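(* Assume $\hat f$ and $\hat g$ have been estimated on an auxiliary data set independent of $(\mathbf X^{(n)},\mathbf Y^{(n)},\mathbf Z^{(n)})$. Let $w:\mathbb R^{d_Z}\to\mathbb R$ be measurable with $|w(z)|\le C$ for all $z$, for some $C>0$. For $P\in\mathcal E_0$ let $\rho_P=\mathbb E_P[\epsilon_P\xi_Pw(Z)]$ and $\sigma_P^2=\operatorname{Var}_P(\epsilon_P\xi_Pw(Z))$. 1. Let $P\in\mathcal E_0$ and assume $A_fA_g=o_P(n^{-1})$, $B_f=o_P(1)$, $B_g=o_P(1)$, $\sigma_P^2>0$ and $\mathbb E_P[\epsilon_P^2\xi_P^2]<\infty$. Then $\sup_{t\in\mathbb R}\big|\mathbb P_P\big(T^{(n)}-\sqrt n\,\rho_P/\tau_D^{(n)}\le t\big)-\Phi(t)\big|\to0$ and $\tau_D^{(n)}-\sigma_P=o_P(1)$. 2. Let $\mathcal P\subset\mathcal E_0$ and assume $A_fA_g=o_{\mathcal P}(n^{-1})$, $B_f=o_{\mathcal P}(1)$, $B_g=o_{\mathcal P}(1)$, $\inf_{P\in\mathcal P}\sigma_P^2>0$ and that there exists $\eta>0$ with $\sup_{P\in\mathcal P}\mathbb E_P[|\epsilon_P\xi_P|^{2+\eta}]<\infty$. Then $\sup_{P\in\mathcal P}\sup_{t\in\mathbb R}\big|\mathbb P_P\big(T^{(n)}-\sqrt n\,\rho_P/\tau_D^{(n)}\le t\big)-\Phi(t)\big|\to0$.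
   Context: Let $X,Y$ be real-valued random variables and $Z$ a random vector in $\mathbb R^{d_Z}$. $\mathcal E_0$ is the set of all distributions of $(X,Y,Z)$ absolutely continuous with respect to Lebesgue measure. For $P\in\mathcal E_0$ let $f_P(z)=\mathbb E_P[X\mid Z=z]$, $g_P(z)=\mathbb E_P[Y\mid Z=z]$, $\epsilon_P=X-f_P(Z)$, $\xi_P=Y-g_P(Z)$, $u_P(z)=\mathbb E_P[\epsilon_P^2\mid Z=z]$, $v_P(z)=\mathbb E_P[\xi_P^2\mid Z=z]$. Let $(x_i,y_i,z_i)$, $i=1,\dots,n$, be i.i.d. copies of $(X,Y,Z)$ forming $(\mathbf X^{(n)},\mathbf Y^{(n)},\mathbf Z^{(n)})$; $\hat f,\hat g$ are estimates of $f_P,g_P$ (regression functions of $X$, resp. $Y$, on $Z$). Define $A_f=\frac1n\sum_{i=1}^n(f_P(z_i)-\hat f(z_i))^2$, $A_g=\frac1n\sum_{i=1}^n(g_P(z_i)-\hat g(z_i))^2$, $B_f=\frac1n\sum_{i=1}^n(f_P(z_i)-\hat f(z_i))^2v_P(z_i)$, $B_g=\frac1n\sum_{i=1}^n(g_P(z_i)-\hat g(z_i))^2u_P(z_i)$. Let $R_i=(x_i-\hat f(z_i))(y_i-\hat g(z_i))w(z_i)$, $\tau_N^{(n)}=\frac1{\sqrt n}\sum_{i=1}^nR_i$, $\tau_D^{(n)}=\big(\frac1n\sum_iR_i^2-(\frac1n\sum_rR_r)^2\big)^{1/2}$, $T^{(n)}=\tau_N^{(n)}/\tau_D^{(n)}$.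 $\Phi$ is the standard normal distribution function. For a family $\mathcal P$, $V_n=o_{\mathcal P}(W_n)$ means $\sup_{P\in\mathcal P}\mathbb P_P(|V_n/W_n|>\delta)\to0$ for all $\delta>0$; $o_P$ is the case $\mathcal P=\{P\}$. *)

theory Defs
  imports "HOL-Probability.Probability"
begin

type_synonym 'z obs = "real \<times> real \<times> 'z"

definition xc :: "'z obs \<Rightarrow> real" where "xc \<omega> = fst \<omega>"
definition yc :: "'z obs \<Rightarrow> real" where "yc \<omega> = fst (snd \<omega>)"
definition zc :: "'z obs \<Rightarrow> 'z" where "zc \<omega> = snd (snd \<omega>)"

definition E0 :: "('z::euclidean_space) obs measure set" where
  "E0 = {P. prob_space P \<and> sets P = sets borel \<and> absolutely_continuous lborel P}"

definition sigZ :: "('z::euclidean_space) obs measure \<Rightarrow> 'z obs measure" where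
  "sigZ P = vimage_algebra (space P) zc borel"

definition cexp :: "('z::euclidean_space) obs measure \<Rightarrow> ('z obs \<Rightarrow> real) \<Rightarrow> 'z \<Rightarrow> real" where
  "cexp P h = (SOME \<phi>. \<phi> \<in> borel_measurable borel \<and>
      (AE \<omega> in P. real_cond_exp P (sigZ P) h \<omega> = \<phi> (zc \<omega>)))"

definition cexp_nn :: "('z::euclidean_space) obs measure \<Rightarrow> ('z obs \<Rightarrow> ennreal) \<Rightarrow> 'z \<Rightarrow> ennreal" where
  "cexp_nn P h = (SOME \<phi>. \<phi> \<in> borel_measurable borel \<and>
      (AE \<omega> in P. nn_cond_exp P (sigZ P) h \<omega> = \<phi> (zc \<omega>)))"

definition fP :: "('z::euclidean_space) obs measure \<Rightarrow> 'z \<Rightarrow> real" where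
  "fP P = cexp P xc"
definition gP :: "('z::euclidean_space) obs measure \<Rightarrow> 'z \<Rightarrow> real" where
  "gP P = cexp P yc"
definition epsP :: "('z::euclidean_space) obs measure \<Rightarrow> 'z obs \<Rightarrow> real" where
  "epsP P \<omega> = xc \<omega> - fP P (zc \<omega>)"
definition xiP :: "('z::euclidean_space) obs measure \<Rightarrow> 'z obs \<Rightarrow> real" where
  "xiP P \<omega> = yc \<omega> - gP P (zc \<omega>)"
definition uP :: "('z::euclidean_space) obs measure \<Rightarrow> 'z \<Rightarrow> ennreal" where
  "uP P = cexp_nn P (\<lambda>\<omega>. ennreal ((epsP P \<omega>)\<^sup>2))"
definition vP :: "('z::euclidean_space) obs measure \<Rightarrow> 'z \<Rightarrow> ennreal" where
  "vP P = cexp_nn P (\<lambda>\<omega>. ennreal ((xiP P \<omega>)\<^sup>2))"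

definition rhoP :: "('z::euclidean_space \<Rightarrow> real) \<Rightarrow> 'z obs measure \<Rightarrow> real" where
  "rhoP w P = prob_space.expectation P (\<lambda>\<omega>. epsP P \<omega> * xiP P \<omega> * w (zc \<omega>))"
definition sigma2P :: "('z::euclidean_space \<Rightarrow> real) \<Rightarrow> 'z obs measure \<Rightarrow> real" where
  "sigma2P w P = prob_space.variance P (\<lambda>\<omega>. epsP P \<omega> * xiP P \<omega> * w (zc \<omega>))"

text \<open>Sample quantities; s i = (x_i, y_i, z_i), fh, gh the (already fitted) estimates.\<close>
definition Rres :: "('z \<Rightarrow> real) \<Rightarrow> ('z \<Rightarrow> real) \<Rightarrow> ('z \<Rightarrow> real) \<Rightarrow> (nat \<Rightarrow> 'z obs) \<Rightarrow> nat \<Rightarrow> real" where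
  "Rres w fh gh s i = (xc (s i) - fh (zc (s i))) * (yc (s i) - gh (zc (s i))) * w (zc (s i))"

definition tauN :: "('z \<Rightarrow> real) \<Rightarrow> ('z \<Rightarrow> real) \<Rightarrow> ('z \<Rightarrow> real) \<Rightarrow> nat \<Rightarrow> (nat \<Rightarrow> 'z obs) \<Rightarrow> real" where
  "tauN w fh gh n s = (\<Sum>i<n. Rres w fh gh s i) / sqrt (real n)"

definition tauD :: "('z \<Rightarrow> real) \<Rightarrow> ('z \<Rightarrow> real) \<Rightarrow> ('z \<Rightarrow> real) \<Rightarrow> nat \<Rightarrow> (nat \<Rightarrow> 'z obs) \<Rightarrow> real" where
  "tauD w fh gh n s = sqrt ((\<Sum>i<n. (Rres w fh gh s i)\<^sup>2) / real n
                          - ((\<Sum>r<n. Rres w fh gh s r) / real n)\<^sup>2)"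

definition Tstat :: "('z \<Rightarrow> real) \<Rightarrow> ('z \<Rightarrow> real) \<Rightarrow> ('z \<Rightarrow> real) \<Rightarrow> nat \<Rightarrow> (nat \<Rightarrow> 'z obs) \<Rightarrow> real" where
  "Tstat w fh gh n s = tauN w fh gh n s / tauD w fh gh n s"

definition Af :: "('z::euclidean_space) obs measure \<Rightarrow> ('z \<Rightarrow> real) \<Rightarrow> nat \<Rightarrow> (nat \<Rightarrow> 'z obs) \<Rightarrow> real" where
  "Af P fh n s = (\<Sum>i<n. (fP P (zc (s i)) - fh (zc (s i)))\<^sup>2) / real n"
definition Ag :: "('z::euclidean_space) obs measure \<Rightarrow> ('z \<Rightarrow> real) \<Rightarrow> nat \<Rightarrow> (nat \<Rightarrow> 'z obs) \<Rightarrow> real" where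
  "Ag P gh n s = (\<Sum>i<n. (gP P (zc (s i)) - gh (zc (s i)))\<^sup>2) / real n"
definition Bf :: "('z::euclidean_space) obs measure \<Rightarrow> ('z \<Rightarrow> real) \<Rightarrow> nat \<Rightarrow> (nat \<Rightarrow> 'z obs) \<Rightarrow> ennreal" where
  "Bf P fh n s = ennreal (1 / real n) *
      (\<Sum>i<n. ennreal ((fP P (zc (s i)) - fh (zc (s i)))\<^sup>2) * vP P (zc (s i)))"
definition Bg :: "('z::euclidean_space) obs measure \<Rightarrow> ('z \<Rightarrow> real) \<Rightarrow> nat \<Rightarrow> (nat \<Rightarrow> 'z obs) \<Rightarrow> ennreal" where
  "Bg P gh n s = ennreal (1 / real n) *
      (\<Sum>i<n. ennreal ((gP P (zc (s i)) - gh (zc (s i)))\<^sup>2) * uP P (zc (s i)))"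

text \<open>Joint law at sample size n: auxiliary data a ~ Aux P n, independent of the
  i.i.d. sample (x_i,y_i,z_i), i < n, from P.\<close>
definition Omega :: "('z obs measure \<Rightarrow> nat \<Rightarrow> 'a measure) \<Rightarrow> ('z::euclidean_space) obs measure \<Rightarrow> nat
    \<Rightarrow> ('a \<times> (nat \<Rightarrow> 'z obs)) measure" where
  "Omega Aux P n = Aux P n \<Otimes>\<^sub>M (\<Pi>\<^sub>M i\<in>{..<n}. P)"

definition Phi :: "real \<Rightarrow> real" where
  "Phi t = cdf (density lborel std_normal_density) t"

end

theory Submission
  imports Defs
begin

text \<open>Write \<open>R\<^sub>i = \<epsilon>\<^sub>i\<xi>\<^sub>iw\<^sub>i + a\<^sub>i + b\<^sub>i + c\<^sub>i\<close>, where \<open>a\<^sub>i\<close> is the product of the two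
  estimation errors and \<open>b\<^sub>i\<close>, \<open>c\<^sub>i\<close> pair one error with the noise of the other regression.
  Cauchy--Schwarz bounds the contribution of \<open>a\<close> by \<open>n A\<^sub>f A\<^sub>g\<close>; given the auxiliary data and the
  \<open>z\<close>-values the \<open>b\<^sub>i\<close> are centred and uncorrelated with average conditional variance at most
  \<open>C\<^sup>2 B\<^sub>f\<close>, and likewise for \<open>c\<close>. The empirical standard deviation is a seminorm, so the
  same three bounds control \<open>\<tau>\<^sub>D\<close>. What is left concerns the i.i.d. variables \<open>\<epsilon>\<^sub>i\<xi>\<^sub>iw\<^sub>i\<close>: a law of
  large numbers and a central limit theorem for triangular arrays whose squares are uniformly
  integrable. Both parts of the theorem are then instances of one statement about an arbitrary
  sequence \<open>P\<^sub>n\<close>: a constant sequence gives the pointwise claim, and arbitrary sequences in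
  \<open>\<PP>\<close> give uniformity.\<close>

text \<open>Three obstacles shape the argument. \<open>Bf\<close> and \<open>Bg\<close> are small
  only in probability: their means may be infinite, and so may the conditional variances, because a
  finite mean of \<open>(epsP P \<omega>)\<^sup>2 * (xiP P \<omega>)\<^sup>2\<close> does not bound
  either factor. Hence the conditional variances live in \<open>ennreal\<close>, and truncated
  second moments replace plain ones. Secondly, the estimates are random, while orthogonality of the
  noise concerns fixed functions of the covariate: bounds are proved for frozen estimates and then
  integrated over the auxiliary data. Thirdly, uniformity over a family fails at some accuracy
  exactly if for infinitely many \<open>n\<close> a violating law can be picked; so limit theorems
  for rows whose law changes with \<open>n\<close> take the place of quantitative rates. Uniform
  integrability of the squares is the common consequence of the two moment assumptions: dominated
  convergence supplies it for one law, the additional \<open>\<eta>\<close> in the exponent for a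
  family. A lower bound on the variances keeps the studentising denominator away from 0 with high
  probability.\<close>

section \<open>Conditional expectations given the covariate\<close>

text \<open>Doob-Dynkin factorisation: true for indicators because the sets of the pulled-back
  sigma-algebra are preimages, and preserved by sums, multiples and increasing limits. It provides
  witnesses for the choices by \<open>SOME\<close> in \<open>cexp\<close> and
  \<open>cexp_nn\<close>, without which nothing would be known of them.\<close>

lemma vimage_algebra_factor_ennreal:
  fixes g :: "'a \<Rightarrow> ennreal"
  assumes g: "g \<in> borel_measurable (vimage_algebra X f N)" and f: "f \<in> X \<rightarrow> space N"
  shows "\<exists>\<phi>\<in>borel_measurable N. \<forall>x\<in>X. g x = \<phi> (f x)"
  using g
proof (induction rule: borel_measurable_induct)
  case (cong f g)
  then show ?case by simp
next
  case (set A)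
  then obtain B where B: "B \<in> sets N" "A = f -` B \<inter> X"
    using sets_vimage_algebra2[OF f] by auto
  have "\<forall>x\<in>X. indicator A x = (indicator B (f x) :: ennreal)"
    by (auto simp: B split: split_indicator)
  with B(1) show ?case by (intro bexI[of _ "indicator B"]) auto
next
  case (mult u c)
  then obtain \<phi> where "\<phi> \<in> borel_measurable N" "\<forall>x\<in>X. u x = \<phi> (f x)" by blast
  then show ?case by (intro bexI[of _ "\<lambda>y. c * \<phi> y"]) auto
next
  case (add u v)
  then obtain \<phi> \<psi> where "\<phi> \<in> borel_measurable N" "\<forall>x\<in>X. u x = \<phi> (f x)"
    "\<psi> \<in> borel_measurable N" "\<forall>x\<in>X. v x = \<psi> (f x)" by blast
  then show ?case by (intro bexI[of _ "\<lambda>y. \<psi> y + \<phi> y"]) auto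
next
  case (seq U)
  then have "\<forall>i. \<exists>\<phi>. \<phi> \<in> borel_measurable N \<and> (\<forall>x\<in>X. U i x = \<phi> (f x))" by blast
  then obtain \<phi> where \<phi>: "\<And>i. \<phi> i \<in> borel_measurable N" "\<And>i x. x \<in> X \<Longrightarrow> U i x = \<phi> i (f x)"
    by metis
  then show ?case
    by (intro bexI[of _ "\<lambda>y. SUP i. \<phi> i y"]) (auto simp: image_comp)
qed

text \<open>\<open>ennreal\<close> cuts off negative values, so the previous lemma applied to
  \<open>g\<close> and to \<open>- g\<close> factors the positive and the negative part
  separately.\<close>

lemma vimage_algebra_factor_real:
  fixes g :: "'a \<Rightarrow> real"
  assumes g: "g \<in> borel_measurable (vimage_algebra X f N)" and f: "f \<in> X \<rightarrow> space N"
  shows "\<exists>\<phi>\<in>borel_measurable N. \<forall>x\<in>X. g x = \<phi> (f x)"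
proof -
  obtain \<phi> where \<phi>: "\<phi> \<in> borel_measurable N" "\<forall>x\<in>X. ennreal (g x) = \<phi> (f x)"
    using vimage_algebra_factor_ennreal[of "\<lambda>x. ennreal (g x)" X f N] g f by auto
  obtain \<psi> where \<psi>: "\<psi> \<in> borel_measurable N" "\<forall>x\<in>X. ennreal (- g x) = \<psi> (f x)"
    using vimage_algebra_factor_ennreal[of "\<lambda>x. ennreal (- g x)" X f N] g f by auto
  have "g x = enn2real (\<phi> (f x)) - enn2real (\<psi> (f x))" if "x \<in> X" for x
    using \<phi>(2) \<psi>(2) that
    by (metis diff_0_right diff_minus_eq_add enn2real_ennreal ennreal_neg enn2real_0 linear
        neg_le_0_iff_le add_0)
  then show ?thesis
    using \<phi>(1) \<psi>(1) by (intro bexI[of _ "\<lambda>y. enn2real (\<phi> y) - enn2real (\<psi> y)"]) auto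
qed

lemma xc_measurable [measurable]: "xc \<in> borel_measurable borel"
  unfolding xc_def[abs_def] by (intro borel_measurable_continuous_onI continuous_intros)

lemma yc_measurable [measurable]: "yc \<in> borel_measurable borel"
  unfolding yc_def[abs_def] by (intro borel_measurable_continuous_onI continuous_intros)

lemma zc_measurable [measurable]: "zc \<in> borel_measurable borel"
  unfolding zc_def[abs_def] by (intro borel_measurable_continuous_onI continuous_intros)

lemma E0_D:
  assumes "P \<in> E0"
  shows "prob_space P" "sets P = sets borel" "space P = UNIV"
  using assms sets_eq_imp_space_eq[of P borel] by (auto simp: E0_def)

locale gcm_dist = prob_space P for P :: "'z::euclidean_space obs measure" +
  assumes sets_P [measurable_cong]: "sets P = sets borel"
begin

lemma subalgebra_sigZ: "subalgebra P (sigZ P)"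
proof -
  have "zc \<in> measurable P borel" by measurable
  then have "sets (sigZ P) \<subseteq> sets P"
    unfolding sigZ_def by (subst sets_vimage_algebra2) (auto simp: measurable_sets)
  then show ?thesis by (auto simp: subalgebra_def sigZ_def)
qed

sublocale sigZ: finite_measure_subalgebra P "sigZ P"
  by standard (rule subalgebra_sigZ)

lemma zc_sigZ: "zc \<in> measurable (sigZ P) borel"
  unfolding sigZ_def by (rule measurable_vimage_algebra1) auto

lemma cexp_props:
  "cexp P h \<in> borel_measurable borel"
  "AE \<omega> in P. real_cond_exp P (sigZ P) h \<omega> = cexp P h (zc \<omega>)"
proof -
  have "\<exists>\<phi>. \<phi> \<in> borel_measurable borel \<and> (AE \<omega> in P. real_cond_exp P (sigZ P) h \<omega> = \<phi> (zc \<omega>))"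
    using vimage_algebra_factor_real[of "real_cond_exp P (sigZ P) h" "space P" zc borel]
    by (force simp: sigZ_def[symmetric])
  then show "cexp P h \<in> borel_measurable borel"
    "AE \<omega> in P. real_cond_exp P (sigZ P) h \<omega> = cexp P h (zc \<omega>)"
    unfolding cexp_def by (rule someI2_ex, blast)+
qed

lemma cexp_nn_props:
  "cexp_nn P h \<in> borel_measurable borel"
  "AE \<omega> in P. nn_cond_exp P (sigZ P) h \<omega> = cexp_nn P h (zc \<omega>)"
proof -
  have "\<exists>\<phi>. \<phi> \<in> borel_measurable borel \<and> (AE \<omega> in P. nn_cond_exp P (sigZ P) h \<omega> = \<phi> (zc \<omega>))"
    using vimage_algebra_factor_ennreal[of "nn_cond_exp P (sigZ P) h" "space P" zc borel]
    by (force simp: sigZ_def[symmetric])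
  then show "cexp_nn P h \<in> borel_measurable borel"
    "AE \<omega> in P. nn_cond_exp P (sigZ P) h \<omega> = cexp_nn P h (zc \<omega>)"
    unfolding cexp_nn_def by (rule someI2_ex, blast)+
qed

lemma fP_measurable [measurable]: "fP P \<in> borel_measurable borel"
  and gP_measurable [measurable]: "gP P \<in> borel_measurable borel"
  and uP_measurable [measurable]: "uP P \<in> borel_measurable borel"
  and vP_measurable [measurable]: "vP P \<in> borel_measurable borel"
  unfolding fP_def gP_def uP_def vP_def by (rule cexp_props cexp_nn_props)+

lemma epsP_measurable [measurable]: "epsP P \<in> borel_measurable borel"
  and xiP_measurable [measurable]: "xiP P \<in> borel_measurable borel"
  unfolding epsP_def[abs_def] xiP_def[abs_def] by measurable

text \<open>The residual has conditional mean 0, and a function of the covariate can be pulled out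
  of a conditional expectation. All cancellation among the error-times-noise terms comes from
  here.\<close>

lemma integral_residual_eq_0:
  fixes \<phi> :: "'z \<Rightarrow> real"
  assumes h: "integrable P h" and [measurable]: "\<phi> \<in> borel_measurable borel"
  shows "(\<integral>\<omega>. \<phi> (zc \<omega>) * (h \<omega> - cexp P h (zc \<omega>)) \<partial>P) = 0"
proof (cases "integrable P (\<lambda>\<omega>. \<phi> (zc \<omega>) * (h \<omega> - cexp P h (zc \<omega>)))")
  \<comment> \<open>A nonintegrable function has Bochner integral 0 by convention.\<close>
  case False
  then show ?thesis by (rule not_integrable_integral_eq)
next
  case int: True
  note [measurable] = zc_sigZ cexp_props(1) borel_measurable_integrable[OF h]
  let ?\<eta> = "\<lambda>\<omega>. h \<omega> - cexp P h (zc \<omega>)"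
  have ic: "integrable P (\<lambda>\<omega>. cexp P h (zc \<omega>))"
    using sigZ.real_cond_exp_int(1)[OF h] cexp_props(2)[of h]
    by (subst integrable_cong_AE[symmetric]) auto
  have "AE \<omega> in P. real_cond_exp P (sigZ P) ?\<eta> \<omega>
      = real_cond_exp P (sigZ P) h \<omega> - real_cond_exp P (sigZ P) (\<lambda>\<omega>. cexp P h (zc \<omega>)) \<omega>"
    by (rule sigZ.real_cond_exp_diff[OF h ic])
  moreover have "AE \<omega> in P. real_cond_exp P (sigZ P) (\<lambda>\<omega>. cexp P h (zc \<omega>)) \<omega> = cexp P h (zc \<omega>)"
    by (rule sigZ.real_cond_exp_F_meas[OF ic]) measurable
  ultimately have *: "AE \<omega> in P. real_cond_exp P (sigZ P) ?\<eta> \<omega> = 0"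
    using cexp_props(2)[of h] by eventually_elim simp
  have "(\<integral>\<omega>. \<phi> (zc \<omega>) * ?\<eta> \<omega> \<partial>P) = (\<integral>\<omega>. \<phi> (zc \<omega>) * real_cond_exp P (sigZ P) ?\<eta> \<omega> \<partial>P)"
    by (rule sigZ.real_cond_exp_intg(2)[symmetric, OF int]) measurable
  also have "\<dots> = 0"
    using * by (intro integral_eq_zero_AE) (auto elim: eventually_mono)
  finally show ?thesis .
qed

text \<open>The nonnegative version of pulling out; it stays valid when the conditional expectation
  takes the value infinity, as \<open>uP\<close> and \<open>vP\<close> may.\<close>

lemma nn_integral_cexp_nn:
  fixes \<phi> :: "'z \<Rightarrow> ennreal"
  assumes [measurable]: "\<phi> \<in> borel_measurable borel" "h \<in> borel_measurable P"
  shows "(\<integral>\<^sup>+\<omega>. \<phi> (zc \<omega>) * h \<omega> \<partial>P) = (\<integral>\<^sup>+\<omega>. \<phi> (zc \<omega>) * cexp_nn P h (zc \<omega>) \<partial>P)"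
proof -
  note [measurable] = zc_sigZ
  have "(\<integral>\<^sup>+\<omega>. \<phi> (zc \<omega>) * h \<omega> \<partial>P) = (\<integral>\<^sup>+\<omega>. \<phi> (zc \<omega>) * nn_cond_exp P (sigZ P) h \<omega> \<partial>P)"
    by (rule sigZ.nn_cond_exp_intg[symmetric]) measurable
  also have "\<dots> = (\<integral>\<^sup>+\<omega>. \<phi> (zc \<omega>) * cexp_nn P h (zc \<omega>) \<partial>P)"
    using cexp_nn_props(2)[of h] by (intro nn_integral_cong_AE) (auto elim: eventually_mono)
  finally show ?thesis .
qed

end

section \<open>Error-times-noise terms\<close>

text \<open>Chebyshev's inequality: expanding the square leaves only the diagonal. Orthogonality is
  assumed instead of independence because the truncated noise terms share a truncation factor and
  need not be independent.\<close>

lemma (in prob_space) prob_uncorrelated_sum_gt: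
  fixes A :: "'i \<Rightarrow> 'a \<Rightarrow> real"
  assumes fin: "finite I" and meas [measurable]: "\<And>i. i \<in> I \<Longrightarrow> A i \<in> borel_measurable M"
    and int: "\<And>i. i \<in> I \<Longrightarrow> integrable M (\<lambda>x. (A i x)\<^sup>2)"
    and orth: "\<And>i j. i \<in> I \<Longrightarrow> j \<in> I \<Longrightarrow> i \<noteq> j \<Longrightarrow> expectation (\<lambda>x. A i x * A j x) = 0"
    and V: "(\<Sum>i\<in>I. expectation (\<lambda>x. (A i x)\<^sup>2)) \<le> V" and \<delta>: "\<delta> > 0"
  shows "prob {x\<in>space M. \<bar>\<Sum>i\<in>I. A i x\<bar> > \<delta>} \<le> V / \<delta>\<^sup>2"
proof -
  have cross: "integrable M (\<lambda>x. A i x * A j x)" if "i \<in> I" "j \<in> I" for i j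
  proof (rule Bochner_Integration.integrable_bound[of _ "\<lambda>x. (A i x)\<^sup>2 + (A j x)\<^sup>2"])
    have "\<bar>a * b\<bar> \<le> a\<^sup>2 + b\<^sup>2" for a b :: real
      using sum_squares_bound[of "\<bar>a\<bar>" "\<bar>b\<bar>"] abs_ge_zero[of "a * b"]
      by (simp only: mult.assoc abs_mult[symmetric] power2_abs)
    then show "AE x in M. norm (A i x * A j x) \<le> norm ((A i x)\<^sup>2 + (A j x)\<^sup>2)"
      by (intro AE_I2) (simp add: add_nonneg_nonneg)
  qed (use that int meas in auto)
  have sq: "(\<Sum>i\<in>I. A i x)\<^sup>2 = (\<Sum>i\<in>I. \<Sum>j\<in>I. A i x * A j x)" for x
    by (simp add: power2_eq_square sum_product)
  have int2: "integrable M (\<lambda>x. (\<Sum>i\<in>I. A i x)\<^sup>2)"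
    unfolding sq using cross by (intro Bochner_Integration.integrable_sum) auto
  have "expectation (\<lambda>x. (\<Sum>i\<in>I. A i x)\<^sup>2)
      = (\<Sum>i\<in>I. \<Sum>j\<in>I. expectation (\<lambda>x. A i x * A j x))"
    unfolding sq using cross
    by (simp add: Bochner_Integration.integral_sum Bochner_Integration.integrable_sum)
  also have "\<dots> = (\<Sum>i\<in>I. \<Sum>j\<in>I. if j = i then expectation (\<lambda>x. (A i x)\<^sup>2) else 0)"
    by (intro sum.cong refl) (auto simp: orth power2_eq_square)
  also have "\<dots> = (\<Sum>i\<in>I. expectation (\<lambda>x. (A i x)\<^sup>2))"
    using fin by simp
  finally have ev: "expectation (\<lambda>x. (\<Sum>i\<in>I. A i x)\<^sup>2) \<le> V" using V by simp
  have [measurable]: "(\<lambda>x. \<Sum>i\<in>I. A i x) \<in> borel_measurable M"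
    by (rule borel_measurable_sum) (rule meas)
  have "prob {x\<in>space M. \<bar>\<Sum>i\<in>I. A i x\<bar> > \<delta>} \<le> prob {x\<in>space M. (\<Sum>i\<in>I. A i x)\<^sup>2 \<ge> \<delta>\<^sup>2}"
    using \<delta> by (intro finite_measure_mono) (auto intro: power2_le_iff_abs_le[THEN iffD2] simp: abs_le_square_iff[symmetric])
  also have "\<dots> \<le> expectation (\<lambda>x. (\<Sum>i\<in>I. A i x)\<^sup>2) / \<delta>\<^sup>2"
    using \<delta> int2 by (intro integral_Markov_inequality_measure[where A="{}"]) auto
  also have "\<dots> \<le> V / \<delta>\<^sup>2"
    using ev by (intro divide_right_mono) auto
  finally show ?thesis .
qed

section \<open>Integrating out a single observation of the sample\<close>

context gcm_dist
begin

sublocale smp: product_prob_space "\<lambda>_::nat. P" "{..<n}" for n :: nat ..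

abbreviation sample :: "nat \<Rightarrow> (nat \<Rightarrow> 'z obs) measure" where
  "sample n \<equiv> PiM {..<n} (\<lambda>_. P)"

lemma prob_space_sample: "prob_space (sample n)"
  by (rule smp.prob_space_axioms)

lemma insert_lessThan: "i < n \<Longrightarrow> insert i ({..<n} - {i}) = {..<n::nat}"
  by auto

lemma component_measurable:
  assumes "i < n" "h \<in> borel_measurable borel"
  shows "(\<lambda>s. h (s i)) \<in> borel_measurable (sample n)"
  by (rule measurable_compose[OF measurable_component_singleton[of i "{..<n}" "\<lambda>_. P"]])
     (use assms in \<open>auto simp: measurable_cong_sets[OF sets_P refl]\<close>)

lemma upd_measurable:
  assumes "i < n" "s \<in> space (PiM ({..<n} - {i}) (\<lambda>_. P))" "h \<in> measurable N borel"
  shows "(\<lambda>y. s(i := h y)) \<in> measurable N (sample n)"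
proof (rule measurable_fun_upd[where J="{..<n} - {i}"])
  show "{..<n} = {..<n} - {i} \<union> {i}" using assms(1) by auto
qed (use assms in \<open>auto simp: measurable_cong_sets[OF refl sets_P]\<close>)

lemma nn_integral_sample_insert:
  assumes "i < n" "H \<in> borel_measurable (sample n)"
  shows "(\<integral>\<^sup>+s. H s \<partial>sample n) = (\<integral>\<^sup>+s. (\<integral>\<^sup>+y. H (s(i := y)) \<partial>P) \<partial>PiM ({..<n} - {i}) (\<lambda>_. P))"
  using smp.product_nn_integral_insert[of "{..<n} - {i}" i H] insert_lessThan[OF assms(1)] assms(2)
  by simp

lemma integral_sample_insert:
  fixes H :: "_ \<Rightarrow> real"
  assumes "i < n" "integrable (sample n) H"
  shows "(\<integral>s. H s \<partial>sample n) = (\<integral>s. (\<integral>y. H (s(i := y)) \<partial>P) \<partial>PiM ({..<n} - {i}) (\<lambda>_. P))"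
  using smp.product_integral_insert[of "{..<n} - {i}" i H] insert_lessThan[OF assms(1)] assms(2)
  by simp

text \<open>Fubini puts observation \<open>i\<close> innermost. Assumption \<open>Hz\<close> encodes
  that \<open>H\<close> sees this observation only through its covariate (the zeros are fillers for
  x and y), so with the other observations frozen \<open>H\<close> is a function of
  \<open>zc y\<close> and the one-observation identity applies.\<close>

lemma integral_sample_residual_eq_0:
  fixes H :: "(nat \<Rightarrow> 'z obs) \<Rightarrow> real"
  assumes i: "i < n" and h: "integrable P h" and H: "H \<in> borel_measurable (sample n)"
    and Hz: "\<And>s y. H (s(i := y)) = H (s(i := (0, 0, zc y)))"
    and int: "integrable (sample n) (\<lambda>s. H s * (h (s i) - cexp P h (zc (s i))))"
  shows "(\<integral>s. H s * (h (s i) - cexp P h (zc (s i))) \<partial>sample n) = 0"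
proof -
  have "(\<integral>y. H (s(i := y)) * (h y - cexp P h (zc y)) \<partial>P) = 0"
    if s: "s \<in> space (PiM ({..<n} - {i}) (\<lambda>_. P))" for s
  proof -
    have "(\<lambda>z. (0, 0, z) :: 'z obs) \<in> borel_measurable borel"
      by (intro borel_measurable_continuous_onI continuous_intros)
    then have "(\<lambda>z. H (s(i := (0, 0, z)))) \<in> borel_measurable borel"
      by (intro measurable_compose[OF upd_measurable[OF i s] H])
    from integral_residual_eq_0[OF h this] show ?thesis by (subst Hz)
  qed
  then show ?thesis
    by (subst integral_sample_insert[OF i int]) (auto intro: integral_eq_zero_AE)
qed

text \<open>The same Fubini argument without cancellation: it lets a squared residual be traded for
  its conditional variance before integrability of either is known.\<close>

lemma nn_integral_sample_cexp_nn:
  fixes H :: "(nat \<Rightarrow> 'z obs) \<Rightarrow> ennreal"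
  assumes i: "i < n" and h: "h \<in> borel_measurable borel" and H: "H \<in> borel_measurable (sample n)"
    and Hz: "\<And>s y. H (s(i := y)) = H (s(i := (0, 0, zc y)))"
  shows "(\<integral>\<^sup>+s. H s * h (s i) \<partial>sample n) = (\<integral>\<^sup>+s. H s * cexp_nn P h (zc (s i)) \<partial>sample n)"
proof -
  have eq: "(\<integral>\<^sup>+y. H (s(i := y)) * h y \<partial>P) = (\<integral>\<^sup>+y. H (s(i := y)) * cexp_nn P h (zc y) \<partial>P)"
    if s: "s \<in> space (PiM ({..<n} - {i}) (\<lambda>_. P))" for s
  proof -
    have "(\<lambda>z. (0, 0, z) :: 'z obs) \<in> borel_measurable borel"
      by (intro borel_measurable_continuous_onI continuous_intros)
    then have "(\<lambda>z. H (s(i := (0, 0, z)))) \<in> borel_measurable borel"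
      by (intro measurable_compose[OF upd_measurable[OF i s] H])
    from nn_integral_cexp_nn[OF this, of h] h show ?thesis
      by (subst (1 2) Hz) (simp add: measurable_cong_sets[OF sets_P refl])
  qed
  have "(\<lambda>\<omega>. cexp_nn P h (zc \<omega>)) \<in> borel_measurable borel"
    using cexp_nn_props(1) by measurable
  then have m: "(\<lambda>s. H s * h (s i)) \<in> borel_measurable (sample n)"
    "(\<lambda>s. H s * cexp_nn P h (zc (s i))) \<in> borel_measurable (sample n)"
    using component_measurable[OF i] h H by (auto intro!: borel_measurable_times_ennreal)
  show ?thesis
    unfolding nn_integral_sample_insert[OF i m(1)] nn_integral_sample_insert[OF i m(2)]
    by (rule nn_integral_cong) (simp only: eq fun_upd_same)
qed

end

text \<open>One locale serves both mixed terms: \<open>h = yc\<close> with \<open>D\<close> the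
  error of \<open>fh\<close> gives \<open>resid = xiP P\<close> and \<open>wvar = Bf P fh n\<close>,
  while \<open>h = xc\<close> with the error of \<open>gh\<close> gives \<open>epsP P\<close> and
  \<open>Bg P gh n\<close>. The estimate inside \<open>D\<close> is a fixed function here.\<close>

locale gcm_term = gcm_dist P for P :: "'z::euclidean_space obs measure" +
  fixes h :: "'z obs \<Rightarrow> real" and D w :: "'z \<Rightarrow> real" and C :: real and n :: nat
  assumes h [measurable]: "h \<in> borel_measurable borel" and int_h: "integrable P h"
    and D [measurable]: "D \<in> borel_measurable borel"
    and w [measurable]: "w \<in> borel_measurable borel" and w_bdd: "\<And>z. \<bar>w z\<bar> \<le> C"
begin

definition resid :: "'z obs \<Rightarrow> real" where
  "resid \<omega> = h \<omega> - cexp P h (zc \<omega>)"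

definition condvar :: "'z \<Rightarrow> ennreal" where
  "condvar = cexp_nn P (\<lambda>\<omega>. ennreal ((resid \<omega>)\<^sup>2))"

definition wvar :: "(nat \<Rightarrow> 'z obs) \<Rightarrow> ennreal" where
  "wvar s = ennreal (1 / real n) * (\<Sum>i<n. ennreal ((D (zc (s i)))\<^sup>2) * condvar (zc (s i)))"

definition wterm :: "(nat \<Rightarrow> 'z obs) \<Rightarrow> nat \<Rightarrow> real" where
  "wterm s i = D (zc (s i)) * resid (s i) * w (zc (s i))"

lemma resid_measurable [measurable]: "resid \<in> borel_measurable borel"
  unfolding resid_def[abs_def] using cexp_props(1)[of h] by measurable

lemma condvar_measurable [measurable]: "condvar \<in> borel_measurable borel"
  unfolding condvar_def by (rule cexp_nn_props)

lemma wvar_measurable [measurable]: "wvar \<in> borel_measurable (sample n)"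
proof -
  have "(\<lambda>s. ennreal ((D (zc (s i)))\<^sup>2) * condvar (zc (s i))) \<in> borel_measurable (sample n)"
    if "i < n" for i
    by (rule component_measurable[OF that, of "\<lambda>\<omega>. ennreal ((D (zc \<omega>))\<^sup>2) * condvar (zc \<omega>)"]) measurable
  then show ?thesis unfolding wvar_def[abs_def] by (intro borel_measurable_times_ennreal borel_measurable_sum) auto
qed

lemma wterm_measurable: "i < n \<Longrightarrow> (\<lambda>s. wterm s i) \<in> borel_measurable (sample n)"
  unfolding wterm_def
  by (rule component_measurable[of _ _ "\<lambda>\<omega>. D (zc \<omega>) * resid \<omega> * w (zc \<omega>)"]) measurable

text \<open>The invariance that admits the truncation factor into the weight \<open>H\<close> of the
  one-observation lemmas.\<close>

lemma wvar_upd: "wvar (s(i := y)) = wvar (s(i := (0, 0, zc y)))"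
proof -
  have "zc ((s(i := y)) j) = zc ((s(i := (0, 0, zc y))) j)" for j by (simp add: zc_def)
  then show ?thesis unfolding wvar_def by simp
qed

text \<open>Truncating on the event that the conditional variance is small, which depends on the
  sample only through its \<open>z\<close>-part, replaces conditioning on the \<open>z\<close>-part.\<close>
definition small :: "real \<Rightarrow> (nat \<Rightarrow> 'z obs) \<Rightarrow> real" where
  "small \<kappa> s = (if wvar s \<le> ennreal \<kappa> then 1 else 0)"

lemma small_measurable [measurable]: "small \<kappa> \<in> borel_measurable (sample n)"
  unfolding small_def[abs_def] by measurable

text \<open>All factors but the squared residual depend on the covariates only, so that square is
  exchanged for \<open>condvar\<close>; after summation the truncation caps \<open>wvar\<close> by
  \<open>\<kappa>\<close>. The computation stays in \<open>ennreal\<close> since integrability is a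
  consequence of this very bound.\<close>

lemma nn_integral_trunc_le:
  assumes n: "n > 0" and "\<kappa> \<ge> 0"
  shows "(\<Sum>i<n. \<integral>\<^sup>+s. ennreal ((small \<kappa> s * wterm s i)\<^sup>2) \<partial>sample n) \<le> ennreal (C\<^sup>2 * (real n * \<kappa>))"
proof -
  let ?H = "\<lambda>i s. ennreal (small \<kappa> s * (D (zc (s i)))\<^sup>2 * (w (zc (s i)))\<^sup>2)"
  have zm: "(\<lambda>s. g (zc (s i))) \<in> borel_measurable (sample n)"
    if "i < n" "g \<in> borel_measurable borel" for i and g :: "'z \<Rightarrow> real"
    by (rule component_measurable[of _ _ "\<lambda>\<omega>. g (zc \<omega>)"]) (use that in measurable)
  have zn: "(\<lambda>s. g (zc (s i))) \<in> borel_measurable (sample n)"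
    if "i < n" "g \<in> borel_measurable borel" for i and g :: "'z \<Rightarrow> ennreal"
    by (rule component_measurable[of _ _ "\<lambda>\<omega>. g (zc \<omega>)"]) (use that in measurable)
  have "(\<integral>\<^sup>+s. ennreal ((small \<kappa> s * wterm s i)\<^sup>2) \<partial>sample n)
      \<le> (\<integral>\<^sup>+s. ennreal (C\<^sup>2) * (ennreal (small \<kappa> s) * (ennreal ((D (zc (s i)))\<^sup>2) * condvar (zc (s i)))) \<partial>sample n)"
    if i: "i < n" for i
  proof -
    have "(\<integral>\<^sup>+s. ennreal ((small \<kappa> s * wterm s i)\<^sup>2) \<partial>sample n)
       = (\<integral>\<^sup>+s. ?H i s * ennreal ((resid (s i))\<^sup>2) \<partial>sample n)"
      by (intro nn_integral_cong)
         (simp add: wterm_def small_def power_mult_distrib mult_ac ennreal_mult[symmetric])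
    also have "\<dots> = (\<integral>\<^sup>+s. ?H i s * condvar (zc (s i)) \<partial>sample n)"
      unfolding condvar_def
    proof (rule nn_integral_sample_cexp_nn[OF i])
      show "?H i \<in> borel_measurable (sample n)"
        using zm[OF i D] zm[OF i w] by measurable
      show "?H i (s(i := y)) = ?H i (s(i := (0, 0, zc y)))" for s y
        using wvar_upd[of s i y] by (simp add: small_def) (simp add: zc_def)
    qed measurable
    also have "\<dots> \<le> (\<integral>\<^sup>+s. ennreal (C\<^sup>2) * (ennreal (small \<kappa> s) * (ennreal ((D (zc (s i)))\<^sup>2) * condvar (zc (s i)))) \<partial>sample n)"
    proof (intro nn_integral_mono)
      fix s
      have "(w (zc (s i)))\<^sup>2 \<le> C\<^sup>2" using w_bdd[of "zc (s i)"]
        by (simp add: power2_le_iff_abs_le order_trans[OF abs_ge_zero])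
      then have "?H i s \<le> ennreal (C\<^sup>2 * (small \<kappa> s * (D (zc (s i)))\<^sup>2))"
        by (intro ennreal_leI) (auto simp: small_def mult.commute[of "C\<^sup>2"] intro: mult_left_mono)
      also have "\<dots> = ennreal (C\<^sup>2) * (ennreal (small \<kappa> s) * ennreal ((D (zc (s i)))\<^sup>2))"
        by (simp add: ennreal_mult small_def)
      finally show "?H i s * condvar (zc (s i)) \<le> ennreal (C\<^sup>2) * (ennreal (small \<kappa> s) * (ennreal ((D (zc (s i)))\<^sup>2) * condvar (zc (s i))))"
        by (metis mult.assoc mult_right_mono zero_le)
    qed
    finally show ?thesis .
  qed
  then have "(\<Sum>i<n. \<integral>\<^sup>+s. ennreal ((small \<kappa> s * wterm s i)\<^sup>2) \<partial>sample n)
      \<le> (\<Sum>i<n. \<integral>\<^sup>+s. ennreal (C\<^sup>2) * (ennreal (small \<kappa> s) * (ennreal ((D (zc (s i)))\<^sup>2) * condvar (zc (s i)))) \<partial>sample n)"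
    by (intro sum_mono) auto
  also have "\<dots> = (\<integral>\<^sup>+s. (\<Sum>i<n. ennreal (C\<^sup>2) * (ennreal (small \<kappa> s) * (ennreal ((D (zc (s i)))\<^sup>2) * condvar (zc (s i))))) \<partial>sample n)"
    using zm[OF _ D] zn[OF _ condvar_measurable]
    by (intro nn_integral_sum[symmetric]) (auto intro!: borel_measurable_times_ennreal)
  also have "\<dots> \<le> (\<integral>\<^sup>+s. ennreal (C\<^sup>2 * (real n * \<kappa>)) \<partial>sample n)"
  proof (intro nn_integral_mono)
    fix s
    have "(\<Sum>i<n. ennreal ((D (zc (s i)))\<^sup>2) * condvar (zc (s i))) = ennreal (real n) * wvar s"
      using n unfolding wvar_def mult.assoc[symmetric] by (simp add: ennreal_mult[symmetric])
    then have "(\<Sum>i<n. ennreal (C\<^sup>2) * (ennreal (small \<kappa> s) * (ennreal ((D (zc (s i)))\<^sup>2) * condvar (zc (s i)))))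
       = ennreal (C\<^sup>2) * (ennreal (small \<kappa> s) * (ennreal (real n) * wvar s))"
      by (simp add: sum_distrib_left[symmetric])
    also have "\<dots> = ennreal (C\<^sup>2) * (ennreal (real n) * (ennreal (small \<kappa> s) * wvar s))"
      by (simp add: mult_ac)
    \<comment> \<open>Off the truncation event \<open>wvar s\<close> may be infinite; the product is
      still 0 because 0 times infinity is 0 in \<open>ennreal\<close>.\<close>
    also have "\<dots> \<le> ennreal (C\<^sup>2) * (ennreal (real n) * ennreal \<kappa>)"
      by (intro mult_left_mono) (auto simp: small_def)
    also have "\<dots> = ennreal (C\<^sup>2 * (real n * \<kappa>))"
      using assms by (simp add: ennreal_mult)
    finally show "(\<Sum>i<n. ennreal (C\<^sup>2) * (ennreal (small \<kappa> s) * (ennreal ((D (zc (s i)))\<^sup>2) * condvar (zc (s i))))) \<le> ennreal (C\<^sup>2 * (real n * \<kappa>))" .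
  qed
  also have "\<dots> = ennreal (C\<^sup>2 * (real n * \<kappa>))"
    by (simp add: smp.emeasure_space_1)
  finally show ?thesis .
qed

lemma trunc_moments:
  assumes n: "n > 0" and \<kappa>: "\<kappa> \<ge> 0"
  shows "\<And>i. i < n \<Longrightarrow> integrable (sample n) (\<lambda>s. (small \<kappa> s * wterm s i)\<^sup>2)"
    and "(\<Sum>i<n. \<integral>s. (small \<kappa> s * wterm s i)\<^sup>2 \<partial>sample n) \<le> C\<^sup>2 * (real n * \<kappa>)"
proof -
  note le = nn_integral_trunc_le[OF n \<kappa>]
  show int: "integrable (sample n) (\<lambda>s. (small \<kappa> s * wterm s i)\<^sup>2)" if i: "i < n" for i
  proof (rule integrableI_bounded)
    show "(\<lambda>s. (small \<kappa> s * wterm s i)\<^sup>2) \<in> borel_measurable (sample n)"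
      using wterm_measurable[OF i] by measurable
    have "(\<integral>\<^sup>+s. ennreal ((small \<kappa> s * wterm s i)\<^sup>2) \<partial>sample n)
       \<le> (\<Sum>i<n. \<integral>\<^sup>+s. ennreal ((small \<kappa> s * wterm s i)\<^sup>2) \<partial>sample n)"
      using i by (intro member_le_sum) auto
    also note le
    finally show "(\<integral>\<^sup>+s. ennreal (norm ((small \<kappa> s * wterm s i)\<^sup>2)) \<partial>sample n) < \<infinity>"
      by (simp add: le_less_trans)
  qed
  have "ennreal (\<Sum>i<n. \<integral>s. (small \<kappa> s * wterm s i)\<^sup>2 \<partial>sample n)
      = (\<Sum>i<n. \<integral>\<^sup>+s. ennreal ((small \<kappa> s * wterm s i)\<^sup>2) \<partial>sample n)"
    using int by (subst sum_ennreal[symmetric]) (auto simp: nn_integral_eq_integral)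
  with le have "ennreal (\<Sum>i<n. \<integral>s. (small \<kappa> s * wterm s i)\<^sup>2 \<partial>sample n) \<le> ennreal (C\<^sup>2 * (real n * \<kappa>))"
    by simp
  then show "(\<Sum>i<n. \<integral>s. (small \<kappa> s * wterm s i)\<^sup>2 \<partial>sample n) \<le> C\<^sup>2 * (real n * \<kappa>)"
    using \<kappa> by (subst (asm) ennreal_le_iff) auto
qed

text \<open>\<open>wterm s j\<close> does not involve observation \<open>i\<close>, and
  \<open>small\<close> sees it only through its covariate. So the residual of observation
  \<open>i\<close> is multiplied by a weight that meets \<open>Hz\<close>, and the integral
  vanishes.\<close>

lemma trunc_orthogonal:
  assumes n: "n > 0" and \<kappa>: "\<kappa> \<ge> 0" and ij: "i < n" "j < n" "i \<noteq> j"
  shows "(\<integral>s. (small \<kappa> s * wterm s i) * (small \<kappa> s * wterm s j) \<partial>sample n) = 0"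
proof (cases "integrable (sample n) (\<lambda>s. (small \<kappa> s * wterm s i) * (small \<kappa> s * wterm s j))")
  case True
  let ?H = "\<lambda>s. small \<kappa> s * D (zc (s i)) * w (zc (s i)) * (small \<kappa> s * wterm s j)"
  have zm: "(\<lambda>s. g (zc (s i))) \<in> borel_measurable (sample n)"
    if "g \<in> borel_measurable borel" for g :: "'z \<Rightarrow> real"
    by (rule component_measurable[of _ _ "\<lambda>\<omega>. g (zc \<omega>)"]) (use that ij in measurable)
  have eq: "(\<lambda>s. (small \<kappa> s * wterm s i) * (small \<kappa> s * wterm s j))
     = (\<lambda>s. ?H s * (h (s i) - cexp P h (zc (s i))))"
    by (simp add: wterm_def[of _ i] resid_def mult_ac)
  have "?H \<in> borel_measurable (sample n)"
    using zm[OF D] zm[OF w] wterm_measurable[OF ij(2)] by measurable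
  moreover have "?H (s(i := y)) = ?H (s(i := (0, 0, zc y)))" for s y
    using wvar_upd[of s i y] ij by (simp add: small_def wterm_def) (simp add: zc_def)
  ultimately show ?thesis
    using True unfolding eq by (intro integral_sample_residual_eq_0[OF ij(1) int_h])
qed (rule not_integrable_integral_eq)

text \<open>Where \<open>wvar s\<close> is at most \<open>\<kappa>\<close> truncation changes
  nothing, and the remaining samples are charged to the first probability. The variance bound of
  order \<open>n * \<kappa>\<close> in Chebyshev's inequality is cancelled by the normalisation
  \<open>sqrt (real n)\<close>.\<close>

lemma prob_wterm_sum_gt:
  assumes n: "n > 0" and \<kappa>: "\<kappa> \<ge> 0" and \<delta>: "\<delta> > 0"
  shows "measure (sample n) {s\<in>space (sample n). \<bar>\<Sum>i<n. wterm s i\<bar> / sqrt (real n) > \<delta>}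
     \<le> measure (sample n) {s\<in>space (sample n). wvar s > ennreal \<kappa>} + C\<^sup>2 * \<kappa> / \<delta>\<^sup>2"
proof -
  let ?A = "{s\<in>space (sample n). wvar s > ennreal \<kappa>}"
  let ?B = "{s\<in>space (sample n). \<bar>\<Sum>i<n. small \<kappa> s * wterm s i\<bar> > \<delta> * sqrt (real n)}"
  note [measurable] = wterm_measurable
  have B: "?B \<in> sets (sample n)" by measurable
  have "measure (sample n) {s\<in>space (sample n). \<bar>\<Sum>i<n. wterm s i\<bar> / sqrt (real n) > \<delta>} \<le> measure (sample n) (?A \<union> ?B)"
    using n B by (intro smp.finite_measure_mono) (auto simp: small_def field_simps)
  also have "\<dots> \<le> measure (sample n) ?A + measure (sample n) ?B"
    by (rule measure_Un_le) (use B in measurable)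
  also have "measure (sample n) ?B \<le> (C\<^sup>2 * (real n * \<kappa>)) / (\<delta> * sqrt (real n))\<^sup>2"
    using trunc_moments[OF n \<kappa>] trunc_orthogonal[OF n \<kappa>] n \<delta>
    by (intro smp.prob_uncorrelated_sum_gt) auto
  also have "\<dots> = C\<^sup>2 * \<kappa> / \<delta>\<^sup>2"
    using n by (simp add: power_mult_distrib)
  finally show ?thesis by simp
qed

text \<open>Markov's inequality on the same truncated second moments. The previous lemma serves
  \<open>tauN\<close>, this one \<open>tauD\<close>.\<close>

lemma prob_wterm_squares_gt:
  assumes n: "n > 0" and \<kappa>: "\<kappa> \<ge> 0" and \<delta>: "\<delta> > 0"
  shows "measure (sample n) {s\<in>space (sample n). (\<Sum>i<n. (wterm s i)\<^sup>2) / real n > \<delta>}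
     \<le> measure (sample n) {s\<in>space (sample n). wvar s > ennreal \<kappa>} + C\<^sup>2 * \<kappa> / \<delta>"
proof -
  let ?A = "{s\<in>space (sample n). wvar s > ennreal \<kappa>}"
  let ?B = "{s\<in>space (sample n). (\<Sum>i<n. (small \<kappa> s * wterm s i)\<^sup>2) \<ge> \<delta> * real n}"
  note [measurable] = wterm_measurable
  have B: "?B \<in> sets (sample n)" by measurable
  have "measure (sample n) {s\<in>space (sample n). (\<Sum>i<n. (wterm s i)\<^sup>2) / real n > \<delta>} \<le> measure (sample n) (?A \<union> ?B)"
    using n B by (intro smp.finite_measure_mono) (auto simp: small_def field_simps)
  also have "\<dots> \<le> measure (sample n) ?A + measure (sample n) ?B"
    by (rule measure_Un_le) (use B in measurable)
  also have "measure (sample n) ?B \<le> integral\<^sup>L (sample n) (\<lambda>s. \<Sum>i<n. (small \<kappa> s * wterm s i)\<^sup>2) / (\<delta> * real n)"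
    using n \<delta> trunc_moments(1)[OF n \<kappa>]
    by (intro integral_Markov_inequality_measure[where A="{}"]) (auto intro!: AE_I2 sum_nonneg)
  also have "\<dots> \<le> (C\<^sup>2 * (real n * \<kappa>)) / (\<delta> * real n)"
    using trunc_moments[OF n \<kappa>] n \<delta> by (intro divide_right_mono) auto
  also have "\<dots> = C\<^sup>2 * \<kappa> / \<delta>"
    using n by simp
  finally show ?thesis by simp
qed

end

section \<open>The empirical standard deviation\<close>

definition esd :: "nat \<Rightarrow> (nat \<Rightarrow> real) \<Rightarrow> real" where
  "esd n X = sqrt ((\<Sum>i<n. (X i)\<^sup>2) / real n - ((\<Sum>i<n. X i) / real n)\<^sup>2)"

lemma sum_centered_squares:
  fixes X :: "nat \<Rightarrow> real"
  assumes "n > 0"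
  defines "m \<equiv> (\<Sum>i<n. X i) / real n"
  shows "(\<Sum>i<n. (X i - m)\<^sup>2) = (\<Sum>i<n. (X i)\<^sup>2) - real n * m\<^sup>2"
proof -
  have "(\<Sum>i<n. (X i - m)\<^sup>2) = (\<Sum>i<n. (X i)\<^sup>2) - 2 * m * (\<Sum>i<n. X i) + real n * m\<^sup>2"
    by (simp add: power2_diff sum.distrib sum_subtractf sum_distrib_left mult_ac)
  moreover have "(\<Sum>i<n. X i) = real n * m" using assms by simp
  ultimately show ?thesis by (simp add: power2_eq_square)
qed

text \<open>Centring turns the empirical variance into a squared Euclidean norm, which makes
  Minkowski's inequality available.\<close>

lemma esd_eq_L2_set:
  assumes "n > 0"
  shows "esd n X = L2_set (\<lambda>i. X i - (\<Sum>i<n. X i) / real n) {..<n} / sqrt (real n)"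
proof -
  have "(\<Sum>i<n. (X i)\<^sup>2) / real n - ((\<Sum>i<n. X i) / real n)\<^sup>2
      = (\<Sum>i<n. (X i - (\<Sum>i<n. X i) / real n)\<^sup>2) / real n"
    unfolding sum_centered_squares[OF assms] using assms by (simp add: diff_divide_distrib)
  then show ?thesis unfolding esd_def L2_set_def by (simp add: real_sqrt_divide)
qed

lemma esd_nonneg: "n > 0 \<Longrightarrow> esd n X \<ge> 0"
  by (simp add: esd_eq_L2_set L2_set_nonneg)

lemma esd_square:
  assumes "n > 0"
  shows "(esd n X)\<^sup>2 = (\<Sum>i<n. (X i)\<^sup>2) / real n - ((\<Sum>i<n. X i) / real n)\<^sup>2"
proof -
  have "(\<Sum>i<n. (X i)\<^sup>2) - real n * ((\<Sum>i<n. X i) / real n)\<^sup>2 \<ge> 0"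
    unfolding sum_centered_squares[OF assms, symmetric] by (intro sum_nonneg) auto
  then have "((\<Sum>i<n. (X i)\<^sup>2) - real n * ((\<Sum>i<n. X i) / real n)\<^sup>2) / real n \<ge> 0"
    by simp
  then show ?thesis unfolding esd_def using assms by (simp add: diff_divide_distrib)
qed

text \<open>Minkowski on the centred vectors; the difference may then be left uncentred, because
  subtracting its mean can only lower its norm.\<close>

lemma esd_le_esd_add:
  assumes n: "n > 0"
  shows "esd n X \<le> esd n Y + L2_set (\<lambda>i. X i - Y i) {..<n} / sqrt (real n)"
proof -
  let ?m = "\<lambda>X. (\<Sum>i<n. X i) / real n"
  let ?D = "\<lambda>i. X i - Y i"
  have "L2_set (\<lambda>i. X i - ?m X) {..<n} = L2_set (\<lambda>i. (Y i - ?m Y) + (?D i - ?m ?D)) {..<n}"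
    by (intro L2_set_cong refl) (simp add: sum_subtractf diff_divide_distrib)
  also have "\<dots> \<le> L2_set (\<lambda>i. Y i - ?m Y) {..<n} + L2_set (\<lambda>i. ?D i - ?m ?D) {..<n}"
    by (rule L2_set_triangle_ineq)
  also have "L2_set (\<lambda>i. ?D i - ?m ?D) {..<n} \<le> L2_set ?D {..<n}"
    unfolding L2_set_def sum_centered_squares[OF n] by simp
  finally show ?thesis
    using n by (simp add: esd_eq_L2_set add_divide_distrib[symmetric] divide_right_mono)
qed

lemma abs_esd_diff_le:
  assumes "n > 0"
  shows "\<bar>esd n X - esd n Y\<bar> \<le> L2_set (\<lambda>i. X i - Y i) {..<n} / sqrt (real n)"
proof -
  have "L2_set (\<lambda>i. Y i - X i) {..<n} = L2_set (\<lambda>i. X i - Y i) {..<n}"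
    by (simp add: L2_set_def power2_commute)
  with esd_le_esd_add[OF assms, of X Y] esd_le_esd_add[OF assms, of Y X] show ?thesis by auto
qed

text \<open>Both bounds reduce to \<open>C\<^sup>2\<close> times the product of the two sums of
  squares, which \<open>q\<close> controls. For the sum this is Cauchy-Schwarz; for the squares each
  single \<open>(e i)\<^sup>2\<close> is bounded by the full sum, which is crude but of the right
  order.\<close>

lemma weighted_product_bounds:
  fixes d e v :: "nat \<Rightarrow> real"
  assumes n: "n > 0" and v: "\<And>i. i < n \<Longrightarrow> \<bar>v i\<bar> \<le> C"
    and q: "(\<Sum>i<n. (d i)\<^sup>2) / real n * ((\<Sum>i<n. (e i)\<^sup>2) / real n) * real n \<le> \<kappa>"
    and \<kappa>: "C\<^sup>2 * \<kappa> \<le> \<delta>\<^sup>2" and \<delta>: "\<delta> \<ge> 0"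
  shows "\<bar>\<Sum>i<n. d i * e i * v i\<bar> / sqrt (real n) \<le> \<delta>"
    and "(\<Sum>i<n. (d i * e i * v i)\<^sup>2) / real n \<le> \<delta>\<^sup>2"
proof -
  let ?A = "\<Sum>i<n. (d i)\<^sup>2" and ?B = "\<Sum>i<n. (e i)\<^sup>2"
  have AB: "C\<^sup>2 * (?A * ?B) \<le> \<delta>\<^sup>2 * real n"
  proof -
    have "?A * ?B / real n \<le> \<kappa>" using q n by (simp add: field_simps)
    then have "C\<^sup>2 * (?A * ?B / real n) \<le> C\<^sup>2 * \<kappa>" by (intro mult_left_mono) auto
    with \<kappa> have "C\<^sup>2 * (?A * ?B) / real n \<le> \<delta>\<^sup>2" by simp
    then show ?thesis using n by (simp add: pos_divide_le_eq)
  qed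
  have C: "C \<ge> 0" using v[OF n] by linarith
  have v2: "(v i)\<^sup>2 \<le> C\<^sup>2" if "i < n" for i
    using v[OF that] C by (simp add: power2_le_iff_abs_le)
  have "(\<Sum>i<n. d i * (e i * v i))\<^sup>2 \<le> ?A * (\<Sum>i<n. (e i * v i)\<^sup>2)"
    by (rule Cauchy_Schwarz_ineq_sum)
  also have "\<dots> \<le> ?A * (\<Sum>i<n. C\<^sup>2 * (e i)\<^sup>2)"
    using v2 by (intro mult_left_mono sum_mono sum_nonneg)
      (auto simp: power_mult_distrib mult.commute[of "(e _)\<^sup>2"] intro: mult_right_mono)
  also have "\<dots> = C\<^sup>2 * (?A * ?B)"
    by (simp add: sum_distrib_left[symmetric])
  also note AB
  finally have "(\<Sum>i<n. d i * (e i * v i))\<^sup>2 \<le> (\<delta> * sqrt (real n))\<^sup>2"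
    by (simp add: power_mult_distrib)
  then have "\<bar>\<Sum>i<n. d i * e i * v i\<bar> \<le> \<delta> * sqrt (real n)"
    using \<delta> by (simp add: power2_le_iff_abs_le mult.assoc)
  then show "\<bar>\<Sum>i<n. d i * e i * v i\<bar> / sqrt (real n) \<le> \<delta>"
    using n by (simp add: pos_divide_le_eq)
  have "(\<Sum>i<n. (d i * e i * v i)\<^sup>2) \<le> (\<Sum>i<n. C\<^sup>2 * ((d i)\<^sup>2 * ?B))"
  proof (intro sum_mono)
    fix i assume i: "i \<in> {..<n}"
    have "(d i * e i * v i)\<^sup>2 = (v i)\<^sup>2 * ((d i)\<^sup>2 * (e i)\<^sup>2)"
      by (simp add: power_mult_distrib)
    also have "\<dots> \<le> C\<^sup>2 * ((d i)\<^sup>2 * ?B)"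
      using i v2[of i] by (intro mult_mono member_le_sum) (auto intro: mult_nonneg_nonneg sum_nonneg)
    finally show "(d i * e i * v i)\<^sup>2 \<le> C\<^sup>2 * ((d i)\<^sup>2 * ?B)" .
  qed
  also have "\<dots> = C\<^sup>2 * (?A * ?B)"
    by (simp add: sum_distrib_left[symmetric] sum_distrib_right[symmetric])
  also note AB
  finally show "(\<Sum>i<n. (d i * e i * v i)\<^sup>2) / real n \<le> \<delta>\<^sup>2"
    using n by (simp add: pos_divide_le_eq)
qed

lemma remainder_bounds:
  fixes R S a b c :: "nat \<Rightarrow> real"
  assumes n: "n > 0" and \<delta>: "\<delta> \<ge> 0"
    and R: "\<And>i. R i = S i + a i + b i + c i"
    and s: "\<bar>\<Sum>i<n. a i\<bar> / sqrt (real n) \<le> \<delta>" "\<bar>\<Sum>i<n. b i\<bar> / sqrt (real n) \<le> \<delta>"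
      "\<bar>\<Sum>i<n. c i\<bar> / sqrt (real n) \<le> \<delta>"
    and q: "(\<Sum>i<n. (a i)\<^sup>2) / real n \<le> \<delta>\<^sup>2" "(\<Sum>i<n. (b i)\<^sup>2) / real n \<le> \<delta>\<^sup>2"
      "(\<Sum>i<n. (c i)\<^sup>2) / real n \<le> \<delta>\<^sup>2"
  shows "\<bar>(\<Sum>i<n. R i) / sqrt (real n) - (\<Sum>i<n. S i) / sqrt (real n)\<bar> \<le> 3 * \<delta>"
    and "\<bar>esd n R - esd n S\<bar> \<le> 3 * \<delta>"
proof -
  have "(\<Sum>i<n. R i) / sqrt (real n) - (\<Sum>i<n. S i) / sqrt (real n)
     = (\<Sum>i<n. a i) / sqrt (real n) + (\<Sum>i<n. b i) / sqrt (real n) + (\<Sum>i<n. c i) / sqrt (real n)"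
    by (simp add: R sum.distrib add_divide_distrib)
  moreover have "\<bar>(\<Sum>i<n. a i) / sqrt (real n)\<bar> \<le> \<delta>" "\<bar>(\<Sum>i<n. b i) / sqrt (real n)\<bar> \<le> \<delta>"
    "\<bar>(\<Sum>i<n. c i) / sqrt (real n)\<bar> \<le> \<delta>"
    using s by simp_all
  ultimately show "\<bar>(\<Sum>i<n. R i) / sqrt (real n) - (\<Sum>i<n. S i) / sqrt (real n)\<bar> \<le> 3 * \<delta>"
    by linarith
  have L: "L2_set x {..<n} / sqrt (real n) \<le> \<delta>" if "(\<Sum>i<n. (x i)\<^sup>2) / real n \<le> \<delta>\<^sup>2" for x :: "nat \<Rightarrow> real"
    using real_sqrt_le_mono[OF that] \<delta> by (simp add: L2_set_def real_sqrt_divide)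
  have "\<bar>esd n R - esd n S\<bar> \<le> L2_set (\<lambda>i. (a i + b i) + c i) {..<n} / sqrt (real n)"
    using abs_esd_diff_le[OF n, of R S] by (simp add: R add.assoc)
  also have "\<dots> \<le> (L2_set a {..<n} + L2_set b {..<n} + L2_set c {..<n}) / sqrt (real n)"
    by (intro divide_right_mono order_trans[OF L2_set_triangle_ineq] add_right_mono) (auto intro: L2_set_triangle_ineq)
  also have "\<dots> \<le> 3 * \<delta>"
    using L[OF q(1)] L[OF q(2)] L[OF q(3)] by (simp add: add_divide_distrib)
  finally show "\<bar>esd n R - esd n S\<bar> \<le> 3 * \<delta>" .
qed

section \<open>Probability of a large remainder\<close>

text \<open>Fubini for an indicator. Independence of auxiliary data and sample enters here: a
  section is judged by the unchanged sample law, with the estimates frozen.\<close>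

lemma (in pair_prob_space) prob_eq_integral_sections:
  assumes Q: "Q \<in> sets (M1 \<Otimes>\<^sub>M M2)"
  shows "integrable M1 (\<lambda>a. M2.prob (Pair a -` Q))"
    and "prob Q = (\<integral>a. M2.prob (Pair a -` Q) \<partial>M1)"
proof -
  have int: "integrable (M1 \<Otimes>\<^sub>M M2) (indicator Q :: _ \<Rightarrow> real)"
    using Q by (simp add: integrable_indicator_iff emeasure_finite less_top[symmetric])
  have eq: "(\<integral>b. indicator Q (a, b) \<partial>M2) = M2.prob (Pair a -` Q)" for a
  proof -
    have "(\<integral>b. indicator Q (a, b) \<partial>M2) = (\<integral>b. indicator (Pair a -` Q) b \<partial>M2)"
      by (intro Bochner_Integration.integral_cong) (auto split: split_indicator)
    also have "\<dots> = M2.prob (Pair a -` Q)"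
      using sets_Pair1[OF Q] sets.sets_into_space[OF sets_Pair1[OF Q]] by (simp add: Int_absorb2)
    finally show ?thesis .
  qed
  show "integrable M1 (\<lambda>a. M2.prob (Pair a -` Q))"
    using integrable_fst'[OF int] by (simp add: eq)
  show "prob Q = (\<integral>a. M2.prob (Pair a -` Q) \<partial>M1)"
    using integral_fst'[OF int] Q sets.sets_into_space[OF Q] by (simp add: eq Int_absorb2)
qed

context gcm_dist
begin

definition Sprod :: "('z \<Rightarrow> real) \<Rightarrow> 'z obs \<Rightarrow> real" where
  "Sprod w \<omega> = epsP P \<omega> * xiP P \<omega> * w (zc \<omega>)"

lemma Sprod_measurable [measurable]:
  assumes [measurable]: "w \<in> borel_measurable borel"
  shows "Sprod w \<in> borel_measurable borel"
  unfolding Sprod_def[abs_def] by measurable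

definition remainder_large :: "('z \<Rightarrow> real) \<Rightarrow> ('z \<Rightarrow> real) \<Rightarrow> ('z \<Rightarrow> real) \<Rightarrow> nat \<Rightarrow> real
    \<Rightarrow> (nat \<Rightarrow> 'z obs) \<Rightarrow> bool" where
  "remainder_large w fh gh n \<delta> s \<longleftrightarrow>
     \<bar>tauN w fh gh n s - (\<Sum>i<n. Sprod w (s i)) / sqrt (real n)\<bar> > \<delta> \<or>
     \<bar>tauD w fh gh n s - esd n (\<lambda>i. Sprod w (s i))\<bar> > \<delta>"

lemma tauD_eq_esd: "tauD w fh gh n s = esd n (Rres w fh gh s)"
  by (simp add: tauD_def esd_def)

text \<open>Five bad events: one for the product of errors, and for each mixed term one for its sum
  and one for its squares. Each mixed term thus pays its \<open>Bf\<close> or \<open>Bg\<close> tail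
  twice and \<open>C\<^sup>2 * \<kappa> / \<delta>\<^sup>2\<close> twice, whence the factors 2, 2
  and 4. Three remainder pieces of size \<open>\<delta>\<close> make the threshold
  \<open>3 * \<delta>\<close>; squares are tested at \<open>\<delta>\<^sup>2\<close> since their
  root enters the deviation of \<open>tauD\<close>.\<close>

lemma prob_remainder_large_le:
  assumes fh [measurable]: "fh \<in> borel_measurable borel"
    and gh [measurable]: "gh \<in> borel_measurable borel"
    and w [measurable]: "w \<in> borel_measurable borel" and w_bdd: "\<And>z. \<bar>w z\<bar> \<le> C"
    and int_x: "integrable P xc" and int_y: "integrable P yc"
    and n: "n > 0" and \<kappa>: "\<kappa> > 0" and \<delta>: "\<delta> > 0" and \<kappa>\<delta>: "C\<^sup>2 * \<kappa> \<le> \<delta>\<^sup>2"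
  shows "measure (sample n) {s\<in>space (sample n). remainder_large w fh gh n (3 * \<delta>) s}
    \<le> measure (sample n) {s\<in>space (sample n). \<bar>Af P fh n s * Ag P gh n s * real n\<bar> > \<kappa>}
     + 2 * measure (sample n) {s\<in>space (sample n). Bf P fh n s > ennreal \<kappa>}
     + 2 * measure (sample n) {s\<in>space (sample n). Bg P gh n s > ennreal \<kappa>}
     + 4 * (C\<^sup>2 * \<kappa> / \<delta>\<^sup>2)"
proof -
  interpret F: gcm_term P yc "\<lambda>z. fP P z - fh z" w C n
    by standard (use int_y w_bdd in measurable)
  interpret G: gcm_term P xc "\<lambda>z. gP P z - gh z" w C n
    by standard (use int_x w_bdd in measurable)
  have F: "F.resid = xiP P" "G.resid = epsP P"
    by (auto simp: F.resid_def G.resid_def xiP_def epsP_def gP_def fP_def fun_eq_iff)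
  have B: "F.wvar = Bf P fh n" "G.wvar = Bg P gh n"
    by (auto simp: F.wvar_def G.wvar_def F.condvar_def G.condvar_def F Bf_def Bg_def vP_def uP_def fun_eq_iff)
  note [measurable] = F.wterm_measurable G.wterm_measurable F.wvar_measurable G.wvar_measurable
  have zm: "(\<lambda>s. g (zc (s i))) \<in> borel_measurable (sample n)"
    if "i < n" "g \<in> borel_measurable borel" for g :: "'z \<Rightarrow> real" and i
    by (rule component_measurable[of _ _ "\<lambda>\<omega>. g (zc \<omega>)"]) (use that in measurable)
  have [measurable]: "Af P fh n \<in> borel_measurable (sample n)" "Ag P gh n \<in> borel_measurable (sample n)"
    unfolding Af_def[abs_def] Ag_def[abs_def]
    using zm[of _ "\<lambda>z. (fP P z - fh z)\<^sup>2"] zm[of _ "\<lambda>z. (gP P z - gh z)\<^sup>2"] by measurable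
  define Q where "Q = {s\<in>space (sample n). \<bar>Af P fh n s * Ag P gh n s * real n\<bar> > \<kappa>}"
  define B1 where "B1 = {s\<in>space (sample n). \<bar>\<Sum>i<n. F.wterm s i\<bar> / sqrt (real n) > \<delta>}"
  define B2 where "B2 = {s\<in>space (sample n). \<bar>\<Sum>i<n. G.wterm s i\<bar> / sqrt (real n) > \<delta>}"
  define B3 where "B3 = {s\<in>space (sample n). (\<Sum>i<n. (F.wterm s i)\<^sup>2) / real n > \<delta>\<^sup>2}"
  define B4 where "B4 = {s\<in>space (sample n). (\<Sum>i<n. (G.wterm s i)\<^sup>2) / real n > \<delta>\<^sup>2}"
  note defs = Q_def B1_def B2_def B3_def B4_def
  have sets: "Q \<in> sets (sample n)" "B1 \<in> sets (sample n)" "B2 \<in> sets (sample n)"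
    "B3 \<in> sets (sample n)" "B4 \<in> sets (sample n)"
    unfolding defs by measurable
  have "\<not> remainder_large w fh gh n (3 * \<delta>) s" if s: "s \<in> space (sample n)" "s \<notin> Q" "s \<notin> B1" "s \<notin> B2" "s \<notin> B3" "s \<notin> B4" for s
  proof -
    let ?d = "\<lambda>i. fP P (zc (s i)) - fh (zc (s i))" and ?e = "\<lambda>i. gP P (zc (s i)) - gh (zc (s i))"
    let ?a = "\<lambda>i. ?d i * ?e i * w (zc (s i))"
    have q: "(\<Sum>i<n. (?d i)\<^sup>2) / real n * ((\<Sum>i<n. (?e i)\<^sup>2) / real n) * real n \<le> \<kappa>"
      using s by (auto simp: Q_def Af_def Ag_def)
    note a = weighted_product_bounds[OF n w_bdd q \<kappa>\<delta> less_imp_le[OF \<delta>]]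
    have R: "Rres w fh gh s i = Sprod w (s i) + ?a i + F.wterm s i + G.wterm s i" for i
      by (simp add: Rres_def Sprod_def F.wterm_def G.wterm_def F epsP_def xiP_def algebra_simps)
    show ?thesis
      using remainder_bounds[of n \<delta> "Rres w fh gh s" "\<lambda>i. Sprod w (s i)" ?a "F.wterm s" "G.wterm s", OF n _ R] a s \<delta>
      unfolding remainder_large_def tauD_eq_esd tauN_def defs by (auto simp: not_less)
  qed
  then have "{s\<in>space (sample n). remainder_large w fh gh n (3 * \<delta>) s} \<subseteq> Q \<union> B1 \<union> B2 \<union> B3 \<union> B4"
    by blast
  then have "measure (sample n) {s\<in>space (sample n). remainder_large w fh gh n (3 * \<delta>) s}
      \<le> measure (sample n) (Q \<union> B1 \<union> B2 \<union> B3 \<union> B4)"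
    using sets by (intro smp.finite_measure_mono) auto
  also have "\<dots> \<le> measure (sample n) Q + measure (sample n) B1 + measure (sample n) B2
      + measure (sample n) B3 + measure (sample n) B4"
    using sets by (intro order_trans[OF measure_Un_le] add_right_mono) auto
  also have "\<dots> \<le> measure (sample n) Q + 2 * measure (sample n) {s\<in>space (sample n). Bf P fh n s > ennreal \<kappa>}
     + 2 * measure (sample n) {s\<in>space (sample n). Bg P gh n s > ennreal \<kappa>} + 4 * (C\<^sup>2 * \<kappa> / \<delta>\<^sup>2)"
  proof -
    have le: "q + b1 + b2 + b3 + b4 \<le> q + 2 * f + 2 * g + 4 * e"
      if "b1 \<le> f + e" "b2 \<le> g + e" "b3 \<le> f + e" "b4 \<le> g + e" for q b1 b2 b3 b4 f g e :: real
      using that by linarith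
    show ?thesis
      using F.prob_wterm_sum_gt[OF n less_imp_le[OF \<kappa>] \<delta>]
        G.prob_wterm_sum_gt[OF n less_imp_le[OF \<kappa>] \<delta>]
        F.prob_wterm_squares_gt[OF n less_imp_le[OF \<kappa>] zero_less_power[OF \<delta>, of 2]]
        G.prob_wterm_squares_gt[OF n less_imp_le[OF \<kappa>] zero_less_power[OF \<delta>, of 2]]
      unfolding B1_def[symmetric] B2_def[symmetric] B3_def[symmetric] B4_def[symmetric] B by (rule le)
  qed
  finally show ?thesis unfolding Q_def .
qed

end

text \<open>\<open>AS\<close> fixes the sigma-algebra shared by all auxiliary laws, so that joint
  measurability of an estimator can be stated independently of the law.\<close>

locale gcm_aux = gcm_dist P for P :: "'z::euclidean_space obs measure" +
  fixes A AS :: "'a measure" and fh gh :: "'a \<Rightarrow> 'z \<Rightarrow> real"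
    and w :: "'z \<Rightarrow> real" and C :: real and n :: nat
  assumes prob_A: "prob_space A" and sets_A: "sets A = sets AS"
    and fh: "(\<lambda>(a, z). fh a z) \<in> borel_measurable (AS \<Otimes>\<^sub>M borel)"
    and gh: "(\<lambda>(a, z). gh a z) \<in> borel_measurable (AS \<Otimes>\<^sub>M borel)"
    and w [measurable]: "w \<in> borel_measurable borel" and w_bdd: "\<And>z. \<bar>w z\<bar> \<le> C"
    and int_x: "integrable P xc" and int_y: "integrable P yc"
begin

sublocale pair_prob_space A "sample n"
  using prob_A prob_space_sample[of n]
  by (simp add: pair_prob_space_def pair_sigma_finite_def prob_space_imp_sigma_finite)

lemma fh_section: "a \<in> space A \<Longrightarrow> fh a \<in> borel_measurable borel"
  and gh_section: "a \<in> space A \<Longrightarrow> gh a \<in> borel_measurable borel"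
  using measurable_Pair2[OF fh, of a] measurable_Pair2[OF gh, of a] sets_eq_imp_space_eq[OF sets_A]
  by simp_all

lemma measurable_obs:
  assumes i: "i < n" and h: "h \<in> borel_measurable borel"
  shows "(\<lambda>\<omega>. h (snd \<omega> i)) \<in> borel_measurable (A \<Otimes>\<^sub>M sample n)"
  by (rule measurable_compose[OF measurable_snd component_measurable[OF i h]])

lemma measurable_est:
  assumes i: "i < n" and f: "(\<lambda>(a, z). f a z) \<in> borel_measurable (AS \<Otimes>\<^sub>M borel)"
  shows "(\<lambda>\<omega>. f (fst \<omega>) (zc (snd \<omega> i))) \<in> borel_measurable (A \<Otimes>\<^sub>M sample n)"
proof -
  have "(\<lambda>\<omega>. (fst \<omega>, zc (snd \<omega> i))) \<in> measurable (A \<Otimes>\<^sub>M sample n) (AS \<Otimes>\<^sub>M borel)"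
    using measurable_obs[OF i zc_measurable] sets_A
    by (intro measurable_Pair) (auto simp: measurable_cong_sets[OF refl sets_A[symmetric]])
  from measurable_compose[OF this f] show ?thesis by simp
qed

lemma statistics_measurable [measurable]:
  "(\<lambda>\<omega>. Af P (fh (fst \<omega>)) n (snd \<omega>)) \<in> borel_measurable (A \<Otimes>\<^sub>M sample n)"
  "(\<lambda>\<omega>. Ag P (gh (fst \<omega>)) n (snd \<omega>)) \<in> borel_measurable (A \<Otimes>\<^sub>M sample n)"
  "(\<lambda>\<omega>. Bf P (fh (fst \<omega>)) n (snd \<omega>)) \<in> borel_measurable (A \<Otimes>\<^sub>M sample n)"
  "(\<lambda>\<omega>. Bg P (gh (fst \<omega>)) n (snd \<omega>)) \<in> borel_measurable (A \<Otimes>\<^sub>M sample n)"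
  "(\<lambda>\<omega>. tauN w (fh (fst \<omega>)) (gh (fst \<omega>)) n (snd \<omega>)) \<in> borel_measurable (A \<Otimes>\<^sub>M sample n)"
  "(\<lambda>\<omega>. tauD w (fh (fst \<omega>)) (gh (fst \<omega>)) n (snd \<omega>)) \<in> borel_measurable (A \<Otimes>\<^sub>M sample n)"
proof -
  note [measurable] = measurable_est[OF _ fh] measurable_est[OF _ gh]
  have [measurable]: "(\<lambda>\<omega>. f (zc (snd \<omega> i))) \<in> borel_measurable (A \<Otimes>\<^sub>M sample n)"
    if "i < n" "f \<in> borel_measurable borel" for i and f :: "'z \<Rightarrow> real"
    by (rule measurable_obs[of i "\<lambda>\<omega>. f (zc \<omega>)"]) (use that in measurable)
  have [measurable]: "(\<lambda>\<omega>. f (zc (snd \<omega> i))) \<in> borel_measurable (A \<Otimes>\<^sub>M sample n)"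
    if "i < n" "f \<in> borel_measurable borel" for i and f :: "'z \<Rightarrow> ennreal"
    by (rule measurable_obs[of i "\<lambda>\<omega>. f (zc \<omega>)"]) (use that in measurable)
  note [measurable] = measurable_obs[OF _ xc_measurable] measurable_obs[OF _ yc_measurable]
  show "(\<lambda>\<omega>. Af P (fh (fst \<omega>)) n (snd \<omega>)) \<in> borel_measurable (A \<Otimes>\<^sub>M sample n)"
    "(\<lambda>\<omega>. Ag P (gh (fst \<omega>)) n (snd \<omega>)) \<in> borel_measurable (A \<Otimes>\<^sub>M sample n)"
    "(\<lambda>\<omega>. Bf P (fh (fst \<omega>)) n (snd \<omega>)) \<in> borel_measurable (A \<Otimes>\<^sub>M sample n)"
    "(\<lambda>\<omega>. Bg P (gh (fst \<omega>)) n (snd \<omega>)) \<in> borel_measurable (A \<Otimes>\<^sub>M sample n)"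
    "(\<lambda>\<omega>. tauN w (fh (fst \<omega>)) (gh (fst \<omega>)) n (snd \<omega>)) \<in> borel_measurable (A \<Otimes>\<^sub>M sample n)"
    "(\<lambda>\<omega>. tauD w (fh (fst \<omega>)) (gh (fst \<omega>)) n (snd \<omega>)) \<in> borel_measurable (A \<Otimes>\<^sub>M sample n)"
    unfolding Af_def Ag_def Bf_def Bg_def tauN_def tauD_def Rres_def by measurable
qed

lemma section_eq:
  "a \<in> space A \<Longrightarrow> Pair a -` {\<omega>\<in>space (A \<Otimes>\<^sub>M sample n). Q (fst \<omega>) (snd \<omega>)} = {s\<in>space (sample n). Q a s}"
  by (auto simp: space_pair_measure)

lemma prob_sample_event:
  assumes "{s\<in>space (sample n). Q s} \<in> sets (sample n)"
  shows "{\<omega>\<in>space (A \<Otimes>\<^sub>M sample n). Q (snd \<omega>)} \<in> sets (A \<Otimes>\<^sub>M sample n)"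
    and "prob {\<omega>\<in>space (A \<Otimes>\<^sub>M sample n). Q (snd \<omega>)} = measure (sample n) {s\<in>space (sample n). Q s}"
proof -
  have "{\<omega>\<in>space (A \<Otimes>\<^sub>M sample n). Q (snd \<omega>)} = space A \<times> {s\<in>space (sample n). Q s}"
    by (auto simp: space_pair_measure)
  with assms show s: "{\<omega>\<in>space (A \<Otimes>\<^sub>M sample n). Q (snd \<omega>)} \<in> sets (A \<Otimes>\<^sub>M sample n)" by simp
  have "prob {\<omega>\<in>space (A \<Otimes>\<^sub>M sample n). Q (snd \<omega>)} = (\<integral>a. measure (sample n) {s\<in>space (sample n). Q s} \<partial>A)"
    unfolding prob_eq_integral_sections(2)[OF s]
    by (intro Bochner_Integration.integral_cong refl arg_cong[where f="measure (sample n)"])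
      (auto simp: space_pair_measure)
  then show "prob {\<omega>\<in>space (A \<Otimes>\<^sub>M sample n). Q (snd \<omega>)} = measure (sample n) {s\<in>space (sample n). Q s}"
    by (simp add: M1.prob_space)
qed

lemma remainder_large_sets:
  "{\<omega>\<in>space (A \<Otimes>\<^sub>M sample n). remainder_large w (fh (fst \<omega>)) (gh (fst \<omega>)) n \<delta> (snd \<omega>)}
     \<in> sets (A \<Otimes>\<^sub>M sample n)"
proof -
  note [measurable] = measurable_obs[OF _ Sprod_measurable[OF w]]
  show ?thesis unfolding remainder_large_def esd_def by measurable
qed

text \<open>The bound for frozen estimates holds at every auxiliary value with the same
  \<open>\<kappa>\<close> and \<open>\<delta>\<close> and is affine in the section probabilities;
  integrating it returns the joint probabilities about which the hypotheses speak.\<close>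

lemma prob_remainder_le:
  assumes n: "n > 0" and \<kappa>: "\<kappa> > 0" and \<delta>: "\<delta> > 0" and \<kappa>\<delta>: "C\<^sup>2 * \<kappa> \<le> \<delta>\<^sup>2"
  shows "prob {\<omega>\<in>space (A \<Otimes>\<^sub>M sample n). remainder_large w (fh (fst \<omega>)) (gh (fst \<omega>)) n (3 * \<delta>) (snd \<omega>)}
    \<le> prob {\<omega>\<in>space (A \<Otimes>\<^sub>M sample n). \<bar>Af P (fh (fst \<omega>)) n (snd \<omega>) * Ag P (gh (fst \<omega>)) n (snd \<omega>) * real n\<bar> > \<kappa>}
     + 2 * prob {\<omega>\<in>space (A \<Otimes>\<^sub>M sample n). Bf P (fh (fst \<omega>)) n (snd \<omega>) > ennreal \<kappa>}
     + 2 * prob {\<omega>\<in>space (A \<Otimes>\<^sub>M sample n). Bg P (gh (fst \<omega>)) n (snd \<omega>) > ennreal \<kappa>}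
     + 4 * (C\<^sup>2 * \<kappa> / \<delta>\<^sup>2)"
    (is "prob ?R \<le> prob ?Q + 2 * prob ?F + 2 * prob ?G + ?d")
proof -
  have sets: "?R \<in> sets (A \<Otimes>\<^sub>M sample n)" "?Q \<in> sets (A \<Otimes>\<^sub>M sample n)"
    "?F \<in> sets (A \<Otimes>\<^sub>M sample n)" "?G \<in> sets (A \<Otimes>\<^sub>M sample n)"
    by (rule remainder_large_sets) measurable
  note int = sets[THEN prob_eq_integral_sections(1)] and eq = sets[THEN prob_eq_integral_sections(2)]
  let ?m = "measure (sample n)"
  have "prob ?R \<le> (\<integral>a. ?m (Pair a -` ?Q) + 2 * ?m (Pair a -` ?F) + 2 * ?m (Pair a -` ?G) + ?d \<partial>A)"
    unfolding eq
  proof (rule integral_mono)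
    fix a assume a: "a \<in> space A"
    show "?m (Pair a -` ?R) \<le> ?m (Pair a -` ?Q) + 2 * ?m (Pair a -` ?F) + 2 * ?m (Pair a -` ?G) + ?d"
      unfolding section_eq[OF a, of "\<lambda>a s. remainder_large w (fh a) (gh a) n (3 * \<delta>) s"]
        section_eq[OF a, of "\<lambda>a s. \<bar>Af P (fh a) n s * Ag P (gh a) n s * real n\<bar> > \<kappa>"]
        section_eq[OF a, of "\<lambda>a s. Bf P (fh a) n s > ennreal \<kappa>"]
        section_eq[OF a, of "\<lambda>a s. Bg P (gh a) n s > ennreal \<kappa>"]
      by (rule prob_remainder_large_le[OF fh_section[OF a] gh_section[OF a] w w_bdd int_x int_y n \<kappa> \<delta> \<kappa>\<delta>])
  qed (use int in auto)
  also have "\<dots> = prob ?Q + 2 * prob ?F + 2 * prob ?G + ?d"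
    unfolding eq using int by (simp add: M1.prob_space)
  finally show ?thesis .
qed

end

section \<open>Triangular arrays with i.i.d. rows\<close>

definition tail_mean :: "'a measure \<Rightarrow> ('a \<Rightarrow> real) \<Rightarrow> real \<Rightarrow> real" where
  "tail_mean M h K = (\<integral>x. (if \<bar>h x\<bar> > K then \<bar>h x\<bar> else 0) \<partial>M)"

locale iid_law = prob_space M for M :: "'a measure"
begin

abbreviation iid :: "nat \<Rightarrow> (nat \<Rightarrow> 'a) measure" where
  "iid n \<equiv> PiM {..<n} (\<lambda>_. M)"

sublocale iid: product_prob_space "\<lambda>_::nat. M" "{..<n}" for n :: nat ..

lemma iid_component_measurable:
  "h \<in> borel_measurable M \<Longrightarrow> i < n \<Longrightarrow> (\<lambda>s. h (s i)) \<in> borel_measurable (iid n)"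
  by simp

lemma integral_iid_component:
  fixes h :: "'a \<Rightarrow> real"
  assumes "i < n" "h \<in> borel_measurable M"
  shows "(\<integral>s. h (s i) \<partial>iid n) = expectation h"
  using assms iid.PiM_component[of i n] integral_distr[of "\<lambda>s. s i" "iid n" M h] by simp

lemma integrable_iid_component:
  fixes h :: "'a \<Rightarrow> real"
  assumes "i < n" "integrable M h"
  shows "integrable (iid n) (\<lambda>s. h (s i))"
  using assms iid.PiM_component[of i n] integrable_distr[of "\<lambda>s. s i" "iid n" M h] by simp

lemma integral_iid_product:
  fixes g :: "'a \<Rightarrow> real"
  assumes ij: "i < n" "j < n" "i \<noteq> j" and g: "integrable M g" "expectation g = 0"
  shows "(\<integral>s. g (s i) * g (s j) \<partial>iid n) = 0"
proof -
  \<comment> \<open>The two factors are padded with constants 1 to a product over all coordinates,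
    so that the integral factorises and a factor is the vanishing mean.\<close>
  let ?f = "\<lambda>k. if k = i \<or> k = j then g else (\<lambda>_. 1)"
  have "(\<Prod>k<n. ?f k (s k)) = g (s i) * g (s j)" for s :: "nat \<Rightarrow> 'a"
  proof -
    have "(\<Prod>k<n. ?f k (s k)) = (\<Prod>k\<in>{i, j}. ?f k (s k))"
      using ij by (intro prod.mono_neutral_right) auto
    then show ?thesis using ij by simp
  qed
  then have "(\<integral>s. g (s i) * g (s j) \<partial>iid n) = (\<integral>s. (\<Prod>k<n. ?f k (s k)) \<partial>iid n)"
    by simp
  also have "\<dots> = (\<Prod>k<n. expectation (?f k))"
    by (rule iid.product_integral_prod) (use g in auto)
  also have "\<dots> = 0"
    using ij g by (auto simp: prod_zero_iff intro!: bexI[of _ i])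
  finally show ?thesis .
qed

lemma prob_iid_sum_gt:
  fixes g :: "'a \<Rightarrow> real"
  assumes g: "g \<in> borel_measurable M" "integrable M (\<lambda>x. (g x)\<^sup>2)" "expectation g = 0"
    and \<delta>: "\<delta> > 0"
  shows "measure (iid n) {s\<in>space (iid n). \<bar>\<Sum>i<n. g (s i)\<bar> > \<delta>}
    \<le> real n * expectation (\<lambda>x. (g x)\<^sup>2) / \<delta>\<^sup>2"
proof (rule prob_space.prob_uncorrelated_sum_gt)
  show "prob_space (iid n)" by (rule iid.prob_space_axioms)
  have "integrable M g" using g(1,2) by (rule square_integrable_imp_integrable)
  then show "(\<integral>s. g (s i) * g (s j) \<partial>iid n) = 0" if "i \<in> {..<n}" "j \<in> {..<n}" "i \<noteq> j" for i j
    using integral_iid_product that g by simp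
qed (use g \<delta> integrable_iid_component[of _ n "\<lambda>x. (g x)\<^sup>2"] in \<open>simp_all add: integral_iid_component[of _ n "\<lambda>x. (g x)\<^sup>2"]\<close>)

lemma prob_iid_mean_gt:
  fixes h :: "'a \<Rightarrow> real"
  assumes h: "h \<in> borel_measurable M" "integrable M (\<lambda>x. (h x)\<^sup>2)" and \<delta>: "\<delta> > 0" and n: "n > 0"
  shows "measure (iid n) {s\<in>space (iid n). \<bar>(\<Sum>i<n. h (s i)) / real n - expectation h\<bar> > \<delta>}
    \<le> expectation (\<lambda>x. (h x)\<^sup>2) / (real n * \<delta>\<^sup>2)"
proof -
  let ?g = "\<lambda>x. h x - expectation h"
  have ih: "integrable M h" using h by (rule square_integrable_imp_integrable)
  have ig: "integrable M (\<lambda>x. (?g x)\<^sup>2)"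
    unfolding power2_diff using h ih by auto
  have eg: "expectation ?g = 0" using ih by (simp add: prob_space)
  have eq: "\<bar>(\<Sum>i<n. h (s i)) / real n - expectation h\<bar> > \<delta> \<longleftrightarrow> \<bar>\<Sum>i<n. ?g (s i)\<bar> > \<delta> * real n" for s
  proof -
    have "(\<Sum>i<n. h (s i)) / real n - expectation h = (\<Sum>i<n. ?g (s i)) / real n"
      using n by (simp add: sum_subtractf diff_divide_distrib)
    then show ?thesis using n by (simp add: pos_less_divide_eq)
  qed
  have "measure (iid n) {s\<in>space (iid n). \<bar>(\<Sum>i<n. h (s i)) / real n - expectation h\<bar> > \<delta>}
      \<le> real n * variance h / (\<delta> * real n)\<^sup>2"
    unfolding eq by (rule prob_iid_sum_gt[OF _ ig eg]) (use h(1) \<delta> n in auto)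
  also have "\<dots> \<le> real n * expectation (\<lambda>x. (h x)\<^sup>2) / (\<delta> * real n)\<^sup>2"
    using variance_eq[OF ih h(2)] by (intro divide_right_mono mult_left_mono) auto
  also have "\<dots> = expectation (\<lambda>x. (h x)\<^sup>2) / (real n * \<delta>\<^sup>2)"
    using n by (simp add: power_mult_distrib power2_eq_square[of "real n"])
  finally show ?thesis .
qed

lemma integrable_tail_mean:
  fixes h :: "'a \<Rightarrow> real"
  assumes [measurable]: "integrable M h"
  shows "integrable M (\<lambda>x. if \<bar>h x\<bar> > K then \<bar>h x\<bar> else 0)"
  by (rule Bochner_Integration.integrable_bound[OF integrable_norm[OF assms]]) auto

lemma expectation_abs_le_tail_mean:
  assumes h: "integrable M h" and K: "K \<ge> 0"
  shows "expectation (\<lambda>x. \<bar>h x\<bar>) \<le> K + tail_mean M h K"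
proof -
  have "expectation (\<lambda>x. \<bar>h x\<bar>) \<le> expectation (\<lambda>x. K + (if \<bar>h x\<bar> > K then \<bar>h x\<bar> else 0))"
    using h K by (intro integral_mono Bochner_Integration.integrable_add integrable_tail_mean) auto
  also have "\<dots> = K + tail_mean M h K"
    using integrable_tail_mean[OF h] by (simp add: tail_mean_def prob_space)
  finally show ?thesis .
qed

text \<open>Khinchin's truncation at level \<open>K\<close>: the bounded part obeys Chebyshev, the
  tail part Markov, and cutting moves the expectation by at most \<open>tail_mean M h K\<close>;
  these are three errors of size \<open>\<delta>\<close>. The law enters the bound only through its
  tail mean, which makes it usable uniformly over laws.\<close>

lemma prob_iid_mean_gt_truncated:
  fixes h :: "'a \<Rightarrow> real"
  assumes h: "integrable M h" and \<delta>: "\<delta> > 0" and n: "n > 0" and K: "K \<ge> 0" and t: "tail_mean M h K \<le> \<delta>"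
  shows "measure (iid n) {s\<in>space (iid n). \<bar>(\<Sum>i<n. h (s i)) / real n - expectation h\<bar> > 3 * \<delta>}
    \<le> K\<^sup>2 / (real n * \<delta>\<^sup>2) + tail_mean M h K / \<delta>"
proof -
  note [measurable] = borel_measurable_integrable[OF h]
  let ?l = "\<lambda>x. if \<bar>h x\<bar> > K then 0 else h x" and ?r = "\<lambda>x. if \<bar>h x\<bar> > K then \<bar>h x\<bar> else 0"
  have lm: "?l \<in> borel_measurable M" and rm: "?r \<in> borel_measurable M" by measurable
  have il: "integrable M ?l"
    by (rule Bochner_Integration.integrable_bound[OF integrable_norm[OF h]]) auto
  have l2: "(?l x)\<^sup>2 \<le> K\<^sup>2" for x using K by (auto simp: power2_le_iff_abs_le)
  have il2: "integrable M (\<lambda>x. (?l x)\<^sup>2)"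
    by (rule integrable_const_bound[where B="K\<^sup>2"]) (use l2 in auto)
  note ir = integrable_tail_mean[OF h, of K]
  let ?B1 = "{s\<in>space (iid n). \<bar>(\<Sum>i<n. ?l (s i)) / real n - expectation ?l\<bar> > \<delta>}"
  let ?B2 = "{s\<in>space (iid n). (\<Sum>i<n. ?r (s i)) \<ge> \<delta> * real n}"
  have sets: "?B1 \<in> sets (iid n)" "?B2 \<in> sets (iid n)"
    using iid_component_measurable[OF lm] iid_component_measurable[OF rm] by measurable
  have "{s\<in>space (iid n). \<bar>(\<Sum>i<n. h (s i)) / real n - expectation h\<bar> > 3 * \<delta>} \<subseteq> ?B1 \<union> ?B2"
  proof safe
    fix s assume s: "\<bar>(\<Sum>i<n. h (s i)) / real n - expectation h\<bar> > 3 * \<delta>"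
      "\<not> \<delta> * real n \<le> (\<Sum>i<n. ?r (s i))"
    have "\<bar>(\<Sum>i<n. h (s i)) / real n - (\<Sum>i<n. ?l (s i)) / real n\<bar> = \<bar>\<Sum>i<n. h (s i) - ?l (s i)\<bar> / real n"
      using n by (simp add: diff_divide_distrib[symmetric] sum_subtractf)
    also have "\<dots> \<le> (\<Sum>i<n. ?r (s i)) / real n"
      by (intro divide_right_mono order_trans[OF sum_abs] sum_mono) auto
    also have "\<dots> < \<delta>" using s(2) n by (simp add: pos_divide_less_eq)
    finally have 1: "\<bar>(\<Sum>i<n. h (s i)) / real n - (\<Sum>i<n. ?l (s i)) / real n\<bar> < \<delta>" .
    have "\<bar>expectation h - expectation ?l\<bar> = \<bar>expectation (\<lambda>x. h x - ?l x)\<bar>"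
      using h il by simp
    also have "\<dots> \<le> expectation (\<lambda>x. \<bar>h x - ?l x\<bar>)" by (rule integral_abs_bound)
    also have "(\<lambda>x. \<bar>h x - ?l x\<bar>) = ?r" by auto
    also have "expectation ?r \<le> \<delta>" using t by (simp add: tail_mean_def)
    finally have 2: "\<bar>expectation h - expectation ?l\<bar> \<le> \<delta>" .
    show "\<bar>(\<Sum>i<n. ?l (s i)) / real n - expectation ?l\<bar> > \<delta>"
      using s(1) 1 2 by linarith
  qed
  then have "measure (iid n) {s\<in>space (iid n). \<bar>(\<Sum>i<n. h (s i)) / real n - expectation h\<bar> > 3 * \<delta>}
      \<le> measure (iid n) (?B1 \<union> ?B2)"
    using sets by (intro iid.finite_measure_mono) auto
  also have "\<dots> \<le> measure (iid n) ?B1 + measure (iid n) ?B2"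
    using sets by (intro measure_Un_le)
  also have "measure (iid n) ?B1 \<le> expectation (\<lambda>x. (?l x)\<^sup>2) / (real n * \<delta>\<^sup>2)"
    by (rule prob_iid_mean_gt[OF lm il2 \<delta> n])
  also have "\<dots> \<le> K\<^sup>2 / (real n * \<delta>\<^sup>2)"
    using integral_mono[OF il2, of "\<lambda>_. K\<^sup>2"] l2 by (intro divide_right_mono) (auto simp: prob_space)
  also have "measure (iid n) ?B2 \<le> (\<integral>s. (\<Sum>i<n. ?r (s i)) \<partial>iid n) / (\<delta> * real n)"
    using n \<delta> integrable_iid_component[OF _ ir]
    by (intro integral_Markov_inequality_measure[where A="{}"]) (auto intro!: AE_I2 sum_nonneg)
  also have "(\<integral>s. (\<Sum>i<n. ?r (s i)) \<partial>iid n) = real n * tail_mean M h K"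
    using integrable_iid_component[OF _ ir] integral_iid_component[OF _ rm]
    by (subst Bochner_Integration.integral_sum) (auto simp: tail_mean_def)
  also have "\<dots> / (\<delta> * real n) = tail_mean M h K / \<delta>" using n by simp
  finally show ?thesis by simp
qed

lemma char_iid_sum:
  assumes [measurable]: "h \<in> borel_measurable M"
  shows "char (distr (iid n) borel (\<lambda>s. \<Sum>i<n. h (s i))) t = char (distr M borel h) t ^ n"
proof -
  have "(\<lambda>s. \<Sum>i<n. h (s i)) \<in> borel_measurable (iid n)"
    by (intro borel_measurable_sum iid_component_measurable) auto
  then have "char (distr (iid n) borel (\<lambda>s. \<Sum>i<n. h (s i))) t = (\<integral>s. (\<Prod>i<n. iexp (t * h (s i))) \<partial>iid n)"
    unfolding char_def
    by (subst integral_distr) (auto simp: sum_distrib_left exp_sum)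
  also have "\<dots> = (\<Prod>i<n. (\<integral>x. iexp (t * h x) \<partial>M))"
    by (rule iid.product_integral_prod) (auto intro!: integrable_const_bound[where B=1])
  also have "\<dots> = char (distr M borel h) t ^ n"
    unfolding char_def by (subst integral_distr) auto
  finally show ?thesis .
qed

end

section \<open>Uniform integrability and the two limit theorems for arrays\<close>

definition unif_integrable :: "(nat \<Rightarrow> 'a measure) \<Rightarrow> (nat \<Rightarrow> 'a \<Rightarrow> real) \<Rightarrow> bool" where
  "unif_integrable M h \<longleftrightarrow> (\<forall>n. integrable (M n) (h n)) \<and> (\<forall>e>0. \<exists>K\<ge>0. \<forall>n. tail_mean (M n) (h n) K \<le> e)"

lemma tendsto_0_realI:
  fixes f :: "nat \<Rightarrow> real"
  assumes "\<And>n. f n \<ge> 0" "\<And>e. e > 0 \<Longrightarrow> \<forall>\<^sub>F n in sequentially. f n \<le> e"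
  shows "f \<longlonglongrightarrow> 0"
proof (rule tendstoI)
  fix e :: real assume "e > 0"
  then have "\<forall>\<^sub>F n in sequentially. f n \<le> e / 2" by (intro assms) simp
  then show "\<forall>\<^sub>F n in sequentially. dist (f n) 0 < e"
    by eventually_elim (use \<open>e > 0\<close> assms(1) in \<open>simp add: dist_real_def\<close>)
qed

lemma tendsto_0_real_eventually_le:
  fixes f :: "nat \<Rightarrow> real"
  assumes "f \<longlonglongrightarrow> 0" "e > 0"
  shows "\<forall>\<^sub>F n in sequentially. f n \<le> e"
  using order_tendstoD(2)[OF assms] by eventually_elim simp

theorem wlln_array:
  assumes M: "\<And>n. prob_space (M n)" and ui: "unif_integrable M h" and \<delta>: "\<delta> > 0"
  shows "(\<lambda>n. measure (PiM {..<n} (\<lambda>_. M n)) {s\<in>space (PiM {..<n} (\<lambda>_. M n)).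
     \<bar>(\<Sum>i<n. h n (s i)) / real n - (\<integral>x. h n x \<partial>M n)\<bar> > \<delta>}) \<longlonglongrightarrow> 0"
proof (rule tendsto_0_realI)
  fix e :: real assume e: "e > 0"
  define d where "d = \<delta> / 3"
  have d: "d > 0" and d3: "3 * d = \<delta>" using \<delta> by (simp_all add: d_def)
  \<comment> \<open>\<open>K\<close> is fixed before \<open>n\<close>: the bound \<open>d\<close> is
    what the truncated inequality asks for, \<open>d * e / 2\<close> makes its Markov part at most
    \<open>e / 2\<close>, and its other part vanishes as \<open>n\<close> grows.\<close>
  obtain K where K: "K \<ge> 0" "\<And>n. tail_mean (M n) (h n) K \<le> min d (d * e / 2)"
    using ui d e unfolding unif_integrable_def by (metis divide_pos_pos mult_pos_pos zero_less_numeral min_less_iff_conj)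
  have "(\<lambda>n. K\<^sup>2 / d\<^sup>2 * inverse (real n)) \<longlonglongrightarrow> K\<^sup>2 / d\<^sup>2 * 0"
    by (intro tendsto_intros LIMSEQ_inverse_real_of_nat[THEN LIMSEQ_imp_Suc])
  then have "\<forall>\<^sub>F n in sequentially. K\<^sup>2 / d\<^sup>2 * inverse (real n) \<le> e / 2"
    using e by (intro tendsto_0_real_eventually_le) auto
  then show "\<forall>\<^sub>F n in sequentially. measure (PiM {..<n} (\<lambda>_. M n)) {s\<in>space (PiM {..<n} (\<lambda>_. M n)).
     \<bar>(\<Sum>i<n. h n (s i)) / real n - (\<integral>x. h n x \<partial>M n)\<bar> > \<delta>} \<le> e"
    using eventually_gt_at_top[of 0]
  proof eventually_elim
    case (elim n)
    interpret iid_law "M n" using M by (simp add: iid_law_def)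
    have "measure (PiM {..<n} (\<lambda>_. M n)) {s\<in>space (PiM {..<n} (\<lambda>_. M n)).
       \<bar>(\<Sum>i<n. h n (s i)) / real n - (\<integral>x. h n x \<partial>M n)\<bar> > 3 * d}
      \<le> K\<^sup>2 / (real n * d\<^sup>2) + tail_mean (M n) (h n) K / d"
      using K(2)[of n] ui elim by (intro prob_iid_mean_gt_truncated d K(1)) (auto simp: unif_integrable_def)
    also have "K\<^sup>2 / (real n * d\<^sup>2) = K\<^sup>2 / d\<^sup>2 * inverse (real n)" by (simp add: field_simps)
    also have "tail_mean (M n) (h n) K / d \<le> e / 2"
      using K(2)[of n] d by (simp add: pos_divide_le_eq mult.commute)
    finally show ?case using elim(1) unfolding d3 by linarith
  qed
qed simp

text \<open>Levy's continuity theorem. The characteristic function of a row is an \<open>n\<close>th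
  power, and powers of numbers in the unit disc differ by at most \<open>n\<close> times the
  difference of the bases, so each factor may only be wrong by less than the order
  \<open>1 / n\<close>. The Taylor remainder is a minimum of a quadratic and a cubic bound: the
  cubic one is used where \<open>(X n x)\<^sup>2 \<le> K\<close> and carries an extra
  \<open>1 / sqrt n\<close>, the quadratic one beyond \<open>K\<close>, where uniform integrability
  acts.\<close>

theorem clt_array:
  assumes M: "\<And>n. prob_space (M n)" and meas: "\<And>n. X n \<in> borel_measurable (M n)"
    and mean: "\<And>n. (\<integral>x. X n x \<partial>M n) = 0" and var: "\<And>n. (\<integral>x. (X n x)\<^sup>2 \<partial>M n) = 1"
    and ui: "unif_integrable M (\<lambda>n x. (X n x)\<^sup>2)"
  shows "weak_conv_m (\<lambda>n. distr (PiM {..<n} (\<lambda>_. M n)) borel (\<lambda>s. (\<Sum>i<n. X n (s i)) / sqrt (real n)))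
     std_normal_distribution"
proof (rule levy_continuity)
  let ?\<mu> = "\<lambda>n. distr (PiM {..<n} (\<lambda>_. M n)) borel (\<lambda>s. (\<Sum>i<n. X n (s i)) / sqrt (real n))"
  have sm: "(\<lambda>s. (\<Sum>i<n. X n (s i)) / sqrt (real n)) \<in> borel_measurable (PiM {..<n} (\<lambda>_. M n))" for n
  proof -
    interpret iid_law "M n" using M by (simp add: iid_law_def)
    show ?thesis
      by (auto intro!: borel_measurable_divide borel_measurable_sum iid_component_measurable[OF meas])
  qed
  show "real_distribution (?\<mu> n)" for n
  proof -
    interpret iid_law "M n" using M by (simp add: iid_law_def)
    show ?thesis by (rule iid.real_distribution_distr) (rule sm)
  qed
  show "real_distribution std_normal_distribution" by (rule real_dist_normal_dist)
  fix t :: real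
  have bound: "cmod (char (?\<mu> n) t - complex_of_real ((1 + (-(t\<^sup>2) / 2) / n) ^ n))
      \<le> t\<^sup>2 / 6 * (\<bar>t\<bar> * sqrt K ^ 3 * inverse (sqrt n)) + t\<^sup>2 * tail_mean (M n) (\<lambda>x. (X n x)\<^sup>2) K"
    if n: "n > 0" "real n \<ge> t\<^sup>2 / 4" and K: "K \<ge> 0" for n K
  proof -
    interpret iid_law "M n" using M by (simp add: iid_law_def)
    note [measurable] = meas[of n]
    define \<tau> where "\<tau> = t / sqrt n"
    have i2: "integrable (M n) (\<lambda>x. (X n x)\<^sup>2)" using ui by (simp add: unif_integrable_def)
    have i1: "integrable (M n) (X n)" by (rule square_integrable_imp_integrable[OF meas i2])
    interpret D: real_distribution "distr (M n) borel (X n)" by (rule real_distribution_distr) simp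
    have "char (?\<mu> n) t = char (distr (PiM {..<n} (\<lambda>_. M n)) borel (\<lambda>s. \<Sum>i<n. X n (s i) / sqrt n)) t"
      by (simp add: sum_divide_distrib)
    also have "\<dots> = char (distr (M n) borel (\<lambda>x. X n x / sqrt n)) t ^ n"
      by (rule char_iid_sum) simp
    also have "char (distr (M n) borel (\<lambda>x. X n x / sqrt n)) t = char (distr (M n) borel (X n)) \<tau>"
      unfolding char_def by (subst (1 2) integral_distr) (auto simp: \<tau>_def)
    finally have char: "char (?\<mu> n) t = char (distr (M n) borel (X n)) \<tau> ^ n" .
    have \<tau>2: "\<tau>\<^sup>2 = t\<^sup>2 / n" using n by (simp add: \<tau>_def power_divide)
    have "cmod (char (distr (M n) borel (X n)) \<tau> - (1 - \<tau>\<^sup>2 * 1 / 2))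
        \<le> (\<tau>\<^sup>2 / 6) * expectation (\<lambda>x. min (6 * (X n x)\<^sup>2) (\<bar>\<tau>\<bar> * \<bar>X n x\<bar> ^ 3))"
      by (rule char_approx3') (use i1 i2 mean var in simp_all)
    also have "expectation (\<lambda>x. min (6 * (X n x)\<^sup>2) (\<bar>\<tau>\<bar> * \<bar>X n x\<bar> ^ 3))
        \<le> expectation (\<lambda>x. \<bar>\<tau>\<bar> * sqrt K ^ 3 + 6 * (if \<bar>(X n x)\<^sup>2\<bar> > K then \<bar>(X n x)\<^sup>2\<bar> else 0))"
    proof (rule integral_mono)
      show "integrable (M n) (\<lambda>x. min (6 * (X n x)\<^sup>2) (\<bar>\<tau>\<bar> * \<bar>X n x\<bar> ^ 3))"
        by (rule Bochner_Integration.integrable_bound[OF integrable_mult_right[OF i2, of 6]]) auto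
      show "integrable (M n) (\<lambda>x. \<bar>\<tau>\<bar> * sqrt K ^ 3 + 6 * (if \<bar>(X n x)\<^sup>2\<bar> > K then \<bar>(X n x)\<^sup>2\<bar> else 0))"
        using integrable_tail_mean[OF i2, of K] by (intro Bochner_Integration.integrable_add integrable_mult_right) auto
      fix x
      show "min (6 * (X n x)\<^sup>2) (\<bar>\<tau>\<bar> * \<bar>X n x\<bar> ^ 3)
        \<le> \<bar>\<tau>\<bar> * sqrt K ^ 3 + 6 * (if \<bar>(X n x)\<^sup>2\<bar> > K then \<bar>(X n x)\<^sup>2\<bar> else 0)"
      proof (cases "(X n x)\<^sup>2 > K")
        case True
        then show ?thesis using K by (simp add: min_le_iff_disj)
      next
        case False
        then have "\<bar>X n x\<bar> \<le> sqrt K" by (intro real_le_rsqrt) simp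
        then have "\<bar>\<tau>\<bar> * \<bar>X n x\<bar> ^ 3 \<le> \<bar>\<tau>\<bar> * sqrt K ^ 3"
          by (intro mult_left_mono power_mono) auto
        with False show ?thesis by simp
      qed
    qed
    also have "\<dots> = \<bar>\<tau>\<bar> * sqrt K ^ 3 + 6 * tail_mean (M n) (\<lambda>x. (X n x)\<^sup>2) K"
      using integrable_tail_mean[OF i2, of K] by (simp add: tail_mean_def prob_space)
    finally have *: "cmod (char (distr (M n) borel (X n)) \<tau> - (1 - \<tau>\<^sup>2 * 1 / 2))
        \<le> \<tau>\<^sup>2 / 6 * (\<bar>\<tau>\<bar> * sqrt K ^ 3 + 6 * tail_mean (M n) (\<lambda>x. (X n x)\<^sup>2) K)"
      by (simp add: mult_left_mono)
    have eq: "1 - complex_of_real (\<tau>\<^sup>2 * 1 / 2) = complex_of_real (1 + (-(t\<^sup>2) / 2) / n)"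
      by (simp add: \<tau>2)
    have "cmod (char (?\<mu> n) t - complex_of_real ((1 + (-(t\<^sup>2) / 2) / n) ^ n))
        \<le> n * cmod (char (distr (M n) borel (X n)) \<tau> - complex_of_real (1 + (-(t\<^sup>2) / 2) / n))"
      unfolding char of_real_power
    proof (rule norm_power_diff)
      show "cmod (char (distr (M n) borel (X n)) \<tau>) \<le> 1" by (rule D.cmod_char_le_1)
      \<comment> \<open>Here \<open>real n \<ge> t\<^sup>2 / 4\<close> enters: it keeps
        \<open>1 - t\<^sup>2 / (2 * n)\<close> from falling below -1.\<close>
      have "\<bar>1 + (-(t\<^sup>2) / 2) / n\<bar> \<le> 1" using n by (auto intro!: abs_leI simp: field_simps)
      then show "cmod (complex_of_real (1 + (-(t\<^sup>2) / 2) / n)) \<le> 1" by (simp only: norm_of_real)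
    qed
    also have "\<dots> \<le> n * (\<tau>\<^sup>2 / 6 * (\<bar>\<tau>\<bar> * sqrt K ^ 3 + 6 * tail_mean (M n) (\<lambda>x. (X n x)\<^sup>2) K))"
      using * unfolding eq[symmetric] by (intro mult_left_mono) auto
    also have "\<dots> = t\<^sup>2 / 6 * (\<bar>\<tau>\<bar> * sqrt K ^ 3) + t\<^sup>2 * tail_mean (M n) (\<lambda>x. (X n x)\<^sup>2) K"
      using n by (simp add: \<tau>2 field_simps)
    also have "\<bar>\<tau>\<bar> * sqrt K ^ 3 = \<bar>t\<bar> * sqrt K ^ 3 * inverse (sqrt n)"
      by (simp add: \<tau>_def abs_divide field_simps)
    finally show ?thesis .
  qed
  have "(\<lambda>n. cmod (char (?\<mu> n) t - complex_of_real ((1 + (-(t\<^sup>2) / 2) / n) ^ n))) \<longlonglongrightarrow> 0"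
  proof (rule tendsto_0_realI)
    fix e :: real assume e: "e > 0"
    \<comment> \<open>The denominator has \<open>1 + t\<^sup>2\<close> in place of
      \<open>t\<^sup>2\<close> to serve \<open>t = 0\<close> as well.\<close>
    then have "e / (2 * (1 + t\<^sup>2)) > 0" by (intro divide_pos_pos mult_pos_pos add_pos_nonneg) auto
    then obtain K where K: "K \<ge> 0" "\<And>n. tail_mean (M n) (\<lambda>x. (X n x)\<^sup>2) K \<le> e / (2 * (1 + t\<^sup>2))"
      using ui unfolding unif_integrable_def by blast
    have t: "t\<^sup>2 * tail_mean (M n) (\<lambda>x. (X n x)\<^sup>2) K \<le> e / 2" for n
    proof -
      have "t\<^sup>2 * tail_mean (M n) (\<lambda>x. (X n x)\<^sup>2) K \<le> t\<^sup>2 * (e / (2 * (1 + t\<^sup>2)))"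
        using K by (intro mult_left_mono) auto
      also have "\<dots> = t\<^sup>2 / (1 + t\<^sup>2) * (e / 2)" by simp
      also have "\<dots> \<le> 1 * (e / 2)"
        using e by (intro mult_right_mono) (auto simp: divide_le_eq add_pos_nonneg)
      finally show ?thesis by simp
    qed
    have "(\<lambda>n. t\<^sup>2 / 6 * (\<bar>t\<bar> * sqrt K ^ 3 * inverse (sqrt (real n)))) \<longlonglongrightarrow> t\<^sup>2 / 6 * (\<bar>t\<bar> * sqrt K ^ 3 * 0)"
      by (intro tendsto_intros tendsto_inverse_0_at_top filterlim_compose[OF sqrt_at_top] filterlim_real_sequentially)
    then have "\<forall>\<^sub>F n in sequentially. t\<^sup>2 / 6 * (\<bar>t\<bar> * sqrt K ^ 3 * inverse (sqrt (real n))) \<le> e / 2"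
      using e by (intro tendsto_0_real_eventually_le) auto
    then show "\<forall>\<^sub>F n in sequentially. cmod (char (?\<mu> n) t - complex_of_real ((1 + (-(t\<^sup>2) / 2) / n) ^ n)) \<le> e"
      using eventually_gt_at_top[of 0] eventually_ge_at_top[of "nat \<lceil>t\<^sup>2 / 4\<rceil>"]
    proof eventually_elim
      case (elim n)
      then have "real n \<ge> t\<^sup>2 / 4" by linarith
      from bound[OF elim(2) this K(1)] t[of n] elim(1) show ?case by linarith
    qed
  qed simp
  moreover have "(\<lambda>n. complex_of_real ((1 + (-(t\<^sup>2) / 2) / n) ^ n)) \<longlonglongrightarrow> complex_of_real (exp (-(t\<^sup>2) / 2))"
    by (rule isCont_tendsto_compose[OF _ tendsto_exp_limit_sequentially]) auto
  ultimately have "(\<lambda>n. char (?\<mu> n) t) \<longlonglongrightarrow> complex_of_real (exp (-(t\<^sup>2) / 2))"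
    using Lim_transform tendsto_norm_zero_iff by blast
  then show "(\<lambda>n. char (?\<mu> n) t) \<longlonglongrightarrow> char std_normal_distribution t"
    by (simp add: char_std_normal_distribution)
qed

section \<open>Uniform convergence to the normal distribution function\<close>

interpretation std_normal: real_distribution std_normal_distribution
  by (rule real_dist_normal_dist)

text \<open>The normal density is at most 1. With Lipschitz constant 1, a grid cell or a shift of
  the argument costs no more than its width.\<close>

lemma Phi_lipschitz:
  assumes "a \<le> b"
  shows "Phi b - Phi a \<le> b - a"
proof (cases "a = b")
  case False
  with assms have ab: "a < b" by simp
  have d: "std_normal_density x \<le> 1" for x
  proof -
    have "sqrt (2 * pi) \<ge> 1" using pi_gt3 by (intro real_le_rsqrt) auto
    then have "1 / sqrt (2 * pi) * exp (- x\<^sup>2 / 2) \<le> 1 * 1" by (intro mult_mono) auto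
    then show ?thesis by (simp add: normal_density_def)
  qed
  have "emeasure std_normal_distribution {a<..b} = (\<integral>\<^sup>+x. ennreal (std_normal_density x) * indicator {a<..b} x \<partial>lborel)"
    by (rule emeasure_density) auto
  also have "\<dots> \<le> (\<integral>\<^sup>+x. indicator {a<..b} x \<partial>lborel)"
    using d by (intro nn_integral_mono) (auto split: split_indicator)
  also have "\<dots> = ennreal (b - a)" using ab by simp
  finally have "measure std_normal_distribution {a<..b} \<le> b - a"
    using ab by (simp add: std_normal.emeasure_eq_measure)
  then show ?thesis using std_normal.cdf_diff_eq[OF ab] by (simp add: Phi_def)
qed simp

lemma Phi_mono: "a \<le> b \<Longrightarrow> Phi a \<le> Phi b"
  unfolding Phi_def by (rule std_normal.cdf_nondecreasing)

lemma Phi_nonneg: "0 \<le> Phi a" and Phi_le_1: "Phi a \<le> 1"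
  unfolding Phi_def by (rule std_normal.cdf_nonneg, rule std_normal.cdf_bounded_prob)

lemma isCont_Phi: "isCont Phi x"
proof -
  have "dist (Phi y) (Phi z) \<le> dist y z" for y z
    using Phi_lipschitz[of y z] Phi_lipschitz[of z y] Phi_mono[of y z] Phi_mono[of z y]
    unfolding dist_real_def by linarith
  then show ?thesis
    unfolding continuous_at_eps_delta by (meson le_less_trans)
qed

text \<open>Polya's theorem: monotone functions only need to be compared on a finite grid.\<close>
lemma weak_conv_std_normal_uniform:
  assumes rd: "\<And>n. real_distribution (\<mu> n)" and wc: "weak_conv_m \<mu> std_normal_distribution" and e: "e > 0"
  shows "\<forall>\<^sub>F n in sequentially. \<forall>t. \<bar>cdf (\<mu> n) t - Phi t\<bar> \<le> e"
proof -
  define d where "d = e / 2"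
  have d: "d > 0" using e by (simp add: d_def)
  have pw: "(\<lambda>n. cdf (\<mu> n) t) \<longlonglongrightarrow> Phi t" for t
    using wc isCont_Phi[of t] unfolding weak_conv_m_def weak_conv_def Phi_def[abs_def] by auto
  obtain a where a: "Phi a < d"
    using order_tendstoD(2)[OF std_normal.cdf_lim_at_bot d] unfolding Phi_def eventually_at_bot_linorder by blast
  obtain b where b: "Phi b > 1 - d"
    using order_tendstoD(1)[OF std_normal.cdf_lim_at_top_prob, of "1 - d"] d
    unfolding Phi_def eventually_at_top_linorder by auto
  \<comment> \<open>Half of \<open>e\<close> pays for the error at grid points, half for the growth
    of \<open>Phi\<close> across one cell of width \<open>d\<close>; to the left of the grid and to
    the right of it the second half pays for a tail of \<open>Phi\<close>.\<close>
  define g where "g k = a + real k * d" for k :: nat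
  have g0: "g 0 = a" by (simp add: g_def)
  obtain N :: nat where "real N > (b - a) / d" using reals_Archimedean2 by blast
  then have N: "g N \<ge> b" using d by (simp add: g_def pos_divide_less_eq)
  have "\<forall>\<^sub>F n in sequentially. \<forall>k\<in>{..N}. \<bar>cdf (\<mu> n) (g k) - Phi (g k)\<bar> \<le> d"
  proof (rule eventually_ball_finite)
    show "\<forall>k\<in>{..N}. \<forall>\<^sub>F n in sequentially. \<bar>cdf (\<mu> n) (g k) - Phi (g k)\<bar> \<le> d"
    proof
      fix k
      show "\<forall>\<^sub>F n in sequentially. \<bar>cdf (\<mu> n) (g k) - Phi (g k)\<bar> \<le> d"
        using tendstoD[OF pw[of "g k"] d] by eventually_elim (simp add: dist_real_def)
    qed
  qed simp
  then show ?thesis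
  proof eventually_elim
    case (elim n)
    interpret \<mu>: real_distribution "\<mu> n" by (rule rd)
    have G: "\<bar>cdf (\<mu> n) (g k) - Phi (g k)\<bar> \<le> d" if "k \<le> N" for k using elim that by simp
    show ?case
    proof
      fix t
      have F01: "0 \<le> cdf (\<mu> n) t" "cdf (\<mu> n) t \<le> 1" by (rule \<mu>.cdf_nonneg, rule \<mu>.cdf_bounded_prob)
      consider "t \<le> g 0" | "t \<ge> g N" | "g 0 < t" "t \<le> g N" by linarith
      then show "\<bar>cdf (\<mu> n) t - Phi t\<bar> \<le> e"
      proof cases
        case 1
        have "cdf (\<mu> n) t \<le> cdf (\<mu> n) (g 0)" "Phi t \<le> Phi (g 0)"
          by (rule \<mu>.cdf_nondecreasing[OF 1], rule Phi_mono[OF 1])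
        then show ?thesis
          using G[OF le0] a F01 Phi_nonneg[of t] unfolding g0 d_def by linarith
      next
        case 2
        have "cdf (\<mu> n) t \<ge> cdf (\<mu> n) (g N)" "Phi t \<ge> Phi (g N)" "Phi (g N) \<ge> Phi b"
          by (rule \<mu>.cdf_nondecreasing[OF 2], rule Phi_mono[OF 2], rule Phi_mono[OF N])
        then show ?thesis
          using G[OF order_refl] b F01 Phi_le_1[of t] unfolding d_def by linarith
      next
        case 3
        have "\<exists>k<N. g k \<le> t \<and> t \<le> g (Suc k)"
        proof (rule ccontr)
          assume no: "\<not> (\<exists>k<N. g k \<le> t \<and> t \<le> g (Suc k))"
          \<comment> \<open>If no cell contained \<open>t\<close>, induction would carry the
            inequality \<open>g k < t\<close> up to the last grid point, against
            \<open>t \<le> g N\<close>.\<close>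
          have "k \<le> N \<Longrightarrow> g k \<le> t \<and> (k < N \<longrightarrow> g (Suc k) < t)" for k
            by (induction k) (use no 3(1) in \<open>force simp: not_le\<close>)+
          from this[of "N - 1"] 3 no show False
            by (cases N) (auto simp: g_def)
        qed
        then obtain k where k: "k < N" "g k \<le> t" "t \<le> g (Suc k)" by blast
        have "cdf (\<mu> n) (g k) \<le> cdf (\<mu> n) t" "cdf (\<mu> n) t \<le> cdf (\<mu> n) (g (Suc k))"
          "Phi (g k) \<le> Phi t" "Phi t \<le> Phi (g (Suc k))"
          using k by (auto intro: \<mu>.cdf_nondecreasing Phi_mono)
        moreover have "Phi (g (Suc k)) - Phi (g k) \<le> d"
          using Phi_lipschitz[of "g k" "g (Suc k)"] d by (simp add: g_def algebra_simps)
        moreover have "k \<le> N" "Suc k \<le> N" using k(1) by auto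
        ultimately show ?thesis using G[of k] G[of "Suc k"] unfolding d_def by linarith
      qed
    qed
  qed
qed

text \<open>Off a rare event the two variables differ by at most \<open>d\<close>, so the event for
  \<open>T\<close> at \<open>t\<close> is squeezed between those for \<open>X\<close> at
  \<open>t - d\<close> and \<open>t + d\<close>. A third of \<open>e\<close> each goes to the
  convergence of \<open>X\<close>, to the rare event and to the shift, which
  \<open>Phi_lipschitz\<close> pays uniformly in \<open>t\<close>.\<close>

lemma slutsky_uniform:
  fixes X T :: "nat \<Rightarrow> 'a \<Rightarrow> real"
  assumes \<Omega>: "\<And>n. prob_space (\<Omega> n)" and X: "\<And>n. X n \<in> borel_measurable (\<Omega> n)"
    and T: "\<forall>\<^sub>F n in sequentially. T n \<in> borel_measurable (\<Omega> n)"
    and conv: "\<And>e. e > 0 \<Longrightarrow> \<forall>\<^sub>F n in sequentially. \<forall>t.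
      \<bar>measure (\<Omega> n) {\<omega>\<in>space (\<Omega> n). X n \<omega> \<le> t} - Phi t\<bar> \<le> e"
    and close: "\<And>\<kappa> e. \<kappa> > 0 \<Longrightarrow> e > 0 \<Longrightarrow> \<forall>\<^sub>F n in sequentially.
      measure (\<Omega> n) {\<omega>\<in>space (\<Omega> n). \<bar>T n \<omega> - X n \<omega>\<bar> > \<kappa>} \<le> e"
    and e: "e > 0"
  shows "\<forall>\<^sub>F n in sequentially. \<forall>t. \<bar>measure (\<Omega> n) {\<omega>\<in>space (\<Omega> n). T n \<omega> \<le> t} - Phi t\<bar> \<le> e"
proof -
  define d where "d = e / 3"
  have d: "d > 0" using e by (simp add: d_def)
  show ?thesis
    using T conv[OF d] close[OF d d]
  proof eventually_elim
    case (elim n)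
    interpret prob_space "\<Omega> n" by (rule \<Omega>)
    note [measurable] = X[of n] elim(1)
    let ?B = "{\<omega>\<in>space (\<Omega> n). \<bar>T n \<omega> - X n \<omega>\<bar> > d}"
    show ?case
    proof
      fix t
      have "prob {\<omega>\<in>space (\<Omega> n). T n \<omega> \<le> t} \<le> prob ({\<omega>\<in>space (\<Omega> n). X n \<omega> \<le> t + d} \<union> ?B)"
        by (intro finite_measure_mono) auto
      also have "\<dots> \<le> prob {\<omega>\<in>space (\<Omega> n). X n \<omega> \<le> t + d} + prob ?B"
        by (rule measure_Un_le) measurable
      finally have 1: "prob {\<omega>\<in>space (\<Omega> n). T n \<omega> \<le> t} \<le> prob {\<omega>\<in>space (\<Omega> n). X n \<omega> \<le> t + d} + prob ?B" .
      have "prob {\<omega>\<in>space (\<Omega> n). X n \<omega> \<le> t - d} \<le> prob ({\<omega>\<in>space (\<Omega> n). T n \<omega> \<le> t} \<union> ?B)"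
        by (intro finite_measure_mono) auto
      also have "\<dots> \<le> prob {\<omega>\<in>space (\<Omega> n). T n \<omega> \<le> t} + prob ?B"
        by (rule measure_Un_le) measurable
      finally have 2: "prob {\<omega>\<in>space (\<Omega> n). X n \<omega> \<le> t - d} \<le> prob {\<omega>\<in>space (\<Omega> n). T n \<omega> \<le> t} + prob ?B" .
      have 3: "\<bar>prob {\<omega>\<in>space (\<Omega> n). X n \<omega> \<le> t + d} - Phi (t + d)\<bar> \<le> d"
        "\<bar>prob {\<omega>\<in>space (\<Omega> n). X n \<omega> \<le> t - d} - Phi (t - d)\<bar> \<le> d"
        using elim(2) by auto
      have 4: "Phi (t + d) - Phi t \<le> d" "Phi t - Phi (t - d) \<le> d"
        using Phi_lipschitz[of t "t + d"] Phi_lipschitz[of "t - d" t] d by auto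
      show "\<bar>prob {\<omega>\<in>space (\<Omega> n). T n \<omega> \<le> t} - Phi t\<bar> \<le> e"
        using 1 2 3 4 elim(3) d_def by linarith
    qed
  qed
qed

section \<open>Transferring uniform integrability\<close>

lemma second_moment_bound:
  assumes M: "\<And>n. prob_space (M n)" and ui: "unif_integrable M (\<lambda>n x. (S n x)\<^sup>2)"
  obtains L where "L > 0" "\<And>n. (\<integral>x. (S n x)\<^sup>2 \<partial>M n) \<le> L"
proof -
  obtain K where K: "K \<ge> 0" "\<And>n. tail_mean (M n) (\<lambda>x. (S n x)\<^sup>2) K \<le> 1"
    using ui unfolding unif_integrable_def by (metis zero_less_one)
  show ?thesis
  proof (rule that[of "K + 1"])
    fix n
    interpret iid_law "M n" using M by (simp add: iid_law_def)
    have "integrable (M n) (\<lambda>x. (S n x)\<^sup>2)" using ui by (simp add: unif_integrable_def)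
    from expectation_abs_le_tail_mean[OF this K(1)] K(2)[of n]
    show "(\<integral>x. (S n x)\<^sup>2 \<partial>M n) \<le> K + 1" by simp
  qed (use K in simp)
qed

lemma mean_square_le:
  fixes f :: "'a \<Rightarrow> real"
  assumes "prob_space N" "f \<in> borel_measurable N" "integrable N (\<lambda>x. (f x)\<^sup>2)"
  shows "(\<integral>x. f x \<partial>N)\<^sup>2 \<le> (\<integral>x. (f x)\<^sup>2 \<partial>N)"
proof -
  interpret prob_space N by fact
  have "integrable N f" using assms(2,3) by (rule square_integrable_imp_integrable)
  from variance_eq[OF this assms(3)] variance_positive[of f] show ?thesis by simp
qed

lemma unif_integrable_of_square:
  assumes M: "\<And>n. prob_space (M n)" and S: "\<And>n. S n \<in> borel_measurable (M n)"
    and ui: "unif_integrable M (\<lambda>n x. (S n x)\<^sup>2)"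
  shows "unif_integrable M S"
  unfolding unif_integrable_def
proof (intro conjI allI impI)
  fix n
  interpret prob_space "M n" by (rule M)
  show "integrable (M n) (S n)"
    using ui by (intro square_integrable_imp_integrable[OF S]) (simp add: unif_integrable_def)
next
  fix e :: real assume "e > 0"
  then obtain K where K: "K \<ge> 0" "\<And>n. tail_mean (M n) (\<lambda>x. (S n x)\<^sup>2) K \<le> e"
    using ui unfolding unif_integrable_def by blast
  show "\<exists>K\<ge>0. \<forall>n. tail_mean (M n) (S n) K \<le> e"
  \<comment> \<open>The level must be at least 1 so that
    \<open>\<bar>S n x\<bar> \<le> (S n x)\<^sup>2\<close> beyond it.\<close>
  proof (intro exI[of _ "max 1 K"] conjI allI)
    fix n
    interpret iid_law "M n" using M by (simp add: iid_law_def)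
    have i: "integrable (M n) (\<lambda>x. (S n x)\<^sup>2)" using ui by (simp add: unif_integrable_def)
    have "integrable (M n) (S n)" using S i by (rule square_integrable_imp_integrable)
    then have "tail_mean (M n) (S n) (max 1 K) \<le> tail_mean (M n) (\<lambda>x. (S n x)\<^sup>2) K"
      unfolding tail_mean_def
    proof (intro integral_mono integrable_tail_mean i)
      fix x
      show "(if \<bar>S n x\<bar> > max 1 K then \<bar>S n x\<bar> else 0) \<le> (if \<bar>(S n x)\<^sup>2\<bar> > K then \<bar>(S n x)\<^sup>2\<bar> else 0)"
      proof (cases "\<bar>S n x\<bar> > max 1 K")
        case True
        then have "\<bar>S n x\<bar> * 1 \<le> \<bar>S n x\<bar> * \<bar>S n x\<bar>" by (intro mult_left_mono) auto
        then have "\<bar>S n x\<bar> \<le> (S n x)\<^sup>2" by (simp add: power2_eq_square)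
        with True show ?thesis by simp
      qed auto
    qed
    with K(2)[of n] show "tail_mean (M n) (S n) (max 1 K) \<le> e" by linarith
  qed simp
qed

text \<open>A standardised square is at most \<open>2 * ((S n x)\<^sup>2 + L) / c\<close>, where
  \<open>L\<close> bounds the second moments and hence the squared means, and \<open>c\<close>
  bounds the variances from below. A fixed multiple of a uniformly integrable sequence plus a
  constant is uniformly integrable.\<close>

lemma unif_integrable_standardized:
  assumes M: "\<And>n. prob_space (M n)" and S: "\<And>n. S n \<in> borel_measurable (M n)"
    and ui: "unif_integrable M (\<lambda>n x. (S n x)\<^sup>2)"
    and c: "c > 0" "\<And>n. v n \<ge> c"
  shows "unif_integrable M (\<lambda>n x. ((S n x - (\<integral>x. S n x \<partial>M n)) / sqrt (v n))\<^sup>2)"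
proof -
  define \<rho> where "\<rho> n = (\<integral>x. S n x \<partial>M n)" for n
  obtain L where L: "L > 0" "\<And>n. (\<integral>x. (S n x)\<^sup>2 \<partial>M n) \<le> L"
    using second_moment_bound[OF M ui] by blast
  have i2: "integrable (M n) (\<lambda>x. (S n x)\<^sup>2)" for n using ui by (simp add: unif_integrable_def)
  have i1: "integrable (M n) (S n)" for n
    using unif_integrable_of_square[OF M S ui] by (simp add: unif_integrable_def)
  have \<rho>: "(\<rho> n)\<^sup>2 \<le> L" for n
    using mean_square_le[OF M S i2, of n] L(2)[of n] by (simp add: \<rho>_def)
  have sq: "((S n x - \<rho> n) / sqrt (v n))\<^sup>2 \<le> 2 * ((S n x)\<^sup>2 + L) / c" for n x
  proof -
    have v: "v n > 0" using c(1) c(2)[of n] by linarith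
    have "(S n x - \<rho> n)\<^sup>2 \<le> 2 * ((S n x)\<^sup>2 + (\<rho> n)\<^sup>2)"
      using zero_le_power2[of "S n x + \<rho> n"] by (simp add: power2_sum power2_diff)
    also have "\<dots> \<le> 2 * ((S n x)\<^sup>2 + L)" using \<rho>[of n] by simp
    finally have "(S n x - \<rho> n)\<^sup>2 / v n \<le> 2 * ((S n x)\<^sup>2 + L) / c"
      using c(1) c(2)[of n] L by (intro frac_le) auto
    then show ?thesis using v by (simp add: power_divide)
  qed
  have int: "integrable (M n) (\<lambda>x. ((S n x - \<rho> n) / sqrt (v n))\<^sup>2)" for n
  proof -
    interpret prob_space "M n" by (rule M)
    show ?thesis using i1[of n] i2[of n]
      unfolding power_divide power2_diff by (intro integrable_divide Bochner_Integration.integrable_diff Bochner_Integration.integrable_add) auto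
  qed
  show ?thesis
    unfolding unif_integrable_def \<rho>_def[symmetric]
  proof (intro conjI allI impI int)
    fix e :: real assume "e > 0"
    then have "e * c / 4 > 0" using c by simp
    then obtain k where k: "k \<ge> 0" "\<And>n. tail_mean (M n) (\<lambda>x. (S n x)\<^sup>2) k \<le> e * c / 4"
      using ui unfolding unif_integrable_def by blast
    \<comment> \<open>Beyond the level \<open>2 * (K + L) / c\<close> one has
      \<open>(S n x)\<^sup>2 > K\<close>: exceeding \<open>L\<close> gives the bound
      \<open>4 / c * (S n x)\<^sup>2\<close>, whence the choice of \<open>e * c / 4\<close>, and
      exceeding \<open>k\<close> puts the point into the controlled tail.\<close>
    define K where "K = max k L"
    show "\<exists>K\<ge>0. \<forall>n. tail_mean (M n) (\<lambda>x. ((S n x - \<rho> n) / sqrt (v n))\<^sup>2) K \<le> e"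
    proof (intro exI[of _ "2 * (K + L) / c"] conjI allI)
      show "2 * (K + L) / c \<ge> 0" using c L k by (simp add: K_def)
      fix n
      interpret iid_law "M n" using M by (simp add: iid_law_def)
      let ?Y = "\<lambda>x. ((S n x - \<rho> n) / sqrt (v n))\<^sup>2"
      have "tail_mean (M n) ?Y (2 * (K + L) / c)
          \<le> expectation (\<lambda>x. 4 / c * (if \<bar>(S n x)\<^sup>2\<bar> > k then \<bar>(S n x)\<^sup>2\<bar> else 0))"
        unfolding tail_mean_def
      proof (intro integral_mono integrable_tail_mean int integrable_mult_right i2)
        fix x
        show "(if \<bar>?Y x\<bar> > 2 * (K + L) / c then \<bar>?Y x\<bar> else 0)
          \<le> 4 / c * (if \<bar>(S n x)\<^sup>2\<bar> > k then \<bar>(S n x)\<^sup>2\<bar> else 0)"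
        proof (cases "\<bar>?Y x\<bar> > 2 * (K + L) / c")
          case True
          then have "2 * (K + L) / c < 2 * ((S n x)\<^sup>2 + L) / c"
            using sq[of n x] by (simp only: abs_power2)
          then have "(S n x)\<^sup>2 > K" using c by (simp add: divide_less_cancel)
          then have *: "(S n x)\<^sup>2 > k" "(S n x)\<^sup>2 > L" by (auto simp: K_def)
          have "?Y x \<le> 2 * ((S n x)\<^sup>2 + L) / c" by (rule sq)
          also have "\<dots> \<le> 2 * ((S n x)\<^sup>2 + (S n x)\<^sup>2) / c"
            using * c by (intro divide_right_mono) auto
          finally have "?Y x \<le> 4 / c * (S n x)\<^sup>2" by simp
          with True * show ?thesis by simp
        next
          case False
          then show ?thesis using c by simp
        qed
      qed
      also have "\<dots> = 4 / c * tail_mean (M n) (\<lambda>x. (S n x)\<^sup>2) k" by (simp add: tail_mean_def)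
      also have "\<dots> \<le> 4 / c * (e * c / 4)" using k(2)[of n] c by (intro mult_left_mono) auto
      also have "\<dots> = e" using c by simp
      finally show "tail_mean (M n) ?Y (2 * (K + L) / c) \<le> e" .
    qed
  qed
qed

section \<open>Convergence along a sequence of distributions\<close>

text \<open>The law of large numbers for \<open>S\<close> and for its square gives convergence of
  the empirical variance. Passing to roots divides by the sum of the two roots, which is at least
  \<open>sqrt c\<close>; the lower bound on the variances makes this step uniform.\<close>

lemma esd_conv_array:
  assumes M: "\<And>n. prob_space (M n)" and S: "\<And>n. S n \<in> borel_measurable (M n)"
    and ui: "unif_integrable M (\<lambda>n x. (S n x)\<^sup>2)"
    and v: "\<And>n. v n = (\<integral>x. (S n x - (\<integral>x. S n x \<partial>M n))\<^sup>2 \<partial>M n)"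
    and c: "c > 0" "\<And>n. v n \<ge> c" and \<delta>: "\<delta> > 0" and e: "e > 0"
  shows "\<forall>\<^sub>F n in sequentially. measure (PiM {..<n} (\<lambda>_. M n)) {s\<in>space (PiM {..<n} (\<lambda>_. M n)).
     \<bar>esd n (\<lambda>i. S n (s i)) - sqrt (v n)\<bar> > \<delta>} \<le> e"
proof -
  obtain L where L: "L > 0" "\<And>n. (\<integral>x. (S n x)\<^sup>2 \<partial>M n) \<le> L"
    using second_moment_bound[OF M ui] by blast
  define l where "l = sqrt L"
  have l: "l > 0" using L by (simp add: l_def)
  \<comment> \<open>The cap 1 bounds the sample mean, so its square misses the squared mean by at
    most \<open>\<eta> * (1 + 2 * l)\<close>. Adding \<open>\<eta>\<close> for the second moment,
    the variance is off by at most \<open>\<eta> * (2 + 2 * l)\<close>, which the other entry keeps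
    below \<open>\<delta> * sqrt c\<close>.\<close>
  define \<eta> where "\<eta> = min 1 (\<delta> * sqrt c / (2 + 2 * l))"
  have \<eta>: "\<eta> > 0" using \<delta> c l by (simp add: \<eta>_def)
  have "\<eta> * (2 + 2 * l) \<le> \<delta> * sqrt c / (2 + 2 * l) * (2 + 2 * l)"
    using l by (intro mult_right_mono) (auto simp: \<eta>_def)
  then have \<eta>2: "\<eta> * (2 + 2 * l) \<le> \<delta> * sqrt c" using l by simp
  have e2: "e / 2 > 0" using e by simp
  note ui1 = unif_integrable_of_square[OF M S ui]
  show ?thesis
    using tendsto_0_real_eventually_le[OF wlln_array[OF M ui \<eta>] e2]
      tendsto_0_real_eventually_le[OF wlln_array[OF M ui1 \<eta>] e2] eventually_gt_at_top[of 0]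
  proof eventually_elim
    case (elim n)
    interpret iid_law "M n" using M by (simp add: iid_law_def)
    have i2: "integrable (M n) (\<lambda>x. (S n x)\<^sup>2)" using ui by (simp add: unif_integrable_def)
    have i1: "integrable (M n) (S n)" using ui1 by (simp add: unif_integrable_def)
    let ?x = "\<lambda>s. (\<Sum>i<n. S n (s i)) / real n" and ?y = "\<lambda>s. (\<Sum>i<n. (S n (s i))\<^sup>2) / real n"
    let ?\<rho> = "\<integral>x. S n x \<partial>M n" and ?q = "\<integral>x. (S n x)\<^sup>2 \<partial>M n"
    have vn: "v n = ?q - ?\<rho>\<^sup>2" unfolding v by (rule variance_eq[OF i1 i2])
    have "?\<rho>\<^sup>2 \<le> L" using mean_square_le[OF M S i2] L(2)[of n] by linarith
    then have \<rho>: "\<bar>?\<rho>\<bar> \<le> l" unfolding l_def by (intro real_le_rsqrt) simp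
    let ?B1 = "{s\<in>space (iid n). \<bar>?y s - ?q\<bar> > \<eta>}" and ?B2 = "{s\<in>space (iid n). \<bar>?x s - ?\<rho>\<bar> > \<eta>}"
    note [measurable] = iid_component_measurable[OF S[of n]]
    have sets: "?B1 \<in> sets (iid n)" "?B2 \<in> sets (iid n)" by measurable
    have "\<bar>esd n (\<lambda>i. S n (s i)) - sqrt (v n)\<bar> \<le> \<delta>"
      if s: "\<bar>?y s - ?q\<bar> \<le> \<eta>" "\<bar>?x s - ?\<rho>\<bar> \<le> \<eta>" for s
    proof -
      let ?E = "esd n (\<lambda>i. S n (s i))"
      have "\<bar>(?x s)\<^sup>2 - ?\<rho>\<^sup>2\<bar> = \<bar>?x s - ?\<rho>\<bar> * \<bar>(?x s - ?\<rho>) + 2 * ?\<rho>\<bar>"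
        by (simp add: power2_eq_square abs_mult[symmetric] algebra_simps)
      also have "\<dots> \<le> \<eta> * (1 + 2 * l)"
        using s(2) \<rho> \<eta> \<eta>_def by (intro mult_mono) (auto simp: abs_le_iff)
      finally have "\<bar>?E\<^sup>2 - v n\<bar> \<le> \<eta> * (2 + 2 * l)"
        using s(1) esd_square[OF elim(3), of "\<lambda>i. S n (s i)"] vn by (simp add: algebra_simps abs_le_iff)
      moreover have "?E\<^sup>2 - v n = (?E - sqrt (v n)) * (?E + sqrt (v n))"
        using c(1) c(2)[of n] by (simp add: power2_eq_square algebra_simps)
      ultimately have "\<bar>?E - sqrt (v n)\<bar> * \<bar>?E + sqrt (v n)\<bar> \<le> \<delta> * sqrt c"
        using \<eta>2 by (simp add: abs_mult)
      moreover have "sqrt c \<le> \<bar>?E + sqrt (v n)\<bar>"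
        using c(2)[of n] esd_nonneg[OF elim(3), of "\<lambda>i. S n (s i)"] real_sqrt_le_mono[OF c(2)[of n]] by linarith
      then have "\<bar>?E - sqrt (v n)\<bar> * sqrt c \<le> \<bar>?E - sqrt (v n)\<bar> * \<bar>?E + sqrt (v n)\<bar>"
        by (intro mult_left_mono) auto
      ultimately have "\<bar>?E - sqrt (v n)\<bar> * sqrt c \<le> \<delta> * sqrt c" by linarith
      then show ?thesis using c(1) by simp
    qed
    then have "{s\<in>space (iid n). \<bar>esd n (\<lambda>i. S n (s i)) - sqrt (v n)\<bar> > \<delta>} \<subseteq> ?B1 \<union> ?B2"
      by (auto simp: not_less[symmetric])
    then have "measure (iid n) {s\<in>space (iid n). \<bar>esd n (\<lambda>i. S n (s i)) - sqrt (v n)\<bar> > \<delta>}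
        \<le> measure (iid n) (?B1 \<union> ?B2)"
      using sets by (intro iid.finite_measure_mono) auto
    also have "\<dots> \<le> measure (iid n) ?B1 + measure (iid n) ?B2" using sets by (intro measure_Un_le)
    also have "\<dots> \<le> e" using elim by simp
    finally show ?case .
  qed
qed

text \<open>With x for \<open>(N - r) / \<sigma>\<close>, the deviation equals
  \<open>((\<tau>N - N) + x * (\<sigma> - \<tau>D)) / \<tau>D\<close>. The condition
  \<open>4 * \<delta> \<le> k\<close> keeps \<open>\<tau>D\<close> at or above \<open>k / 2\<close>,
  and the last condition is what the resulting bound requires. The factor x is the reason for a
  bound \<open>A\<close> on the standardised sum.\<close>

lemma studentized_close:
  fixes \<tau>N \<tau>D N d \<sigma> r :: real
  assumes k: "k > 0" "k \<le> \<sigma>" and N: "\<bar>\<tau>N - N\<bar> \<le> \<delta>" and D: "\<bar>\<tau>D - d\<bar> \<le> \<delta>" "\<bar>d - \<sigma>\<bar> \<le> \<delta>"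
    and X: "\<bar>(N - r) / \<sigma>\<bar> \<le> A" and \<delta>: "\<delta> \<ge> 0" "4 * \<delta> \<le> k" "2 * (2 * A + 1) * \<delta> \<le> \<kappa> * k"
  shows "\<bar>\<tau>N / \<tau>D - r / \<tau>D - (N - r) / \<sigma>\<bar> \<le> \<kappa>"
proof -
  define x where "x = (N - r) / \<sigma>"
  have xs: "N - r = \<sigma> * x" using k by (simp add: x_def)
  have tD: "\<tau>D \<ge> k / 2" "\<bar>\<sigma> - \<tau>D\<bar> \<le> 2 * \<delta>" using k D \<delta> by linarith+
  have A: "A \<ge> 0" using X by linarith
  have pos: "\<tau>D > 0" using tD(1) k by linarith
  have "\<tau>N / \<tau>D - r / \<tau>D - x = ((\<tau>N - N) + x * (\<sigma> - \<tau>D)) / \<tau>D"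
    using pos xs by (simp add: field_simps)
  then have "\<bar>\<tau>N / \<tau>D - r / \<tau>D - x\<bar> = \<bar>(\<tau>N - N) + x * (\<sigma> - \<tau>D)\<bar> / \<tau>D"
    using pos by (simp add: abs_divide)
  also have "\<dots> \<le> (\<delta> + A * (2 * \<delta>)) / \<tau>D"
  proof (intro divide_right_mono)
    have "\<bar>x * (\<sigma> - \<tau>D)\<bar> \<le> A * (2 * \<delta>)"
      unfolding abs_mult using X tD(2) A by (intro mult_mono) (auto simp: x_def)
    then show "\<bar>(\<tau>N - N) + x * (\<sigma> - \<tau>D)\<bar> \<le> \<delta> + A * (2 * \<delta>)" using N by linarith
  qed (use pos in simp)
  also have "\<dots> \<le> (\<delta> + A * (2 * \<delta>)) / (k / 2)"
    using tD(1) k A \<delta> by (intro divide_left_mono mult_pos_pos) auto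
  also have "\<dots> = 2 * (2 * A + 1) * \<delta> / k" by (simp add: algebra_simps)
  also have "\<dots> \<le> \<kappa>" using \<delta>(3) k by (simp add: pos_divide_le_eq)
  finally show ?thesis by (simp add: x_def)
qed

text \<open>Laws are looked at only along the diagonal: sample size \<open>n\<close> with
  \<open>P n\<close>. The moment assumptions of both parts enter as \<open>ui\<close>, and
  \<open>c\<close> is a common lower bound for the variances.\<close>

locale gcm_sequence =
  fixes w :: "'z::euclidean_space \<Rightarrow> real" and C :: real
    and AS :: "'a measure" and Aux :: "'z obs measure \<Rightarrow> nat \<Rightarrow> 'a measure"
    and fhat ghat :: "nat \<Rightarrow> 'a \<Rightarrow> 'z \<Rightarrow> real"
    and P :: "nat \<Rightarrow> 'z obs measure" and c :: real
  assumes w_meas: "w \<in> borel_measurable borel" and w_bdd: "\<And>z. \<bar>w z\<bar> \<le> C"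
    and Aux_prob: "\<And>n. prob_space (Aux (P n) n)"
    and Aux_sets: "\<And>n. sets (Aux (P n) n) = sets AS"
    and fhat_meas: "\<And>n. (\<lambda>(a, z). fhat n a z) \<in> borel_measurable (AS \<Otimes>\<^sub>M borel)"
    and ghat_meas: "\<And>n. (\<lambda>(a, z). ghat n a z) \<in> borel_measurable (AS \<Otimes>\<^sub>M borel)"
    and P: "\<And>n. P n \<in> E0"
    and int_x: "\<And>n. integrable (P n) xc" and int_y: "\<And>n. integrable (P n) yc"
    and A_small: "\<And>\<delta> e. \<delta> > 0 \<Longrightarrow> e > 0 \<Longrightarrow> \<forall>\<^sub>F n in sequentially. \<P>(\<omega> in Omega Aux (P n) n.
       \<bar>Af (P n) (fhat n (fst \<omega>)) n (snd \<omega>) * Ag (P n) (ghat n (fst \<omega>)) n (snd \<omega>) * real n\<bar> > \<delta>) \<le> e"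
    and Bf_small: "\<And>\<delta> e. \<delta> > 0 \<Longrightarrow> e > 0 \<Longrightarrow> \<forall>\<^sub>F n in sequentially. \<P>(\<omega> in Omega Aux (P n) n.
       Bf (P n) (fhat n (fst \<omega>)) n (snd \<omega>) > ennreal \<delta>) \<le> e"
    and Bg_small: "\<And>\<delta> e. \<delta> > 0 \<Longrightarrow> e > 0 \<Longrightarrow> \<forall>\<^sub>F n in sequentially. \<P>(\<omega> in Omega Aux (P n) n.
       Bg (P n) (ghat n (fst \<omega>)) n (snd \<omega>) > ennreal \<delta>) \<le> e"
    and c: "c > 0" and sigma2: "\<And>n. sigma2P w (P n) \<ge> c"
    and ui: "unif_integrable P (\<lambda>n \<omega>. (epsP (P n) \<omega> * xiP (P n) \<omega> * w (zc \<omega>))\<^sup>2)"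
begin

abbreviation "fh n \<omega> \<equiv> fhat n (fst \<omega>)"
abbreviation "gh n \<omega> \<equiv> ghat n (fst \<omega>)"
abbreviation "\<Omega> n \<equiv> Omega Aux (P n) n"
abbreviation "smp n \<equiv> PiM {..<n} (\<lambda>_. P n)"

definition S :: "nat \<Rightarrow> 'z obs \<Rightarrow> real" where
  "S n \<omega> = epsP (P n) \<omega> * xiP (P n) \<omega> * w (zc \<omega>)"

definition X :: "nat \<Rightarrow> 'z obs \<Rightarrow> real" where
  "X n \<omega> = (S n \<omega> - rhoP w (P n)) / sqrt (sigma2P w (P n))"

definition Z :: "nat \<Rightarrow> (nat \<Rightarrow> 'z obs) \<Rightarrow> real" where
  "Z n s = (\<Sum>i<n. X n (s i)) / sqrt (real n)"

lemma prob_P: "prob_space (P n)"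
  using E0_D(1)[OF P] .

lemma gcm_aux_P: "gcm_aux (P n) (Aux (P n) n) AS (fhat n) (ghat n) w C"
  unfolding gcm_aux_def gcm_dist_def gcm_dist_axioms_def gcm_aux_axioms_def
  using E0_D[OF P] Aux_prob Aux_sets fhat_meas ghat_meas w_meas w_bdd int_x int_y by auto

lemma gcm_dist_P: "gcm_dist (P n)"
  using gcm_aux_P by (simp add: gcm_aux_def)

lemma Omega_eq: "\<Omega> n = Aux (P n) n \<Otimes>\<^sub>M smp n"
  by (simp add: Omega_def)

lemma prob_Omega: "prob_space (\<Omega> n)"
proof -
  interpret gcm_aux "P n" "Aux (P n) n" AS "fhat n" "ghat n" w C n by (rule gcm_aux_P)
  show ?thesis unfolding Omega_eq by (rule prob_space_axioms)
qed

lemma S_measurable: "S n \<in> borel_measurable (P n)"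
proof -
  interpret gcm_dist "P n" by (rule gcm_dist_P)
  have "S n = Sprod w" by (simp add: S_def Sprod_def fun_eq_iff)
  then show ?thesis using Sprod_measurable[OF w_meas] by (simp add: measurable_cong_sets[OF sets_P refl])
qed

lemma ui_S: "unif_integrable P (\<lambda>n \<omega>. (S n \<omega>)\<^sup>2)"
  using ui by (simp add: S_def)

lemma rho_eq: "rhoP w (P n) = (\<integral>\<omega>. S n \<omega> \<partial>P n)"
  and sigma2_eq: "sigma2P w (P n) = (\<integral>\<omega>. (S n \<omega> - (\<integral>\<omega>. S n \<omega> \<partial>P n))\<^sup>2 \<partial>P n)"
  by (simp_all add: rhoP_def sigma2P_def S_def)

lemma sigma2_pos: "sigma2P w (P n) > 0"
  using c sigma2[of n] by linarith

lemma X_measurable: "X n \<in> borel_measurable (P n)"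
  unfolding X_def[abs_def] using S_measurable by measurable

lemma X_square: "(X n \<omega>)\<^sup>2 = (S n \<omega> - rhoP w (P n))\<^sup>2 / sigma2P w (P n)"
  using sigma2_pos[of n] by (simp add: X_def power_divide)

lemma X_mean: "(\<integral>\<omega>. X n \<omega> \<partial>P n) = 0"
proof -
  interpret prob_space "P n" by (rule prob_P)
  have "integrable (P n) (S n)"
    using unif_integrable_of_square[OF prob_P S_measurable ui_S] by (simp add: unif_integrable_def)
  then show ?thesis by (simp add: X_def rho_eq prob_space)
qed

lemma X_var: "(\<integral>\<omega>. (X n \<omega>)\<^sup>2 \<partial>P n) = 1"
  using sigma2_pos[of n] by (simp add: X_square sigma2_eq rho_eq)

lemma ui_X: "unif_integrable P (\<lambda>n \<omega>. (X n \<omega>)\<^sup>2)"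
  unfolding X_def rho_eq by (rule unif_integrable_standardized[OF prob_P S_measurable ui_S c sigma2])

lemma Z_measurable: "Z n \<in> borel_measurable (smp n)"
proof -
  interpret iid_law "P n" using prob_P by (simp add: iid_law_def)
  show ?thesis unfolding Z_def[abs_def]
    by (auto intro!: borel_measurable_divide borel_measurable_sum iid_component_measurable[OF X_measurable])
qed

lemma Z_Omega_measurable: "(\<lambda>\<omega>. Z n (snd \<omega>)) \<in> borel_measurable (\<Omega> n)"
  unfolding Omega_eq by (rule measurable_compose[OF measurable_snd Z_measurable])

lemma prob_Omega_sample:
  assumes "{s\<in>space (smp n). Q s} \<in> sets (smp n)"
  shows "{\<omega>\<in>space (\<Omega> n). Q (snd \<omega>)} \<in> sets (\<Omega> n)"
    and "measure (\<Omega> n) {\<omega>\<in>space (\<Omega> n). Q (snd \<omega>)} = measure (smp n) {s\<in>space (smp n). Q s}"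
proof -
  interpret gcm_aux "P n" "Aux (P n) n" AS "fhat n" "ghat n" w C n by (rule gcm_aux_P)
  show "{\<omega>\<in>space (\<Omega> n). Q (snd \<omega>)} \<in> sets (\<Omega> n)"
    "measure (\<Omega> n) {\<omega>\<in>space (\<Omega> n). Q (snd \<omega>)} = measure (smp n) {s\<in>space (smp n). Q s}"
    unfolding Omega_eq by (rule prob_sample_event[OF assms])+
qed

lemma Z_conv:
  assumes "e > 0"
  shows "\<forall>\<^sub>F n in sequentially. \<forall>t. \<bar>measure (\<Omega> n) {\<omega>\<in>space (\<Omega> n). Z n (snd \<omega>) \<le> t} - Phi t\<bar> \<le> e"
proof -
  let ?\<mu> = "\<lambda>n. distr (smp n) borel (Z n)"
  have wc: "weak_conv_m ?\<mu> std_normal_distribution"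
    unfolding Z_def[abs_def] by (rule clt_array[OF prob_P X_measurable X_mean X_var ui_X])
  have rd: "real_distribution (?\<mu> n)" for n
  proof -
    interpret iid_law "P n" using prob_P by (simp add: iid_law_def)
    show ?thesis by (rule iid.real_distribution_distr[OF Z_measurable])
  qed
  have "cdf (?\<mu> n) t = measure (\<Omega> n) {\<omega>\<in>space (\<Omega> n). Z n (snd \<omega>) \<le> t}" for n t
  proof -
    note [measurable] = Z_measurable[of n]
    have "cdf (?\<mu> n) t = measure (smp n) (Z n -` {..t} \<inter> space (smp n))"
      by (simp add: cdf_def2 measure_distr)
    also have "Z n -` {..t} \<inter> space (smp n) = {s\<in>space (smp n). Z n s \<le> t}" by auto
    also have "measure (smp n) \<dots> = measure (\<Omega> n) {\<omega>\<in>space (\<Omega> n). Z n (snd \<omega>) \<le> t}"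
      by (rule prob_Omega_sample(2)[symmetric]) measurable
    finally show ?thesis .
  qed
  with weak_conv_std_normal_uniform[OF rd wc assms] show ?thesis by simp
qed

text \<open>Chebyshev with unit variance. This tightness bounds the factor that multiplies the error
  of the denominator in \<open>studentized_close\<close>.\<close>

lemma prob_Z_gt:
  assumes n: "n > 0" and A: "A > 0"
  shows "{\<omega>\<in>space (\<Omega> n). \<bar>Z n (snd \<omega>)\<bar> > A} \<in> sets (\<Omega> n)"
    and "measure (\<Omega> n) {\<omega>\<in>space (\<Omega> n). \<bar>Z n (snd \<omega>)\<bar> > A} \<le> 1 / A\<^sup>2"
proof -
  interpret iid_law "P n" using prob_P by (simp add: iid_law_def)
  note [measurable] = Z_measurable[of n]
  have s: "{s\<in>space (smp n). \<bar>Z n s\<bar> > A} \<in> sets (smp n)" by measurable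
  show "{\<omega>\<in>space (\<Omega> n). \<bar>Z n (snd \<omega>)\<bar> > A} \<in> sets (\<Omega> n)"
    by (rule prob_Omega_sample(1)[OF s])
  have eq: "\<bar>Z n s\<bar> > A \<longleftrightarrow> \<bar>\<Sum>i<n. X n (s i)\<bar> > A * sqrt (real n)" for s
    using n by (simp add: Z_def pos_less_divide_eq)
  have i2: "integrable (P n) (\<lambda>\<omega>. (X n \<omega>)\<^sup>2)" using ui_X by (simp add: unif_integrable_def)
  have "measure (\<Omega> n) {\<omega>\<in>space (\<Omega> n). \<bar>Z n (snd \<omega>)\<bar> > A} = measure (smp n) {s\<in>space (smp n). \<bar>Z n s\<bar> > A}"
    by (rule prob_Omega_sample(2)[OF s])
  also have "\<dots> \<le> real n * (\<integral>\<omega>. (X n \<omega>)\<^sup>2 \<partial>P n) / (A * sqrt (real n))\<^sup>2"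
    unfolding eq by (rule prob_iid_sum_gt[OF X_measurable i2 X_mean]) (use n A in simp)
  also have "\<dots> = 1 / A\<^sup>2" using n by (simp add: X_var power_mult_distrib)
  finally show "measure (\<Omega> n) {\<omega>\<in>space (\<Omega> n). \<bar>Z n (snd \<omega>)\<bar> > A} \<le> 1 / A\<^sup>2" .
qed

definition R :: "nat \<Rightarrow> real \<Rightarrow> ('a \<times> (nat \<Rightarrow> 'z obs)) set" where
  "R n \<delta> = {\<omega>\<in>space (\<Omega> n).
     \<bar>tauN w (fh n \<omega>) (gh n \<omega>) n (snd \<omega>) - (\<Sum>i<n. S n (snd \<omega> i)) / sqrt (real n)\<bar> > \<delta> \<or>
     \<bar>tauD w (fh n \<omega>) (gh n \<omega>) n (snd \<omega>) - esd n (\<lambda>i. S n (snd \<omega> i))\<bar> > \<delta>}"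

lemma R_eq: "R n \<delta> = {\<omega>\<in>space (Aux (P n) n \<Otimes>\<^sub>M smp n).
    gcm_dist.remainder_large (P n) w (fh n \<omega>) (gh n \<omega>) n \<delta> (snd \<omega>)}"
proof -
  interpret gcm_dist "P n" by (rule gcm_dist_P)
  show ?thesis unfolding R_def remainder_large_def Omega_eq Sprod_def S_def ..
qed

lemma R_sets: "R n \<delta> \<in> sets (\<Omega> n)"
proof -
  interpret gcm_aux "P n" "Aux (P n) n" AS "fhat n" "ghat n" w C n by (rule gcm_aux_P)
  show ?thesis unfolding R_eq unfolding Omega_eq by (rule remainder_large_sets)
qed

lemma R_small:
  assumes \<delta>: "\<delta> > 0" and e: "e > 0"
  shows "\<forall>\<^sub>F n in sequentially. measure (\<Omega> n) (R n \<delta>) \<le> e"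
proof -
  define d where "d = \<delta> / 3"
  have d: "d > 0" "3 * d = \<delta>" using \<delta> by (simp_all add: d_def)
  \<comment> \<open>Two demands on \<open>\<kappa>\<close>:
    \<open>C\<^sup>2 * \<kappa> \<le> d\<^sup>2\<close> for the product of errors, and
    \<open>4 * (C\<^sup>2 * \<kappa> / d\<^sup>2) \<le> e / 2\<close> for the Chebyshev and Markov
    parts. The added 1 prevents division by 0.\<close>
  define \<kappa> where "\<kappa> = d\<^sup>2 * min 1 (e / 8) / (C\<^sup>2 + 1)"
  have C1: "C\<^sup>2 + 1 > 0" by (simp add: add_nonneg_pos)
  have \<kappa>: "\<kappa> > 0" using d e C1 by (simp add: \<kappa>_def)
  have "C\<^sup>2 * \<kappa> = d\<^sup>2 * min 1 (e / 8) * (C\<^sup>2 / (C\<^sup>2 + 1))" by (simp add: \<kappa>_def)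
  also have "\<dots> \<le> d\<^sup>2 * min 1 (e / 8) * 1"
    using C1 e by (intro mult_left_mono mult_nonneg_nonneg) auto
  finally have C\<kappa>: "C\<^sup>2 * \<kappa> \<le> d\<^sup>2 * min 1 (e / 8)" by simp
  have "d\<^sup>2 * min 1 (e / 8) \<le> d\<^sup>2 * 1" "d\<^sup>2 * min 1 (e / 8) \<le> d\<^sup>2 * (e / 8)"
    by (intro mult_left_mono; simp)+
  with C\<kappa> have C\<kappa>2: "C\<^sup>2 * \<kappa> \<le> d\<^sup>2" "C\<^sup>2 * \<kappa> \<le> d\<^sup>2 * (e / 8)" by linarith+
  then have \<kappa>e: "4 * (C\<^sup>2 * \<kappa> / d\<^sup>2) \<le> e / 2" using d by (simp add: pos_divide_le_eq mult.commute)
  \<comment> \<open>The three probabilities enter with weights 1, 2 and 2, so five times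
    \<open>e / 10\<close> fills the other half of \<open>e\<close>.\<close>
  have e10: "e / 10 > 0" using e by simp
  show ?thesis
    using A_small[OF \<kappa> e10] Bf_small[OF \<kappa> e10] Bg_small[OF \<kappa> e10] eventually_gt_at_top[of 0]
  proof eventually_elim
    case (elim n)
    interpret gcm_aux "P n" "Aux (P n) n" AS "fhat n" "ghat n" w C n by (rule gcm_aux_P)
    show ?case
      using prob_remainder_le[OF elim(4) \<kappa> d(1) C\<kappa>2(1)] elim(1-3) \<kappa>e
      unfolding R_eq d(2) Omega_eq by linarith
  qed
qed

definition V :: "nat \<Rightarrow> real \<Rightarrow> ('a \<times> (nat \<Rightarrow> 'z obs)) set" where
  "V n \<delta> = {\<omega>\<in>space (\<Omega> n). \<bar>esd n (\<lambda>i. S n (snd \<omega> i)) - sqrt (sigma2P w (P n))\<bar> > \<delta>}"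

lemma esd_sets: "{s\<in>space (smp n). \<bar>esd n (\<lambda>i. S n (s i)) - sqrt (sigma2P w (P n))\<bar> > \<delta>} \<in> sets (smp n)"
proof -
  interpret iid_law "P n" using prob_P by (simp add: iid_law_def)
  note [measurable] = iid_component_measurable[OF S_measurable[of n]]
  show ?thesis unfolding esd_def by measurable
qed

lemma V_sets: "V n \<delta> \<in> sets (\<Omega> n)"
  unfolding V_def by (rule prob_Omega_sample(1)[OF esd_sets])

lemma V_small:
  assumes "\<delta> > 0" "e > 0"
  shows "\<forall>\<^sub>F n in sequentially. measure (\<Omega> n) (V n \<delta>) \<le> e"
  unfolding V_def prob_Omega_sample(2)[OF esd_sets]
  by (rule esd_conv_array[OF prob_P S_measurable ui_S sigma2_eq c sigma2 assms])

theorem tauD_consistent: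
  assumes \<delta>: "\<delta> > 0" and e: "e > 0"
  shows "\<forall>\<^sub>F n in sequentially. measure (\<Omega> n) {\<omega>\<in>space (\<Omega> n).
    \<bar>tauD w (fh n \<omega>) (gh n \<omega>) n (snd \<omega>) - sqrt (sigma2P w (P n))\<bar> > \<delta>} \<le> e"
proof -
  have h: "\<delta> / 2 > 0" "e / 2 > 0" using assms by auto
  show ?thesis
    using R_small[OF h] V_small[OF h]
  proof eventually_elim
    case (elim n)
    interpret prob_space "\<Omega> n" by (rule prob_Omega)
    have "prob {\<omega>\<in>space (\<Omega> n). \<bar>tauD w (fh n \<omega>) (gh n \<omega>) n (snd \<omega>) - sqrt (sigma2P w (P n))\<bar> > \<delta>}
        \<le> prob (R n (\<delta> / 2) \<union> V n (\<delta> / 2))"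
    proof (rule finite_measure_mono)
      show "R n (\<delta> / 2) \<union> V n (\<delta> / 2) \<in> events" using R_sets V_sets by auto
      show "{\<omega>\<in>space (\<Omega> n). \<bar>tauD w (fh n \<omega>) (gh n \<omega>) n (snd \<omega>) - sqrt (sigma2P w (P n))\<bar> > \<delta>}
        \<subseteq> R n (\<delta> / 2) \<union> V n (\<delta> / 2)"
      proof (intro subsetI, rule ccontr)
        fix \<omega> assume 1: "\<omega> \<in> {\<omega>\<in>space (\<Omega> n). \<bar>tauD w (fh n \<omega>) (gh n \<omega>) n (snd \<omega>) - sqrt (sigma2P w (P n))\<bar> > \<delta>}"
          and 2: "\<omega> \<notin> R n (\<delta> / 2) \<union> V n (\<delta> / 2)"
        have "\<bar>tauD w (fh n \<omega>) (gh n \<omega>) n (snd \<omega>) - sqrt (sigma2P w (P n))\<bar> > \<delta>"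
          "\<bar>tauD w (fh n \<omega>) (gh n \<omega>) n (snd \<omega>) - esd n (\<lambda>i. S n (snd \<omega> i))\<bar> \<le> \<delta> / 2"
          "\<bar>esd n (\<lambda>i. S n (snd \<omega> i)) - sqrt (sigma2P w (P n))\<bar> \<le> \<delta> / 2"
          using 1 2 by (auto simp: R_def V_def)
        then show False by linarith
      qed
    qed
    also have "\<dots> \<le> prob (R n (\<delta> / 2)) + prob (V n (\<delta> / 2))"
      by (rule measure_Un_le[OF R_sets V_sets])
    also have "\<dots> \<le> e" using elim by simp
    finally show ?case .
  qed
qed

text \<open>Outside \<open>R\<close>, \<open>V\<close> and the tail of \<open>Z\<close> this is the
  deterministic estimate \<open>studentized_close\<close>, with N the normalised sum of the
  \<open>S n\<close> values and r the centring \<open>sqrt (real n) * rhoP w (P n)\<close>. As r is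
  subtracted before division in both statistics, its size, possibly of order \<open>sqrt n\<close>,
  never enters the bound.\<close>

lemma Tstat_close:
  assumes \<kappa>: "\<kappa> > 0" and e: "e > 0"
  shows "\<forall>\<^sub>F n in sequentially. measure (\<Omega> n) {\<omega>\<in>space (\<Omega> n).
    \<bar>(Tstat w (fh n \<omega>) (gh n \<omega>) n (snd \<omega>)
      - sqrt (real n) * rhoP w (P n) / tauD w (fh n \<omega>) (gh n \<omega>) n (snd \<omega>)) - Z n (snd \<omega>)\<bar> > \<kappa>} \<le> e"
proof -
  \<comment> \<open>\<open>A\<close> precedes \<open>\<delta>\<close>, whose size depends on it. The
    tail of \<open>Z\<close> costs \<open>e / 2\<close>, and \<open>e / 4\<close> remains for each
    of \<open>R\<close> and \<open>V\<close>.\<close>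
  define A where "A = sqrt (2 / e)"
  have A: "A > 0" "1 / A\<^sup>2 = e / 2" using e by (simp_all add: A_def)
  define k where "k = sqrt c"
  have k: "k > 0" using c by (simp add: k_def)
  \<comment> \<open>The two entries of the minimum are the two smallness conditions of
    \<open>studentized_close\<close>.\<close>
  define \<delta> where "\<delta> = min (k / 4) (\<kappa> * k / (2 * (2 * A + 1)))"
  have \<delta>: "\<delta> > 0" using k \<kappa> A by (simp add: \<delta>_def add_pos_pos)
  have \<delta>4: "4 * \<delta> \<le> k" by (simp add: \<delta>_def min_le_iff_disj)
  have "2 * (2 * A + 1) * \<delta> \<le> 2 * (2 * A + 1) * (\<kappa> * k / (2 * (2 * A + 1)))"
    using A by (intro mult_left_mono) (auto simp: \<delta>_def)
  also have "\<dots> = \<kappa> * k" using A by (simp add: add_pos_pos)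
  finally have \<delta>\<kappa>: "2 * (2 * A + 1) * \<delta> \<le> \<kappa> * k" .
  have e4: "e / 4 > 0" using e by simp
  show ?thesis
    using R_small[OF \<delta> e4] V_small[OF \<delta> e4] eventually_gt_at_top[of 0]
  proof eventually_elim
    case (elim n)
    interpret prob_space "\<Omega> n" by (rule prob_Omega)
    let ?T = "\<lambda>\<omega>. Tstat w (fh n \<omega>) (gh n \<omega>) n (snd \<omega>)
      - sqrt (real n) * rhoP w (P n) / tauD w (fh n \<omega>) (gh n \<omega>) n (snd \<omega>)"
    let ?Z = "{\<omega>\<in>space (\<Omega> n). \<bar>Z n (snd \<omega>)\<bar> > A}"
    have k\<sigma>: "k \<le> sqrt (sigma2P w (P n))" unfolding k_def by (rule real_sqrt_le_mono[OF sigma2])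
    have Z: "Z n s = ((\<Sum>i<n. S n (s i)) / sqrt (real n) - sqrt (real n) * rhoP w (P n)) / sqrt (sigma2P w (P n))" for s
    proof -
      have "real n / sqrt (real n) = sqrt (real n)" by (rule real_div_sqrt) simp
      then show ?thesis
        by (simp add: Z_def X_def sum_divide_distrib[symmetric] sum_subtractf diff_divide_distrib mult.commute)
          (metis divide_divide_eq_left mult.commute times_divide_eq_left)
    qed
    have "prob {\<omega>\<in>space (\<Omega> n). \<bar>?T \<omega> - Z n (snd \<omega>)\<bar> > \<kappa>} \<le> prob (R n \<delta> \<union> V n \<delta> \<union> ?Z)"
    proof (rule finite_measure_mono)
      show "R n \<delta> \<union> V n \<delta> \<union> ?Z \<in> events" using R_sets V_sets prob_Z_gt(1)[OF elim(3) A(1)] by auto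
      show "{\<omega>\<in>space (\<Omega> n). \<bar>?T \<omega> - Z n (snd \<omega>)\<bar> > \<kappa>} \<subseteq> R n \<delta> \<union> V n \<delta> \<union> ?Z"
      proof (intro subsetI, rule ccontr)
        fix \<omega> assume 1: "\<omega> \<in> {\<omega>\<in>space (\<Omega> n). \<bar>?T \<omega> - Z n (snd \<omega>)\<bar> > \<kappa>}"
          and 2: "\<omega> \<notin> R n \<delta> \<union> V n \<delta> \<union> ?Z"
        have 3: "\<bar>tauN w (fh n \<omega>) (gh n \<omega>) n (snd \<omega>) - (\<Sum>i<n. S n (snd \<omega> i)) / sqrt (real n)\<bar> \<le> \<delta>"
          "\<bar>tauD w (fh n \<omega>) (gh n \<omega>) n (snd \<omega>) - esd n (\<lambda>i. S n (snd \<omega> i))\<bar> \<le> \<delta>"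
          "\<bar>esd n (\<lambda>i. S n (snd \<omega> i)) - sqrt (sigma2P w (P n))\<bar> \<le> \<delta>"
          "\<bar>Z n (snd \<omega>)\<bar> \<le> A"
          using 1 2 by (auto simp: R_def V_def)
        have "\<bar>?T \<omega> - Z n (snd \<omega>)\<bar> \<le> \<kappa>"
          unfolding Tstat_def Z
          by (rule studentized_close[OF k k\<sigma> 3(1-3) 3(4)[unfolded Z] less_imp_le[OF \<delta>] \<delta>4 \<delta>\<kappa>])
        with 1 show False by simp
      qed
    qed
    also have "\<dots> \<le> prob (R n \<delta>) + prob (V n \<delta>) + prob ?Z"
      using R_sets V_sets prob_Z_gt(1)[OF elim(3) A(1)]
      by (intro order_trans[OF measure_Un_le] add_right_mono) auto
    also have "\<dots> \<le> e" using elim(1,2) prob_Z_gt(2)[OF elim(3) A(1)] A(2) by simp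
    finally show ?case .
  qed
qed

theorem Tstat_asymptotically_normal:
  assumes e: "e > 0"
  shows "\<forall>\<^sub>F n in sequentially. \<forall>t. \<bar>measure (\<Omega> n) {\<omega>\<in>space (\<Omega> n).
    Tstat w (fh n \<omega>) (gh n \<omega>) n (snd \<omega>)
      - sqrt (real n) * rhoP w (P n) / tauD w (fh n \<omega>) (gh n \<omega>) n (snd \<omega>) \<le> t} - Phi t\<bar> \<le> e"
proof (rule slutsky_uniform[OF prob_Omega Z_Omega_measurable _ Z_conv Tstat_close e])
  show "\<forall>\<^sub>F n in sequentially. (\<lambda>\<omega>. Tstat w (fh n \<omega>) (gh n \<omega>) n (snd \<omega>)
      - sqrt (real n) * rhoP w (P n) / tauD w (fh n \<omega>) (gh n \<omega>) n (snd \<omega>)) \<in> borel_measurable (\<Omega> n)"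
  proof (rule always_eventually, rule allI)
    fix n
    interpret gcm_aux "P n" "Aux (P n) n" AS "fhat n" "ghat n" w C n by (rule gcm_aux_P)
    show "(\<lambda>\<omega>. Tstat w (fh n \<omega>) (gh n \<omega>) n (snd \<omega>)
      - sqrt (real n) * rhoP w (P n) / tauD w (fh n \<omega>) (gh n \<omega>) n (snd \<omega>)) \<in> borel_measurable (\<Omega> n)"
      unfolding Omega_eq Tstat_def by measurable
  qed
qed

end

section \<open>Sources of uniform integrability, and passage from sequences to families\<close>

lemma tail_mean_arbitrarily_small:
  assumes h: "integrable M h" and e: "e > 0"
  shows "\<exists>K\<ge>0. tail_mean M h K \<le> e"
proof -
  \<comment> \<open>Dominated convergence: at each point the integrand is 0 as soon as the level
    reaches \<open>\<bar>h x\<bar>\<close>.\<close>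
  have "(\<lambda>k. tail_mean M h (real k)) \<longlonglongrightarrow> (\<integral>x. 0 \<partial>M)"
    unfolding tail_mean_def
  proof (rule integral_dominated_convergence[where w="\<lambda>x. \<bar>h x\<bar>"])
    have [measurable]: "h \<in> borel_measurable M" using h by auto
    show "(\<lambda>x. if \<bar>h x\<bar> > real k then \<bar>h x\<bar> else 0) \<in> borel_measurable M" for k
      by measurable
    show "AE x in M. (\<lambda>k. if \<bar>h x\<bar> > real k then \<bar>h x\<bar> else 0) \<longlonglongrightarrow> 0"
    proof (rule AE_I2)
      fix x
      have "\<forall>\<^sub>F k in sequentially. (if \<bar>h x\<bar> > real k then \<bar>h x\<bar> else 0) = 0"
        using eventually_ge_at_top[of "nat \<lceil>\<bar>h x\<bar>\<rceil>"] by eventually_elim (auto simp: not_less nat_le_iff ceiling_le_iff)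
      then show "(\<lambda>k. if \<bar>h x\<bar> > real k then \<bar>h x\<bar> else 0) \<longlonglongrightarrow> 0"
        by (rule tendsto_eventually)
    qed
  qed (use h in auto)
  then have "\<forall>\<^sub>F k in sequentially. tail_mean M h (real k) \<le> e"
    using e by (intro tendsto_0_real_eventually_le) auto
  then show ?thesis
    unfolding eventually_sequentially by (meson of_nat_0_le_iff order_refl)
qed

lemma unif_integrable_const: "integrable M h \<Longrightarrow> unif_integrable (\<lambda>_. M) (\<lambda>_. h)"
  by (auto simp: unif_integrable_def tail_mean_arbitrarily_small)

text \<open>Excess exponent is traded for smallness: the square is
  \<open>\<bar>S n x\<bar> powr (2 + \<eta>)\<close> times
  \<open>\<bar>S n x\<bar> powr (- \<eta>)\<close>, and beyond the level \<open>k\<close> the second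
  factor is at most \<open>k powr (- \<eta>)\<close>.\<close>

lemma unif_integrable_square_of_moment:
  assumes M: "\<And>n. prob_space (M n)" and S: "\<And>n. S n \<in> borel_measurable (M n)"
    and \<eta>: "\<eta> > 0" and mom: "\<And>n. (\<integral>\<^sup>+x. ennreal (\<bar>S n x\<bar> powr (2 + \<eta>)) \<partial>M n) \<le> ennreal B"
  shows "unif_integrable M (\<lambda>n x. (S n x)\<^sup>2)"
proof -
  \<comment> \<open>\<open>B\<close> may be negative, in which case \<open>ennreal B\<close> is 0;
    \<open>D\<close> is a positive bound, by which one can divide.\<close>
  define D where "D = max B 0 + 1"
  have D: "D > 0" by (simp add: D_def)
  let ?G = "\<lambda>n x. \<bar>S n x\<bar> powr (2 + \<eta>)"
  have iG: "integrable (M n) (?G n)" for n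
    using S[of n] mom[of n] by (intro integrableI_bounded) (auto intro: le_less_trans)
  have eG: "(\<integral>x. ?G n x \<partial>M n) \<le> D" for n
  proof -
    have "ennreal (\<integral>x. ?G n x \<partial>M n) \<le> ennreal B"
      using mom[of n] by (subst nn_integral_eq_integral[symmetric, OF iG]) auto
    also have "\<dots> \<le> ennreal D" by (intro ennreal_leI) (simp add: D_def)
    finally show ?thesis using D by (simp add: ennreal_le_iff)
  qed
  have sq: "(S n x)\<^sup>2 = \<bar>S n x\<bar> powr 2" for n x
    by (cases "S n x = 0") (simp_all add: powr_numeral)
  have i2: "integrable (M n) (\<lambda>x. (S n x)\<^sup>2)" for n
  proof -
    interpret prob_space "M n" by (rule M)
    show ?thesis
    proof (rule Bochner_Integration.integrable_bound[of _ "\<lambda>x. 1 + ?G n x"])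
      have "(S n x)\<^sup>2 \<le> 1 + ?G n x" for x
      proof (cases "\<bar>S n x\<bar> \<le> 1")
        case True
        then have "(S n x)\<^sup>2 \<le> 1" by (simp add: abs_square_le_1)
        then show ?thesis by (simp add: add_increasing2)
      next
        case False
        then have "\<bar>S n x\<bar> powr 2 \<le> ?G n x" using \<eta> by (intro powr_mono) auto
        then show ?thesis unfolding sq by simp
      qed
      then show "AE x in M n. norm ((S n x)\<^sup>2) \<le> norm (1 + ?G n x)"
        by (intro AE_I2) simp
    qed (use iG S in auto)
  qed
  show ?thesis
    unfolding unif_integrable_def
  proof (intro conjI allI impI i2)
    fix e :: real assume e: "e > 0"
    \<comment> \<open>The solution of \<open>k powr (- \<eta>) = e / D\<close>.\<close>
    define k where "k = (D / e) powr (1 / \<eta>)"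
    have k: "k > 0" using D e by (simp add: k_def)
    have "k powr (- \<eta>) = (D / e) powr (-1)" using \<eta> by (simp add: k_def powr_powr)
    also have "\<dots> = e / D" using D e by (simp add: powr_minus)
    finally have kp: "k powr (- \<eta>) = e / D" .
    show "\<exists>K\<ge>0. \<forall>n. tail_mean (M n) (\<lambda>x. (S n x)\<^sup>2) K \<le> e"
    proof (intro exI[of _ "k\<^sup>2"] conjI allI)
      fix n
      interpret iid_law "M n" using M by (simp add: iid_law_def)
      have "tail_mean (M n) (\<lambda>x. (S n x)\<^sup>2) (k\<^sup>2) \<le> (\<integral>x. e / D * ?G n x \<partial>M n)"
        unfolding tail_mean_def
      proof (intro integral_mono integrable_tail_mean i2 integrable_mult_right iG)
        fix x
        show "(if \<bar>(S n x)\<^sup>2\<bar> > k\<^sup>2 then \<bar>(S n x)\<^sup>2\<bar> else 0) \<le> e / D * ?G n x"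
        proof (cases "(S n x)\<^sup>2 > k\<^sup>2")
          case True
          then have kS: "k < \<bar>S n x\<bar>" using k by (metis abs_le_square_iff abs_of_pos not_le)
          have "\<bar>S n x\<bar> powr 2 = \<bar>S n x\<bar> powr (- \<eta>) * ?G n x"
            by (simp add: powr_add[symmetric])
          also have "\<dots> \<le> k powr (- \<eta>) * ?G n x"
            using kS k \<eta> by (intro mult_right_mono powr_mono2') auto
          finally show ?thesis using True kp by (simp add: sq[symmetric])
        next
          case False
          then show ?thesis using e D by simp
        qed
      qed
      also have "\<dots> = e / D * (\<integral>x. ?G n x \<partial>M n)" by simp
      also have "\<dots> \<le> e / D * D" using eG[of n] e D by (intro mult_left_mono) auto
      also have "\<dots> = e" using D by simp
      finally show "tail_mean (M n) (\<lambda>x. (S n x)\<^sup>2) (k\<^sup>2) \<le> e" .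
    qed simp
  qed
qed

text \<open>At each \<open>n\<close> pick an element violating \<open>Q n\<close> if there is one.
  Along this sequence violations eventually stop, and from then on no element violates.\<close>

lemma eventually_ball_of_sequences:
  assumes seq: "\<And>p. (\<And>n. p n \<in> A) \<Longrightarrow> \<forall>\<^sub>F n in sequentially. Q n (p n)"
  shows "\<forall>\<^sub>F n in sequentially. \<forall>x\<in>A. Q n x"
proof (cases "A = {}")
  case False
  then have "\<forall>n. \<exists>x. x \<in> A \<and> ((\<exists>y\<in>A. \<not> Q n y) \<longrightarrow> \<not> Q n x)" by blast
  then obtain p where p: "\<And>n. p n \<in> A" "\<And>n. (\<exists>y\<in>A. \<not> Q n y) \<longrightarrow> \<not> Q n (p n)" by metis
  from seq[OF p(1)] show ?thesis by eventually_elim (use p(2) in blast)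
qed simp

text \<open>The order 1/n is encoded by multiplying with \<open>real n\<close>. In the second part
  suprema over laws are written as bounds that eventually hold for all laws at once, which avoids
  real suprema over a possibly empty family. Integrability of \<open>xc\<close> and
  \<open>yc\<close> expresses that the regression functions exist as conditional means.\<close>

theorem theorem2:
  fixes w :: "'z::euclidean_space \<Rightarrow> real" and C :: real
    and AS :: "'a measure" and Aux :: "'z obs measure \<Rightarrow> nat \<Rightarrow> 'a measure"
    and fhat ghat :: "nat \<Rightarrow> 'a \<Rightarrow> 'z \<Rightarrow> real"
  assumes w_meas: "w \<in> borel_measurable borel"
    and C_pos: "C > 0" and w_bdd: "\<And>z. \<bar>w z\<bar> \<le> C"
    and Aux_prob: "\<And>P n. P \<in> E0 \<Longrightarrow> prob_space (Aux P n)"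
    and Aux_sets: "\<And>P n. P \<in> E0 \<Longrightarrow> sets (Aux P n) = sets AS"
    and fhat_meas: "\<And>n. (\<lambda>(a, z). fhat n a z) \<in> borel_measurable (AS \<Otimes>\<^sub>M borel)"
    and ghat_meas: "\<And>n. (\<lambda>(a, z). ghat n a z) \<in> borel_measurable (AS \<Otimes>\<^sub>M borel)"
  shows
   "(\<forall>P \<in> E0.
      integrable P xc \<and> integrable P yc
      \<and> (\<forall>\<delta>>0. (\<lambda>n. \<P>(\<omega> in Omega Aux P n.
            \<bar>Af P (fhat n (fst \<omega>)) n (snd \<omega>) * Ag P (ghat n (fst \<omega>)) n (snd \<omega>) * real n\<bar> > \<delta>))
           \<longlonglongrightarrow> 0)
      \<and> (\<forall>\<delta>>0. (\<lambda>n. \<P>(\<omega> in Omega Aux P n. Bf P (fhat n (fst \<omega>)) n (snd \<omega>) > ennreal \<delta>))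
           \<longlonglongrightarrow> 0)
      \<and> (\<forall>\<delta>>0. (\<lambda>n. \<P>(\<omega> in Omega Aux P n. Bg P (ghat n (fst \<omega>)) n (snd \<omega>) > ennreal \<delta>))
           \<longlonglongrightarrow> 0)
      \<and> sigma2P w P > 0
      \<and> (\<integral>\<^sup>+ \<omega>. ennreal ((epsP P \<omega>)\<^sup>2 * (xiP P \<omega>)\<^sup>2) \<partial>P) < \<infinity>
    \<longrightarrow> (\<lambda>n. SUP t::real. \<bar>\<P>(\<omega> in Omega Aux P n.
            Tstat w (fhat n (fst \<omega>)) (ghat n (fst \<omega>)) n (snd \<omega>)
            - sqrt (real n) * rhoP w P / tauD w (fhat n (fst \<omega>)) (ghat n (fst \<omega>)) n (snd \<omega>) \<le> t)
            - Phi t\<bar>) \<longlonglongrightarrow> 0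
      \<and> (\<forall>\<delta>>0. (\<lambda>n. \<P>(\<omega> in Omega Aux P n.
            \<bar>tauD w (fhat n (fst \<omega>)) (ghat n (fst \<omega>)) n (snd \<omega>) - sqrt (sigma2P w P)\<bar> > \<delta>))
           \<longlonglongrightarrow> 0))
   \<and>
   (\<forall>\<PP> \<subseteq> E0.
      (\<forall>P\<in>\<PP>. integrable P xc \<and> integrable P yc)
      \<and> (\<forall>\<delta>>0. \<forall>e>0. \<forall>\<^sub>F n in sequentially. \<forall>P\<in>\<PP>. \<P>(\<omega> in Omega Aux P n.
            \<bar>Af P (fhat n (fst \<omega>)) n (snd \<omega>) * Ag P (ghat n (fst \<omega>)) n (snd \<omega>) * real n\<bar> > \<delta>) \<le> e)
      \<and> (\<forall>\<delta>>0. \<forall>e>0. \<forall>\<^sub>F n in sequentially. \<forall>P\<in>\<PP>. \<P>(\<omega> in Omega Aux P n.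
            Bf P (fhat n (fst \<omega>)) n (snd \<omega>) > ennreal \<delta>) \<le> e)
      \<and> (\<forall>\<delta>>0. \<forall>e>0. \<forall>\<^sub>F n in sequentially. \<forall>P\<in>\<PP>. \<P>(\<omega> in Omega Aux P n.
            Bg P (ghat n (fst \<omega>)) n (snd \<omega>) > ennreal \<delta>) \<le> e)
      \<and> (\<exists>c>0. \<forall>P\<in>\<PP>. sigma2P w P \<ge> c)
      \<and> (\<exists>\<eta>>0. \<exists>M::real. \<forall>P\<in>\<PP>.
            (\<integral>\<^sup>+ \<omega>. ennreal (\<bar>epsP P \<omega> * xiP P \<omega>\<bar> powr (2 + \<eta>)) \<partial>P) \<le> ennreal M)
    \<longrightarrow> (\<forall>e>0. \<forall>\<^sub>F n in sequentially. \<forall>P\<in>\<PP>. \<forall>t::real. \<bar>\<P>(\<omega> in Omega Aux P n.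
            Tstat w (fhat n (fst \<omega>)) (ghat n (fst \<omega>)) n (snd \<omega>)
            - sqrt (real n) * rhoP w P / tauD w (fhat n (fst \<omega>)) (ghat n (fst \<omega>)) n (snd \<omega>) \<le> t)
            - Phi t\<bar> \<le> e))"
proof (intro conjI ballI impI allI)
  fix P :: "'z obs measure"
  assume P: "P \<in> E0" and H: "integrable P xc \<and> integrable P yc
      \<and> (\<forall>\<delta>>0. (\<lambda>n. \<P>(\<omega> in Omega Aux P n.
            \<bar>Af P (fhat n (fst \<omega>)) n (snd \<omega>) * Ag P (ghat n (fst \<omega>)) n (snd \<omega>) * real n\<bar> > \<delta>))
           \<longlonglongrightarrow> 0)
      \<and> (\<forall>\<delta>>0. (\<lambda>n. \<P>(\<omega> in Omega Aux P n. Bf P (fhat n (fst \<omega>)) n (snd \<omega>) > ennreal \<delta>))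
           \<longlonglongrightarrow> 0)
      \<and> (\<forall>\<delta>>0. (\<lambda>n. \<P>(\<omega> in Omega Aux P n. Bg P (ghat n (fst \<omega>)) n (snd \<omega>) > ennreal \<delta>))
           \<longlonglongrightarrow> 0)
      \<and> sigma2P w P > 0
      \<and> (\<integral>\<^sup>+ \<omega>. ennreal ((epsP P \<omega>)\<^sup>2 * (xiP P \<omega>)\<^sup>2) \<partial>P) < \<infinity>"
  have H1: "integrable P xc" "integrable P yc" "sigma2P w P > 0" using H by blast+
  let ?S = "\<lambda>\<omega>. epsP P \<omega> * xiP P \<omega> * w (zc \<omega>)"
  interpret gcm_dist P using E0_D[OF P] by (simp add: gcm_dist_def gcm_dist_axioms_def)
  note [measurable] = w_meas
  have "integrable P (\<lambda>\<omega>. (epsP P \<omega>)\<^sup>2 * (xiP P \<omega>)\<^sup>2)"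
    using H by (intro integrableI_bounded) auto
  then have "integrable P (\<lambda>\<omega>. C\<^sup>2 * ((epsP P \<omega>)\<^sup>2 * (xiP P \<omega>)\<^sup>2))" by simp
  then have "integrable P (\<lambda>\<omega>. (?S \<omega>)\<^sup>2)"
  proof (rule Bochner_Integration.integrable_bound)
    have "(w z)\<^sup>2 \<le> C\<^sup>2" for z using w_bdd[of z] C_pos by (simp add: power2_le_iff_abs_le)
    then have "(?S \<omega>)\<^sup>2 \<le> C\<^sup>2 * ((epsP P \<omega>)\<^sup>2 * (xiP P \<omega>)\<^sup>2)" for \<omega>
      by (simp add: power_mult_distrib mult.commute[of "C\<^sup>2"] mult_left_mono)
    then show "AE \<omega> in P. norm ((?S \<omega>)\<^sup>2) \<le> norm (C\<^sup>2 * ((epsP P \<omega>)\<^sup>2 * (xiP P \<omega>)\<^sup>2))"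
      by (intro AE_I2) simp
  qed measurable
  then have ui: "unif_integrable (\<lambda>_. P) (\<lambda>_ \<omega>. (?S \<omega>)\<^sup>2)" by (rule unif_integrable_const)
  \<comment> \<open>For a single law the variance itself serves as the lower bound
    \<open>c\<close>.\<close>
  interpret seq: gcm_sequence w C AS Aux fhat ghat "\<lambda>_. P" "sigma2P w P"
  proof (rule gcm_sequence.intro)
    fix \<delta> e :: real assume de: "\<delta> > 0" "e > 0"
    show "\<forall>\<^sub>F n in sequentially. \<P>(\<omega> in Omega Aux P n.
       \<bar>Af P (fhat n (fst \<omega>)) n (snd \<omega>) * Ag P (ghat n (fst \<omega>)) n (snd \<omega>) * real n\<bar> > \<delta>) \<le> e"
      using H de by (intro tendsto_0_real_eventually_le) blast+
    show "\<forall>\<^sub>F n in sequentially. \<P>(\<omega> in Omega Aux P n. Bf P (fhat n (fst \<omega>)) n (snd \<omega>) > ennreal \<delta>) \<le> e"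
      using H de by (intro tendsto_0_real_eventually_le) blast+
    show "\<forall>\<^sub>F n in sequentially. \<P>(\<omega> in Omega Aux P n. Bg P (ghat n (fst \<omega>)) n (snd \<omega>) > ennreal \<delta>) \<le> e"
      using H de by (intro tendsto_0_real_eventually_le) blast+
  qed (rule w_meas w_bdd Aux_prob[OF P] Aux_sets[OF P] fhat_meas ghat_meas P H1 order_refl ui)+
  show "(\<lambda>n. SUP t::real. \<bar>\<P>(\<omega> in Omega Aux P n.
            Tstat w (fhat n (fst \<omega>)) (ghat n (fst \<omega>)) n (snd \<omega>)
            - sqrt (real n) * rhoP w P / tauD w (fhat n (fst \<omega>)) (ghat n (fst \<omega>)) n (snd \<omega>) \<le> t)
            - Phi t\<bar>) \<longlonglongrightarrow> 0" (is "(\<lambda>n. SUP t. ?f n t) \<longlonglongrightarrow> 0")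
  proof (rule tendsto_0_realI)
    fix n
    interpret O: prob_space "Omega Aux P n" by (rule seq.prob_Omega)
    \<comment> \<open>A real supremum has its intended meaning only on a set bounded above; both
      quantities lie in [0, 1].\<close>
    have "\<bar>O.prob B - Phi t\<bar> \<le> 1" for B t
      using Phi_nonneg[of t] Phi_le_1[of t] O.prob_le_1[of B] measure_nonneg[of "Omega Aux P n" B]
      by linarith
    then have "bdd_above (range (?f n))" by (intro bdd_aboveI[of _ 1]) auto
    then show "(SUP t. ?f n t) \<ge> 0" by (rule cSUP_upper2[of _ _ 0]) auto
  next
    fix e :: real assume "e > 0"
    from seq.Tstat_asymptotically_normal[OF this]
    show "\<forall>\<^sub>F n in sequentially. (SUP t. ?f n t) \<le> e"
      by eventually_elim (rule cSUP_least, auto)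
  qed
  show "(\<lambda>n. \<P>(\<omega> in Omega Aux P n.
            \<bar>tauD w (fhat n (fst \<omega>)) (ghat n (fst \<omega>)) n (snd \<omega>) - sqrt (sigma2P w P)\<bar> > \<delta>))
           \<longlonglongrightarrow> 0" if "\<delta> > 0" for \<delta>
    by (rule tendsto_0_realI) (use seq.tauD_consistent[OF that] in auto)
next
  fix \<PP> :: "'z obs measure set" and e :: real
  assume PP: "\<PP> \<subseteq> E0" and e: "e > 0" and H: "(\<forall>P\<in>\<PP>. integrable P xc \<and> integrable P yc)
      \<and> (\<forall>\<delta>>0. \<forall>e>0. \<forall>\<^sub>F n in sequentially. \<forall>P\<in>\<PP>. \<P>(\<omega> in Omega Aux P n.
            \<bar>Af P (fhat n (fst \<omega>)) n (snd \<omega>) * Ag P (ghat n (fst \<omega>)) n (snd \<omega>) * real n\<bar> > \<delta>) \<le> e)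
      \<and> (\<forall>\<delta>>0. \<forall>e>0. \<forall>\<^sub>F n in sequentially. \<forall>P\<in>\<PP>. \<P>(\<omega> in Omega Aux P n.
            Bf P (fhat n (fst \<omega>)) n (snd \<omega>) > ennreal \<delta>) \<le> e)
      \<and> (\<forall>\<delta>>0. \<forall>e>0. \<forall>\<^sub>F n in sequentially. \<forall>P\<in>\<PP>. \<P>(\<omega> in Omega Aux P n.
            Bg P (ghat n (fst \<omega>)) n (snd \<omega>) > ennreal \<delta>) \<le> e)
      \<and> (\<exists>c>0. \<forall>P\<in>\<PP>. sigma2P w P \<ge> c)
      \<and> (\<exists>\<eta>>0. \<exists>M::real. \<forall>P\<in>\<PP>.
            (\<integral>\<^sup>+ \<omega>. ennreal (\<bar>epsP P \<omega> * xiP P \<omega>\<bar> powr (2 + \<eta>)) \<partial>P) \<le> ennreal M)"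
  have H1: "\<And>P. P \<in> \<PP> \<Longrightarrow> integrable P xc" "\<And>P. P \<in> \<PP> \<Longrightarrow> integrable P yc" using H by blast+
  note Hs = H[THEN conjunct2]
  note A_small = Hs[THEN conjunct1] and Bf_small = Hs[THEN conjunct2, THEN conjunct1]
    and Bg_small = Hs[THEN conjunct2, THEN conjunct2, THEN conjunct1]
    and sigma = Hs[THEN conjunct2, THEN conjunct2, THEN conjunct2, THEN conjunct1]
    and moment = Hs[THEN conjunct2, THEN conjunct2, THEN conjunct2, THEN conjunct2]
  obtain c where c: "c > 0" "\<And>P. P \<in> \<PP> \<Longrightarrow> sigma2P w P \<ge> c" using sigma by blast
  obtain \<eta> M where \<eta>: "\<eta> > 0" and M: "\<And>P. P \<in> \<PP> \<Longrightarrow>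
      (\<integral>\<^sup>+ \<omega>. ennreal (\<bar>epsP P \<omega> * xiP P \<omega>\<bar> powr (2 + \<eta>)) \<partial>P) \<le> ennreal M" using moment by blast
  show "\<forall>\<^sub>F n in sequentially. \<forall>P\<in>\<PP>. \<forall>t::real. \<bar>\<P>(\<omega> in Omega Aux P n.
            Tstat w (fhat n (fst \<omega>)) (ghat n (fst \<omega>)) n (snd \<omega>)
            - sqrt (real n) * rhoP w P / tauD w (fhat n (fst \<omega>)) (ghat n (fst \<omega>)) n (snd \<omega>) \<le> t)
            - Phi t\<bar> \<le> e"
  proof (rule eventually_ball_of_sequences)
    fix p :: "nat \<Rightarrow> 'z obs measure" assume pPP: "\<And>n. p n \<in> \<PP>"
    then have pE0: "\<And>n. p n \<in> E0" using PP by blast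
    note pr = E0_D[OF pE0]
    let ?S = "\<lambda>n \<omega>. epsP (p n) \<omega> * xiP (p n) \<omega> * w (zc \<omega>)"
    have ui: "unif_integrable p (\<lambda>n \<omega>. (?S n \<omega>)\<^sup>2)"
    proof (rule unif_integrable_square_of_moment[OF pr(1) _ \<eta>])
      fix n
      interpret gcm_dist "p n" using pr by (simp add: gcm_dist_def gcm_dist_axioms_def)
      note [measurable] = w_meas
      show "?S n \<in> borel_measurable (p n)" by measurable
      have "(\<integral>\<^sup>+\<omega>. ennreal (\<bar>?S n \<omega>\<bar> powr (2 + \<eta>)) \<partial>p n)
          \<le> (\<integral>\<^sup>+\<omega>. ennreal (C powr (2 + \<eta>)) * ennreal (\<bar>epsP (p n) \<omega> * xiP (p n) \<omega>\<bar> powr (2 + \<eta>)) \<partial>p n)"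
      proof (rule nn_integral_mono)
        fix \<omega>
        have "\<bar>?S n \<omega>\<bar> powr (2 + \<eta>) \<le> (C * \<bar>epsP (p n) \<omega> * xiP (p n) \<omega>\<bar>) powr (2 + \<eta>)"
          unfolding abs_mult[of _ "w (zc \<omega>)"] using w_bdd[of "zc \<omega>"] \<eta>
          by (intro powr_mono2) (auto simp: mult.commute[of C] intro: mult_left_mono)
        also have "\<dots> = C powr (2 + \<eta>) * \<bar>epsP (p n) \<omega> * xiP (p n) \<omega>\<bar> powr (2 + \<eta>)"
          using C_pos by (simp add: powr_mult)
        finally show "ennreal (\<bar>?S n \<omega>\<bar> powr (2 + \<eta>))
            \<le> ennreal (C powr (2 + \<eta>)) * ennreal (\<bar>epsP (p n) \<omega> * xiP (p n) \<omega>\<bar> powr (2 + \<eta>))"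
          by (simp add: ennreal_mult[symmetric] ennreal_leI)
      qed
      also have "\<dots> = ennreal (C powr (2 + \<eta>)) * (\<integral>\<^sup>+\<omega>. ennreal (\<bar>epsP (p n) \<omega> * xiP (p n) \<omega>\<bar> powr (2 + \<eta>)) \<partial>p n)"
        by (rule nn_integral_cmult) measurable
      \<comment> \<open>\<open>M\<close> may be negative; \<open>ennreal M\<close> is then 0 and
        agrees with \<open>ennreal (max M 0)\<close>.\<close>
      also have "\<dots> \<le> ennreal (C powr (2 + \<eta>)) * ennreal (max M 0)"
        using M[OF pPP[of n]] by (intro mult_left_mono) (auto simp: max_def ennreal_neg)
      also have "\<dots> = ennreal (C powr (2 + \<eta>) * max M 0)" by (simp add: ennreal_mult)
      finally show "(\<integral>\<^sup>+\<omega>. ennreal (\<bar>?S n \<omega>\<bar> powr (2 + \<eta>)) \<partial>p n) \<le> ennreal (C powr (2 + \<eta>) * max M 0)" .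
    qed
    interpret seq: gcm_sequence w C AS Aux fhat ghat p c
    proof (rule gcm_sequence.intro)
      show "\<forall>\<^sub>F n in sequentially. \<P>(\<omega> in Omega Aux (p n) n.
         \<bar>Af (p n) (fhat n (fst \<omega>)) n (snd \<omega>) * Ag (p n) (ghat n (fst \<omega>)) n (snd \<omega>) * real n\<bar> > \<delta>) \<le> e"
        "\<forall>\<^sub>F n in sequentially. \<P>(\<omega> in Omega Aux (p n) n. Bf (p n) (fhat n (fst \<omega>)) n (snd \<omega>) > ennreal \<delta>) \<le> e"
        "\<forall>\<^sub>F n in sequentially. \<P>(\<omega> in Omega Aux (p n) n. Bg (p n) (ghat n (fst \<omega>)) n (snd \<omega>) > ennreal \<delta>) \<le> e"
        if de: "\<delta> > 0" "e > 0" for \<delta> e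
      proof -
        have ev: "\<forall>\<^sub>F n in sequentially. Q n (p n)"
          if "\<forall>\<^sub>F n in sequentially. \<forall>P\<in>\<PP>. Q n P" for Q :: "nat \<Rightarrow> 'z obs measure \<Rightarrow> bool"
          using that by eventually_elim (rule bspec[OF _ pPP])
        show "\<forall>\<^sub>F n in sequentially. \<P>(\<omega> in Omega Aux (p n) n.
           \<bar>Af (p n) (fhat n (fst \<omega>)) n (snd \<omega>) * Ag (p n) (ghat n (fst \<omega>)) n (snd \<omega>) * real n\<bar> > \<delta>) \<le> e"
          by (rule ev[OF A_small[rule_format, OF de]])
        show "\<forall>\<^sub>F n in sequentially. \<P>(\<omega> in Omega Aux (p n) n. Bf (p n) (fhat n (fst \<omega>)) n (snd \<omega>) > ennreal \<delta>) \<le> e"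
          by (rule ev[OF Bf_small[rule_format, OF de]])
        show "\<forall>\<^sub>F n in sequentially. \<P>(\<omega> in Omega Aux (p n) n. Bg (p n) (ghat n (fst \<omega>)) n (snd \<omega>) > ennreal \<delta>) \<le> e"
          by (rule ev[OF Bg_small[rule_format, OF de]])
      qed
    qed (rule w_meas w_bdd Aux_prob[OF pE0] Aux_sets[OF pE0] fhat_meas ghat_meas pE0 H1[OF pPP] c(1) c(2)[OF pPP] ui)+
    show "\<forall>\<^sub>F n in sequentially. \<forall>t::real. \<bar>\<P>(\<omega> in Omega Aux (p n) n.
            Tstat w (fhat n (fst \<omega>)) (ghat n (fst \<omega>)) n (snd \<omega>)
            - sqrt (real n) * rhoP w (p n) / tauD w (fhat n (fst \<omega>)) (ghat n (fst \<omega>)) n (snd \<omega>) \<le> t)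
            - Phi t\<bar> \<le> e"
      by (rule seq.Tstat_asymptotically_normal[OF e])
  qed
qed

end
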